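(* For every integer $t\ge4$, every odd integer $\ell\ge5$ and every density $0<d\le 1/2$, we have $p(n;K_t,C_\ell,d)=n^{-2/(t-1)}$.
   Context: $K_t$ is the complete graph on $t$ vertices and $C_\ell$ the cycle of length $\ell$. A graph $G$ is $(H_1,H_2)$-Ramsey if every red/blue colouring of its edges contains a red copy of $H_1$ or a blue copy of $H_2$. The density of an $n$-vertex graph $G$ is $e(G)/\binom n2$. $G(n,p)$ is the binomial random graph on $[n]$ and $G_n\cup G(n,p)$ the union graph on $[n]$. The perturbed Ramsey threshold $p(n;H_1,H_2,d)$ is a function such that: (i) if $p=\omega(p(n;H_1,H_2,d))$ then for every sequence $(G_n)$ of $n$-vertex graphs of density at least $d$, $G_n\cup G(n,p)$ is $(H_1,H_2)$-Ramsey with high probability; (ii) if $p=o(p(n;H_1,H_2,d))$ then for some sequence $(G_n)$ of $n$-vertex graphs of density at least $d$, with high probability $G_n\cup G(n,p)$ is not $(H_1,H_2)$-Ramsey. *)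

theory Defs
  imports Complex_Main "HOL-Library.Landau_Symbols"
begin

text \<open>Simple graphs on vertex set [n] = {0..<n}, represented by their edge sets
  (sets of 2-element subsets).\<close>

definition all_edges :: "nat \<Rightarrow> nat set set" where
  "all_edges n = {e. \<exists>u v. u < n \<and> v < n \<and> u \<noteq> v \<and> e = {u, v}}"

definition complete_graph :: "nat \<Rightarrow> nat set set" where
  "complete_graph t = all_edges t"

definition cycle_graph :: "nat \<Rightarrow> nat set set" where
  "cycle_graph l = {{i, (i + 1) mod l} | i. i < l}"

definition has_copy :: "nat set set \<Rightarrow> nat \<Rightarrow> nat set set \<Rightarrow> bool" where
  "has_copy H k G = (\<exists>f. inj_on f {0..<k} \<and> (\<forall>e\<in>H. f ` e \<in> G))"

text \<open>(H1,H2)-Ramsey: for every red/blue colouring of the edges of G (R = red edges,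
  G - R = blue edges) there is a red copy of H1 or a blue copy of H2.\<close>
definition is_ramsey :: "nat set set \<Rightarrow> nat set set \<Rightarrow> nat \<Rightarrow> nat set set \<Rightarrow> nat \<Rightarrow> bool" where
  "is_ramsey G H1 k1 H2 k2 = (\<forall>R. R \<subseteq> G \<longrightarrow> has_copy H1 k1 R \<or> has_copy H2 k2 (G - R))"

definition density :: "nat \<Rightarrow> nat set set \<Rightarrow> real" where
  "density n G = real (card G) / real (n choose 2)"

text \<open>Probability that G \<union> G(n,p) has property P, where G(n,p) includes each of the
  (n choose 2) possible edges independently with probability p.\<close>
definition union_prob :: "nat \<Rightarrow> real \<Rightarrow> nat set set \<Rightarrow> (nat set set \<Rightarrow> bool) \<Rightarrow> real" where
  "union_prob n p G P =
     (\<Sum>S\<in>{S. S \<subseteq> all_edges n \<and> P (G \<union> S)}.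
        p ^ card S * (1 - p) ^ (card (all_edges n) - card S))"

definition is_perturbed_ramsey_threshold ::
  "(nat \<Rightarrow> real) \<Rightarrow> nat set set \<Rightarrow> nat \<Rightarrow> nat set set \<Rightarrow> nat \<Rightarrow> real \<Rightarrow> bool" where
  "is_perturbed_ramsey_threshold thr H1 k1 H2 k2 d =
    ((\<forall>p::nat \<Rightarrow> real. (\<forall>n. 0 \<le> p n \<and> p n \<le> 1) \<longrightarrow> p \<in> \<omega>(thr) \<longrightarrow>
        (\<forall>G::nat \<Rightarrow> nat set set. (\<forall>n. G n \<subseteq> all_edges n) \<longrightarrow>
            (\<forall>\<^sub>F n in sequentially. density n (G n) \<ge> d) \<longrightarrow>
            (\<lambda>n. union_prob n (p n) (G n) (\<lambda>F. is_ramsey F H1 k1 H2 k2)) \<longlonglongrightarrow> 1))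
   \<and> (\<forall>p::nat \<Rightarrow> real. (\<forall>n. 0 \<le> p n \<and> p n \<le> 1) \<longrightarrow> p \<in> o(thr) \<longrightarrow>
        (\<exists>G::nat \<Rightarrow> nat set set. (\<forall>n. G n \<subseteq> all_edges n) \<and>
            (\<forall>\<^sub>F n in sequentially. density n (G n) \<ge> d) \<and>
            (\<lambda>n. union_prob n (p n) (G n) (\<lambda>F. \<not> is_ramsey F H1 k1 H2 k2)) \<longlonglongrightarrow> 1)))"

end

theory Submission
  imports Defs "HOL-Library.FuncSet" "HOL-Analysis.Convex"
begin

text \<open>Below the threshold, colour a balanced complete bipartite graph blue and everything else red:
  with high probability \<open>G(n,p)\<close> contains no \<open>K\<^sub>t\<close>, so there is no red \<open>K\<^sub>t\<close>, and no blue odd cycle.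

  Above it, write \<open>\<Gamma>\<close> for the random graph and pass to a bipartite subgraph of \<open>G\<close> of linear minimum
  degree. Suppose first that a positive proportion of its edges is red. Double counting yields a red star
  whose leaves form a linear set in which almost all copies of \<open>K\<^sub>a\<close> in \<open>\<Gamma>\<close>, \<open>a = \<lceil>t/2\<rceil>\<close>, have linearly
  many common red neighbours. A red one among them forbids red cliques on \<open>t - a\<close> vertices in its common
  red neighbourhood; in any case there is a linear set in which almost every \<open>K\<^sub>a\<close> of \<open>\<Gamma>\<close> has a blue edge.
  For \<open>t \<ge> 5\<close> every linear subset then carries a positive proportion of blue \<open>\<Gamma>\<close>-edges, some blue second
  neighbourhood is linear, and a path inside it between vertices with different parents closes a blue \<open>C\<^sub>l\<close>.
  For \<open>t = 4\<close> almost all \<open>\<Gamma>\<close>-edges are blue, and deleting the few others destroys only few copies of \<open>C\<^sub>l\<close>.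

  Suppose now that almost all edges of \<open>G\<close> are blue. Two vertices with linearly many common blue
  neighbours are joined by a blue path with \<open>l - 1\<close> edges, so a \<open>\<Gamma>\<close>-edge between them is red. With high
  probability \<open>\<Gamma>\<close> has a \<open>K\<^sub>t\<close> with linearly many common \<open>G\<close>-neighbours. If its vertices have few red
  edges to \<open>G\<close>, it is red; otherwise some vertex has a linear red neighbourhood, in which \<open>\<Gamma>\<close> has a
  clique on \<open>t - 1\<close> vertices with linearly many common blue neighbours, hence a red one.

  All linear sets are treated at once by the exponentially small failure probabilities in Janson's
  inequality; the upper bounds on numbers of copies need only Markov's inequality.\<close>

text \<open>At \<open>p = q * n powr (- 2 / (t - 1))\<close>, with \<open>q\<close> constant,
  cliques on v vertices number about n^(v(t-v)/(t-1)) in expectation: at least order n for v < t,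
  but only a constant for v = t. So K_(t-1) can be found in all linear sets at once, against a union
  bound over 2^n sets, whereas a K_t can only be asked for inside a family of order n^t tuples that
  \<open>G\<close> fixes before the random graph is exposed. Hence the colouring is confronted with
  one prescribed K_t, and the fallback is a K_(t-1) in a set that may depend on the colouring.

  The size a is squeezed from two sides: t - a <= a lets a red K_a supply what a red K_a in its
  neighbourhood lacks to a red K_t, and a <= t - 2 makes a single edge the rarest subgraph of K_a,
  so that by Cauchy-Schwarz many non-red copies need order n^2 p blue edges.

  The case t = 4 separates because second neighbourhoods are linear only if n p^2 is bounded below,
  and 2/(t-1) <= 1/2 means t >= 5.\<close>

subsection \<open>Random subsets and Janson's inequality\<close>

text \<open>A random subset is averaged by an explicit finite sum, so that the inequalities below
  can be proved by induction on the ground set, revealing one element at a time.\<close>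

definition expect :: "'a set \<Rightarrow> real \<Rightarrow> ('a set \<Rightarrow> real) \<Rightarrow> real" where
  "expect E p h = (\<Sum>S\<in>Pow E. p ^ card S * (1 - p) ^ (card E - card S) * h S)"

lemma expect_empty [simp]: "expect {} p h = h {}"
  by (simp add: expect_def)

lemma expect_insert:
  assumes "finite E" "e \<notin> E"
  shows "expect (insert e E) p h
    = p * expect E p (\<lambda>S. h (insert e S)) + (1 - p) * expect E p h"
proof -
  have inj: "inj_on (insert e) (Pow E)"
    using assms(2) by (auto simp: inj_on_def)
  have fin: "finite S" if "S \<subseteq> E" for S
    using that assms(1) finite_subset by blast
  have "expect (insert e E) p h =
      (\<Sum>S\<in>Pow E. p ^ card S * (1 - p) ^ (Suc (card E) - card S) * h S)
    + (\<Sum>S\<in>insert e ` Pow E. p ^ card S * (1 - p) ^ (Suc (card E) - card S) * h S)"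
    unfolding expect_def Pow_insert using assms
    by (subst sum.union_disjoint) auto
  also have "(\<Sum>S\<in>insert e ` Pow E. p ^ card S * (1 - p) ^ (Suc (card E) - card S) * h S)
      = p * expect E p (\<lambda>S. h (insert e S))"
    unfolding expect_def sum_distrib_left
  proof (subst sum.reindex[OF inj], rule sum.cong)
    fix S assume "S \<in> Pow E"
    then have "finite S" "e \<notin> S" using fin assms by auto
    then show "((\<lambda>S. p ^ card S * (1 - p) ^ (Suc (card E) - card S) * h S) \<circ> insert e) S
      = p * (p ^ card S * (1 - p) ^ (card E - card S) * h (insert e S))"
      by simp
  qed simp
  also have "(\<Sum>S\<in>Pow E. p ^ card S * (1 - p) ^ (Suc (card E) - card S) * h S)
      = (1 - p) * expect E p h"
    unfolding expect_def sum_distrib_left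
  proof (rule sum.cong)
    fix S assume "S \<in> Pow E"
    then have "card S \<le> card E" using assms(1) by (simp add: card_mono)
    then show "p ^ card S * (1 - p) ^ (Suc (card E) - card S) * h S
      = (1 - p) * (p ^ card S * (1 - p) ^ (card E - card S) * h S)"
      by (simp add: Suc_diff_le)
  qed simp
  finally show ?thesis by simp
qed

lemma expect_const [simp]:
  assumes "finite E" shows "expect E p (\<lambda>_. c) = c"
  using assms by (induction rule: finite_induct) (simp_all add: expect_insert algebra_simps)

lemma expect_add: "expect E p (\<lambda>S. f S + g S) = expect E p f + expect E p g"
  by (simp add: expect_def algebra_simps sum.distrib)

lemma expect_diff: "expect E p (\<lambda>S. f S - g S) = expect E p f - expect E p g"
  by (simp add: expect_def algebra_simps sum_subtractf)

lemma expect_cmult: "expect E p (\<lambda>S. c * f S) = c * expect E p f"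
  by (simp add: expect_def sum_distrib_left algebra_simps)

lemma expect_sum: "expect E p (\<lambda>S. \<Sum>i\<in>I. f i S) = (\<Sum>i\<in>I. expect E p (f i))"
  unfolding expect_def by (simp add: sum_distrib_left) (rule sum.swap)

lemma expect_cong: "(\<And>S. S \<subseteq> E \<Longrightarrow> f S = g S) \<Longrightarrow> expect E p f = expect E p g"
  unfolding expect_def by (rule sum.cong) auto

lemma expect_mono:
  assumes "0 \<le> p" "p \<le> 1" "\<And>S. S \<subseteq> E \<Longrightarrow> f S \<le> g S"
  shows "expect E p f \<le> expect E p g"
  unfolding expect_def by (intro sum_mono mult_left_mono) (use assms in auto)

lemma expect_nonneg:
  assumes "0 \<le> p" "p \<le> 1" "\<And>S. S \<subseteq> E \<Longrightarrow> 0 \<le> f S"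
  shows "0 \<le> expect E p f"
  unfolding expect_def by (intro sum_nonneg mult_nonneg_nonneg) (use assms in auto)

text \<open>Raising the probability of one element moves weight \<open>q - p\<close> from the branch
  without it to the branch with it, where an increasing function is at least as large.\<close>

lemma expect_mono_prob:
  assumes "finite E" "0 \<le> p" "p \<le> q" "q \<le> 1" "\<And>S T. S \<subseteq> T \<Longrightarrow> f S \<le> f T"
  shows "expect E p f \<le> expect E q f"
  using assms
proof (induction arbitrary: f rule: finite_induct)
  case (insert e E)
  have m: "insert e S \<subseteq> insert e T" if "S \<subseteq> T" for S T :: "'a set" using that by auto
  have "expect E q f \<le> expect E q (\<lambda>S. f (insert e S))"
    using insert.prems by (intro expect_mono) (auto simp: subset_insertI)
  then have d: "0 \<le> (q - p) * (expect E q (\<lambda>S. f (insert e S)) - expect E q f)"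
    using insert by simp
  have "p * expect E p (\<lambda>S. f (insert e S)) + (1 - p) * expect E p f
      \<le> p * expect E q (\<lambda>S. f (insert e S)) + (1 - p) * expect E q f"
    using insert.IH[of f] insert.IH[of "\<lambda>S. f (insert e S)"] insert.prems m
    by (intro add_mono mult_left_mono) auto
  also have "\<dots> \<le> q * expect E q (\<lambda>S. f (insert e S)) + (1 - q) * expect E q f"
    using d by (simp add: algebra_simps)
  finally show ?case using insert by (simp add: expect_insert)
qed simp

text \<open>Revealing one element reduces the claim to Chebyshev's inequality on two points, whose
  slack is \<open>p * (1 - p) * ((a0 - a1) * (b0 - b1))\<close>.\<close>

lemma Harris:
  assumes "finite E" "0 \<le> p" "p \<le> 1"
    "\<And>S T. S \<subseteq> T \<Longrightarrow> f T \<le> f S" "\<And>S T. S \<subseteq> T \<Longrightarrow> g T \<le> g S"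
  shows "expect E p f * expect E p g \<le> expect E p (\<lambda>S. f S * g S)"
  using assms
proof (induction arbitrary: f g rule: finite_induct)
  case (insert e E)
  have m: "insert e S \<subseteq> insert e T" if "S \<subseteq> T" for S T :: "'a set" using that by auto
  define a0 a1 b0 b1 where "a0 = expect E p f" and "a1 = expect E p (\<lambda>S. f (insert e S))"
    and "b0 = expect E p g" and "b1 = expect E p (\<lambda>S. g (insert e S))"
  have "a1 \<le> a0" "b1 \<le> b0"
    unfolding a0_def a1_def b0_def b1_def
    using insert.prems by (auto intro!: expect_mono simp: subset_insertI)
  then have d: "0 \<le> (p * (1 - p)) * ((a0 - a1) * (b0 - b1))"
    using insert.prems by simp
  have "(p * a1 + (1 - p) * a0) * (p * b1 + (1 - p) * b0) \<le> p * (a1 * b1) + (1 - p) * (a0 * b0)"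
    using d by (simp add: algebra_simps)
  also have "\<dots> \<le> p * expect E p (\<lambda>S. f (insert e S) * g (insert e S))
      + (1 - p) * expect E p (\<lambda>S. f S * g S)"
    unfolding a0_def a1_def b0_def b1_def
    using insert.IH[of f g] insert.IH[of "\<lambda>S. f (insert e S)" "\<lambda>S. g (insert e S)"] insert.prems m
    by (intro add_mono mult_left_mono) auto
  finally show ?case using insert by (simp add: expect_insert a0_def a1_def b0_def b1_def)
qed simp

text \<open>By independence, conditioning on \<open>A \<subseteq> S\<close> has the same effect as
  adding \<open>A\<close> to an unconditioned random set.\<close>

lemma expect_superset:
  assumes "finite E" "finite A" "A \<subseteq> E"
  shows "expect E p (\<lambda>S. of_bool (A \<subseteq> S) * h S) = p ^ card A * expect E p (\<lambda>S. h (S \<union> A))"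
  using assms(2,3)
proof (induction arbitrary: h rule: finite_induct)
  case (insert e A)
  have one: "expect E p (\<lambda>S. of_bool (e \<in> S) * k S) = p * expect E p (\<lambda>S. k (insert e S))"
    for k :: "'a set \<Rightarrow> real"
  proof -
    define E' where "E' = E - {e}"
    have E: "E = insert e E'" "finite E'" "e \<notin> E'" using insert assms(1) by (auto simp: E'_def)
    have "expect E' p (\<lambda>S. of_bool (e \<in> S) * k S) = expect E' p (\<lambda>S. 0)"
      using E by (intro expect_cong) auto
    then show ?thesis using E by (simp add: expect_insert algebra_simps)
  qed
  have "expect E p (\<lambda>S. of_bool (insert e A \<subseteq> S) * h S)
      = expect E p (\<lambda>S. of_bool (A \<subseteq> S) * (of_bool (e \<in> S) * h S))"
    by (rule expect_cong) auto
  also have "\<dots> = p ^ card A * expect E p (\<lambda>S. of_bool (e \<in> S \<union> A) * h (S \<union> A))"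
    using insert by (subst insert.IH) auto
  also have "expect E p (\<lambda>S. of_bool (e \<in> S \<union> A) * h (S \<union> A))
     = expect E p (\<lambda>S. of_bool (e \<in> S) * h (S \<union> A))"
    using insert by (intro expect_cong) auto
  finally show ?case using insert by (simp add: one)
qed simp

lemma expect_superset_prob:
  assumes "finite E" "A \<subseteq> E"
  shows "expect E p (\<lambda>S. of_bool (A \<subseteq> S)) = p ^ card A"
  using expect_superset[of E A p "\<lambda>_. 1"] assms finite_subset[of A E] by simp

section \<open>Events, the union bound and Markov's inequality\<close>

definition prob :: "'a set \<Rightarrow> real \<Rightarrow> ('a set \<Rightarrow> bool) \<Rightarrow> real" where
  "prob E p P = expect E p (\<lambda>S. of_bool (P S))"

lemma prob_mono:
  assumes "0 \<le> p" "p \<le> 1" "\<And>S. S \<subseteq> E \<Longrightarrow> P S \<Longrightarrow> Q S"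
  shows "prob E p P \<le> prob E p Q"
  unfolding prob_def by (rule expect_mono) (use assms in auto)

lemma prob_not:
  assumes "finite E" shows "prob E p (\<lambda>S. \<not> P S) = 1 - prob E p P"
proof -
  have "prob E p (\<lambda>S. \<not> P S) = expect E p (\<lambda>S. 1 - of_bool (P S))"
    unfolding prob_def by (rule expect_cong) auto
  then show ?thesis using assms by (simp add: expect_diff prob_def)
qed

lemma prob_disj_le:
  assumes "0 \<le> p" "p \<le> 1"
  shows "prob E p (\<lambda>S. P S \<or> Q S) \<le> prob E p P + prob E p Q"
  unfolding prob_def expect_add[symmetric] by (rule expect_mono) (use assms in auto)

lemma prob_Bex_le:
  assumes "0 \<le> p" "p \<le> 1" "finite I"
  shows "prob E p (\<lambda>S. \<exists>i\<in>I. P i S) \<le> (\<Sum>i\<in>I. prob E p (P i))"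
  unfolding prob_def expect_sum[symmetric]
proof (rule expect_mono[OF assms(1,2)])
  fix S show "of_bool (\<exists>i\<in>I. P i S) \<le> (\<Sum>i\<in>I. of_bool (P i S) :: real)"
  proof (cases "\<exists>i\<in>I. P i S")
    case True
    then obtain i where "i \<in> I" "P i S" by auto
    then show ?thesis using member_le_sum[of i I "\<lambda>i. of_bool (P i S) :: real"] assms by auto
  qed (simp add: sum_nonneg)
qed

lemma Markov:
  assumes "0 \<le> p" "p \<le> 1" "0 < c" "\<And>S. S \<subseteq> E \<Longrightarrow> 0 \<le> h S"
  shows "prob E p (\<lambda>S. c \<le> h S) \<le> expect E p h / c"
proof -
  have "c * prob E p (\<lambda>S. c \<le> h S) \<le> expect E p h"
    unfolding prob_def expect_cmult[symmetric] by (rule expect_mono) (use assms in auto)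
  then show ?thesis using assms by (simp add: field_simps)
qed

text \<open>The Laplace transform \<open>\<psi>\<close> of the count satisfies a differential
  inequality, found by conditioning on one \<open>A i\<close>: the sets meeting \<open>A i\<close>
  are controlled by exp(-u) >= 1 - u, the sets disjoint from it are unaffected by the condition, and
  Harris's inequality separates the two factors.\<close>

lemma expect_exp_neg_le:
  fixes A :: "'i \<Rightarrow> 'a set"
  assumes E: "finite E" and p: "0 \<le> p" "p \<le> 1" and I: "finite I"
    and A: "\<And>i. i \<in> I \<Longrightarrow> A i \<subseteq> E"
    and \<Lambda>: "(\<Sum>i\<in>I. \<Sum>j\<in>{j\<in>I. A i \<inter> A j \<noteq> {}}. p ^ card (A i \<union> A j)) \<le> \<Lambda>"
    and \<mu>: "\<mu> = (\<Sum>i\<in>I. p ^ card (A i))"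
    and x: "0 \<le> x"
  shows "expect E p (\<lambda>S. exp (- x * real (card {i\<in>I. A i \<subseteq> S})))
    \<le> exp (- x * \<mu> + x\<^sup>2 * \<Lambda> / 2)"
proof -
  define X where "X S = (\<Sum>i\<in>I. of_bool (A i \<subseteq> S) :: real)" for S
  have X_card: "real (card {i\<in>I. A i \<subseteq> S}) = X S" for S
    using I by (simp add: X_def Int_def)
  define \<psi> where "\<psi> y = expect E p (\<lambda>S. exp (- y * X S))" for y
  define \<psi>' where "\<psi>' y = - expect E p (\<lambda>S. X S * exp (- y * X S))" for y
  have \<psi>_nn: "0 \<le> \<psi> y" for y unfolding \<psi>_def using p by (intro expect_nonneg) auto
  have deriv: "(\<psi> has_real_derivative \<psi>' y) (at y)" for y
    unfolding \<psi>_def \<psi>'_def expect_def sum_negf[symmetric]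
    by (auto intro!: derivative_eq_intros sum.cong)
  have key: "- \<psi>' y \<ge> (\<mu> - y * \<Lambda>) * \<psi> y" if y: "0 \<le> y" for y
  proof -
    have one: "expect E p (\<lambda>S. of_bool (A i \<subseteq> S) * exp (- y * X S))
       \<ge> (p ^ card (A i) - y * (\<Sum>j\<in>{j\<in>I. A i \<inter> A j \<noteq> {}}. p ^ card (A i \<union> A j))) * \<psi> y"
      if i: "i \<in> I" for i
    proof -
      define J where "J = {j\<in>I. A i \<inter> A j \<noteq> {}}"
      define Y where "Y S = (\<Sum>j\<in>J. of_bool (A j \<subseteq> S) :: real)" for S
      define Z where "Z S = (\<Sum>j\<in>I-J. of_bool (A j \<subseteq> S) :: real)" for S
      have J: "J \<subseteq> I" "finite J" using I by (auto simp: J_def)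
      have Ai: "A i \<subseteq> E" "finite (A i)" using A[OF i] E finite_subset by auto
      have XYZ: "X S = Y S + Z S" for S
        unfolding X_def Y_def Z_def using sum.subset_diff[OF J(1) I, of "\<lambda>j. of_bool (A j \<subseteq> S) :: real"]
        by simp
      have Z_eq: "Z (S \<union> A i) = Z S" for S
        unfolding Z_def J_def by (intro sum.cong arg_cong[where f=of_bool]) auto
      have Y_nn: "0 \<le> Y S" and Z_nn: "0 \<le> Z S" for S by (simp_all add: Y_def Z_def sum_nonneg)
      have Y_mono: "Y S \<le> Y T" and Z_mono: "Z S \<le> Z T" if "S \<subseteq> T" for S T
        unfolding Y_def Z_def by (intro sum_mono, simp, use that in blast)+
      have EY: "p ^ card (A i) * expect E p (\<lambda>S. Y (S \<union> A i)) = (\<Sum>j\<in>J. p ^ card (A i \<union> A j))"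
      proof -
        have "p ^ card (A i) * expect E p (\<lambda>S. Y (S \<union> A i))
            = expect E p (\<lambda>S. of_bool (A i \<subseteq> S) * Y S)"
          using expect_superset[OF E Ai(2,1), where h=Y] by simp
        also have "\<dots> = expect E p (\<lambda>S. \<Sum>j\<in>J. of_bool (A i \<union> A j \<subseteq> S))"
          unfolding Y_def by (intro expect_cong) (auto simp: sum_distrib_left intro!: sum.cong)
        also have "\<dots> = (\<Sum>j\<in>J. p ^ card (A i \<union> A j))"
          unfolding expect_sum using J A Ai E by (intro sum.cong expect_superset_prob) auto
        finally show ?thesis .
      qed
      have "1 - y * expect E p (\<lambda>S. Y (S \<union> A i)) = expect E p (\<lambda>S. 1 + (- y) * Y (S \<union> A i))"
        unfolding expect_add expect_cmult using E by simp
      also have "\<dots> \<le> expect E p (\<lambda>S. exp (- y * Y (S \<union> A i)))"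
        using p by (intro expect_mono exp_ge_add_one_self)
      finally have u: "1 - y * expect E p (\<lambda>S. Y (S \<union> A i)) \<le> expect E p (\<lambda>S. exp (- y * Y (S \<union> A i)))" .
      have v: "\<psi> y \<le> expect E p (\<lambda>S. exp (- y * Z S))"
        unfolding \<psi>_def using p y Y_nn by (intro expect_mono) (auto simp: XYZ algebra_simps)
      have "(p ^ card (A i) - y * (\<Sum>j\<in>J. p ^ card (A i \<union> A j))) * \<psi> y
          = p ^ card (A i) * ((1 - y * expect E p (\<lambda>S. Y (S \<union> A i))) * \<psi> y)"
        unfolding EY[symmetric] by (simp add: algebra_simps)
      also have "\<dots> \<le> p ^ card (A i) * (expect E p (\<lambda>S. exp (- y * Y (S \<union> A i))) * \<psi> y)"
        using u \<psi>_nn p by (intro mult_left_mono mult_right_mono) auto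
      also have "\<dots> \<le> p ^ card (A i) *
          (expect E p (\<lambda>S. exp (- y * Y (S \<union> A i))) * expect E p (\<lambda>S. exp (- y * Z S)))"
        using v p by (intro mult_left_mono expect_nonneg) auto
      also have "\<dots> \<le> p ^ card (A i) * expect E p (\<lambda>S. exp (- y * Y (S \<union> A i)) * exp (- y * Z S))"
      proof (intro mult_left_mono Harris[OF E p])
        fix S T :: "'a set" assume "S \<subseteq> T"
        then show "exp (- y * Y (T \<union> A i)) \<le> exp (- y * Y (S \<union> A i))"
          "exp (- y * Z T) \<le> exp (- y * Z S)"
          using y Y_mono[of "S \<union> A i" "T \<union> A i"] Z_mono[of S T] by (auto intro: mult_left_mono)
      qed (use p in auto)
      also have "\<dots> = p ^ card (A i) * expect E p (\<lambda>S. exp (- y * X (S \<union> A i)))"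
        unfolding XYZ Z_eq by (simp add: exp_add[symmetric] algebra_simps)
      also have "\<dots> = expect E p (\<lambda>S. of_bool (A i \<subseteq> S) * exp (- y * X S))"
        using expect_superset[OF E Ai(2,1), where h="\<lambda>S. exp (- y * X S)"] by simp
      finally show ?thesis by (simp add: J_def)
    qed
    have "(\<mu> - y * \<Lambda>) * \<psi> y
       \<le> (\<mu> - y * (\<Sum>i\<in>I. \<Sum>j\<in>{j\<in>I. A i \<inter> A j \<noteq> {}}. p ^ card (A i \<union> A j))) * \<psi> y"
      using \<Lambda> y \<psi>_nn by (intro mult_right_mono diff_left_mono mult_left_mono) auto
    also have "\<dots> = (\<Sum>i\<in>I. (p ^ card (A i) - y * (\<Sum>j\<in>{j\<in>I. A i \<inter> A j \<noteq> {}}. p ^ card (A i \<union> A j))) * \<psi> y)"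
      by (simp add: \<mu> sum_distrib_left sum_distrib_right sum_subtractf left_diff_distrib)
    also have "\<dots> \<le> (\<Sum>i\<in>I. expect E p (\<lambda>S. of_bool (A i \<subseteq> S) * exp (- y * X S)))"
      by (intro sum_mono one)
    also have "\<dots> = - \<psi>' y"
      by (simp add: \<psi>'_def X_def sum_distrib_right expect_sum)
    finally show ?thesis .
  qed
  \<comment> \<open>The integrating factor turns the differential inequality \<open>key\<close> into
    monotonicity of \<open>\<phi>\<close>.\<close>
  define \<phi> where "\<phi> y = \<psi> y * exp (y * \<mu> - y\<^sup>2 * \<Lambda> / 2)" for y
  have "\<phi> x \<le> \<phi> 0"
  proof (rule DERIV_nonpos_imp_nonincreasing[OF x])
    fix y assume y: "0 \<le> y" "y \<le> x"
    have "(\<phi> has_real_derivative (\<psi>' y + (\<mu> - y * \<Lambda>) * \<psi> y) * exp (y * \<mu> - y\<^sup>2 * \<Lambda> / 2)) (at y)"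
      unfolding \<phi>_def by (rule derivative_eq_intros deriv refl | simp add: algebra_simps)+
    moreover have "(\<psi>' y + (\<mu> - y * \<Lambda>) * \<psi> y) * exp (y * \<mu> - y\<^sup>2 * \<Lambda> / 2) \<le> 0"
      using key[OF y(1)] by (simp add: mult_nonpos_nonneg)
    ultimately show "\<exists>z. (\<phi> has_real_derivative z) (at y) \<and> z \<le> 0" by blast
  qed
  also have "\<phi> 0 = 1" using E by (simp add: \<phi>_def \<psi>_def)
  finally have "\<psi> x * exp (x * \<mu> - x\<^sup>2 * \<Lambda> / 2) \<le> 1" by (simp add: \<phi>_def)
  then have "\<psi> x \<le> 1 / exp (x * \<mu> - x\<^sup>2 * \<Lambda> / 2)" by (simp add: field_simps)
  also have "\<dots> = exp (- (x * \<mu> - x\<^sup>2 * \<Lambda> / 2))" by (simp only: exp_minus inverse_eq_divide)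
  finally show ?thesis unfolding X_card \<psi>_def by simp
qed

theorem Janson:
  fixes A :: "'i \<Rightarrow> 'a set"
  assumes E: "finite E" and p: "0 \<le> p" "p \<le> 1" and I: "finite I"
    and A: "\<And>i. i \<in> I \<Longrightarrow> A i \<subseteq> E"
    and \<Lambda>: "(\<Sum>i\<in>I. \<Sum>j\<in>{j\<in>I. A i \<inter> A j \<noteq> {}}. p ^ card (A i \<union> A j)) \<le> \<Lambda>" "0 < \<Lambda>"
    and \<mu>: "\<mu> = (\<Sum>i\<in>I. p ^ card (A i))"
  shows "prob E p (\<lambda>S. real (card {i\<in>I. A i \<subseteq> S}) \<le> \<mu> / 2) \<le> exp (- \<mu>\<^sup>2 / (8 * \<Lambda>))"
proof -
  \<comment> \<open>This \<open>x\<close> minimises the exponent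
    \<open>- x * \<mu> / 2 + x\<^sup>2 * \<Lambda> / 2\<close> left by the exponential Markov
    bound.\<close>
  define x where "x = \<mu> / (2 * \<Lambda>)"
  have \<mu>0: "0 \<le> \<mu>" using p by (simp add: \<mu> sum_nonneg)
  then have x: "0 \<le> x" using \<Lambda> by (simp add: x_def)
  have "prob E p (\<lambda>S. real (card {i\<in>I. A i \<subseteq> S}) \<le> \<mu> / 2)
     \<le> expect E p (\<lambda>S. exp (x * \<mu> / 2) * exp (- x * real (card {i\<in>I. A i \<subseteq> S})))"
    unfolding prob_def
  proof (rule expect_mono[OF p])
    fix S
    show "of_bool (real (card {i\<in>I. A i \<subseteq> S}) \<le> \<mu> / 2)
       \<le> exp (x * \<mu> / 2) * exp (- x * real (card {i\<in>I. A i \<subseteq> S}))"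
      using mult_left_mono[OF _ x, of "real (card {i\<in>I. A i \<subseteq> S})" "\<mu> / 2"]
      by (auto simp: exp_add[symmetric])
  qed
  also have "\<dots> \<le> exp (x * \<mu> / 2) * exp (- x * \<mu> + x\<^sup>2 * \<Lambda> / 2)"
    unfolding expect_cmult using assms x by (intro mult_left_mono expect_exp_neg_le) auto
  also have "\<dots> = exp (- \<mu>\<^sup>2 / (8 * \<Lambda>))"
  proof -
    have "x * \<mu> / 2 + (- x * \<mu> + x\<^sup>2 * \<Lambda> / 2) = - \<mu>\<^sup>2 / (8 * \<Lambda>)"
      using \<Lambda> by (simp add: x_def field_simps power2_eq_square)
    then show ?thesis by (simp only: exp_add[symmetric])
  qed
  finally show ?thesis .
qed

subsection \<open>Copies of a graph in the random graph\<close>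

definition graph_on :: "nat \<Rightarrow> nat set set \<Rightarrow> bool" where
  "graph_on k F \<longleftrightarrow> (\<forall>e\<in>F. e \<subseteq> {..<k} \<and> card e = 2)"

text \<open>Extensionality makes the set finite and counts every labelled embedding of
  \<open>{..<k}\<close> exactly once.\<close>

definition injections :: "nat \<Rightarrow> nat set \<Rightarrow> (nat \<Rightarrow> nat) set" where
  "injections k S = {f \<in> {..<k} \<rightarrow>\<^sub>E S. inj_on f {..<k}}"

definition image_graph :: "nat set set \<Rightarrow> (nat \<Rightarrow> nat) \<Rightarrow> nat set set" where
  "image_graph F f = (\<lambda>e. f ` e) ` F"

definition copies :: "nat set set \<Rightarrow> nat \<Rightarrow> nat set \<Rightarrow> nat set set \<Rightarrow> (nat \<Rightarrow> nat) set" where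
  "copies F k S \<Gamma> = {f \<in> injections k S. image_graph F f \<subseteq> \<Gamma>}"

text \<open>The pairs are ordered, and for nonempty \<open>F\<close> the diagonal is included, so
  that this is what a sum of squared counts produces.\<close>

definition overlaps :: "nat set set \<Rightarrow> nat \<Rightarrow> nat set \<Rightarrow> nat set set \<Rightarrow> ((nat \<Rightarrow> nat) \<times> (nat \<Rightarrow> nat)) set" where
  "overlaps F k S \<Gamma> = {(f, g). f \<in> copies F k S \<Gamma> \<and> g \<in> copies F k S \<Gamma> \<and>
     image_graph F f \<inter> image_graph F g \<noteq> {}}"

abbreviation mean_copies :: "nat set set \<Rightarrow> nat \<Rightarrow> nat \<Rightarrow> real \<Rightarrow> real" where
  "mean_copies F k n p \<equiv> real n ^ k * p ^ card F"

abbreviation red_copies ::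
  "nat set set \<Rightarrow> nat \<Rightarrow> nat set \<Rightarrow> nat set set \<Rightarrow> nat set set \<Rightarrow> (nat \<Rightarrow> nat) set" where
  "red_copies F k S \<Gamma> R \<equiv> {f \<in> copies F k S \<Gamma>. image_graph F f \<subseteq> R}"

lemma graph_on_finite: "graph_on k F \<Longrightarrow> finite F"
  unfolding graph_on_def by (rule finite_subset[of _ "Pow {..<k}"]) auto

lemma finite_injections [simp]: "finite S \<Longrightarrow> finite (injections k S)"
  unfolding injections_def by (rule finite_subset[of _ "{..<k} \<rightarrow>\<^sub>E S"]) (auto intro: finite_PiE)

lemma finite_copies [simp]: "finite S \<Longrightarrow> finite (copies F k S \<Gamma>)"
  by (simp add: copies_def)

lemma injections_mono: "S \<subseteq> T \<Longrightarrow> injections k S \<subseteq> injections k T"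
  unfolding injections_def by (auto simp: PiE_iff)

lemma copies_mono: "S \<subseteq> T \<Longrightarrow> copies F k S \<Gamma> \<subseteq> copies F k T \<Gamma>"
  unfolding copies_def using injections_mono by blast

lemma card_injections_le:
  assumes "finite S" shows "card (injections k S) \<le> card S ^ k"
proof -
  have "card (injections k S) \<le> card ({..<k} \<rightarrow>\<^sub>E S)"
    unfolding injections_def using assms by (intro card_mono finite_PiE) auto
  then show ?thesis by (simp add: card_funcsetE)
qed

lemma card_injections_ge:
  assumes "finite S" "2 * k \<le> card S"
  shows "(real (card S) / 2) ^ k \<le> card (injections k S)"
proof -
  have "card (injections k S) = (\<Prod>i\<in>{0..<k}. card S - i)"
    unfolding injections_def using assms by (subst card_inj_on_subset_funcset) auto
  moreover have "(real (card S) / 2) ^ k \<le> (\<Prod>i\<in>{0..<k}. real (card S - i))"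
  proof -
    have "(\<Prod>i\<in>{0..<k}. real (card S) / 2) \<le> (\<Prod>i\<in>{0..<k}. real (card S - i))"
      using assms by (intro prod_mono) (auto simp: of_nat_diff)
    then show ?thesis by simp
  qed
  ultimately show ?thesis by simp
qed

lemma inj_on_image_edges:
  assumes "graph_on k F" "f \<in> injections k S"
  shows "inj_on ((`) f) F"
proof -
  have "inj_on f (\<Union> F)"
    using assms unfolding graph_on_def injections_def by (auto intro: inj_on_subset)
  then show ?thesis by (rule inj_on_image)
qed

lemma card_image_graph:
  assumes "graph_on k F" "f \<in> injections k S"
  shows "card (image_graph F f) = card F"
  unfolding image_graph_def by (rule card_image[OF inj_on_image_edges[OF assms]])

lemma finite_all_edges [simp]: "finite (all_edges n)"
  unfolding all_edges_def by (rule finite_subset[of _ "Pow {..<n}"]) auto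

lemma all_edges_iff: "e \<in> all_edges n \<longleftrightarrow> e \<subseteq> {..<n} \<and> card e = 2"
  unfolding all_edges_def by (auto simp: card_2_iff)

lemma image_graph_all_edges:
  assumes "graph_on k F" "f \<in> injections k {..<n}"
  shows "image_graph F f \<subseteq> all_edges n"
proof -
  have "card (f ` e) = 2" if "e \<in> F" for e
    using assms that unfolding graph_on_def injections_def
    by (metis (no_types, lifting) card_image inj_on_subset mem_Collect_eq)
  then show ?thesis
    using assms unfolding graph_on_def injections_def image_graph_def
    by (auto simp: all_edges_iff) blast
qed

text \<open>Choose for every element of \<open>V\<close> the coordinate that is mapped to it; the
  other \<open>k - card V\<close> coordinates are then free.\<close>

lemma card_injections_covering_le:
  assumes V: "finite V" "card V \<le> k"
  shows "card {g \<in> injections k {..<n}. V \<subseteq> g ` {..<k}} \<le> k ^ card V * n ^ (k - card V)"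
proof -
  define H where "H = {h \<in> V \<rightarrow>\<^sub>E {..<k}. inj_on h V}"
  define G where "G h = {g \<in> {..<k} \<rightarrow>\<^sub>E {..<n}. \<forall>x\<in>V. g (h x) = x}" for h
  have finH: "finite H" unfolding H_def
    by (rule finite_subset[of _ "V \<rightarrow>\<^sub>E {..<k}"]) (use V in \<open>auto intro: finite_PiE\<close>)
  have finG: "finite (G h)" for h unfolding G_def
    by (rule finite_subset[of _ "{..<k} \<rightarrow>\<^sub>E {..<n}"]) (auto intro: finite_PiE)
  have sub: "{g \<in> injections k {..<n}. V \<subseteq> g ` {..<k}} \<subseteq> (\<Union>h\<in>H. G h)"
  proof
    fix g assume g: "g \<in> {g \<in> injections k {..<n}. V \<subseteq> g ` {..<k}}"
    then have "\<forall>x\<in>V. \<exists>i<k. g i = x" by auto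
    then obtain h where h: "\<And>x. x \<in> V \<Longrightarrow> h x < k \<and> g (h x) = x" by metis
    have "restrict h V \<in> H" unfolding H_def using h by (auto simp: inj_on_def) metis
    moreover have "g \<in> G (restrict h V)" using g h by (auto simp: G_def injections_def)
    ultimately show "g \<in> (\<Union>h\<in>H. G h)" by blast
  qed
  have Gh: "card (G h) \<le> n ^ (k - card V)" if h: "h \<in> H" for h
  proof -
    have hV: "h ` V \<subseteq> {..<k}" "card (h ` V) = card V"
      using h by (auto simp: H_def card_image)
    have "G h \<subseteq> PiE {..<k} (\<lambda>i. if i \<in> h ` V then {inv_into V h i} else {..<n})"
    proof
      fix g assume g: "g \<in> G h"
      have "g i = inv_into V h i" if "i \<in> h ` V" for i
        using g that h by (auto simp: G_def H_def)
      then show "g \<in> PiE {..<k} (\<lambda>i. if i \<in> h ` V then {inv_into V h i} else {..<n})"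
        using g by (auto simp: G_def PiE_iff)
    qed
    then have "card (G h) \<le> card (PiE {..<k} (\<lambda>i. if i \<in> h ` V then {inv_into V h i} else {..<n}))"
      by (intro card_mono finite_PiE) auto
    also have "\<dots> = (\<Prod>i<k. if i \<in> h ` V then 1 else n)"
      by (subst card_PiE) (auto intro!: prod.cong)
    also have "\<dots> = n ^ card ({..<k} - h ` V)"
      by (simp add: prod.If_cases Diff_eq Collect_neg_eq[symmetric] Compl_eq)
    also have "card ({..<k} - h ` V) = k - card V"
      using hV V by (subst card_Diff_subset) auto
    finally show ?thesis .
  qed
  have "card {g \<in> injections k {..<n}. V \<subseteq> g ` {..<k}} \<le> card (\<Union>h\<in>H. G h)"
    using finH finG by (intro card_mono sub) auto
  also have "\<dots> \<le> (\<Sum>h\<in>H. card (G h))" by (rule card_UN_le[OF finH])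
  also have "\<dots> \<le> card H * n ^ (k - card V)" using sum_bounded_above[of H "\<lambda>h. card (G h)"] Gh by simp
  also have "card H \<le> card (V \<rightarrow>\<^sub>E {..<k})" unfolding H_def
    using V by (intro card_mono finite_PiE) auto
  also have "\<dots> = k ^ card V" using V by (simp add: card_funcsetE)
  finally show ?thesis by simp
qed

text \<open>The number \<open>M\<close> bounds from below the expected number of copies of every nonempty
  subgraph; it governs both the variance of the number of copies of \<open>F\<close> and its lower tail.\<close>

definition rich :: "nat set set \<Rightarrow> nat \<Rightarrow> real \<Rightarrow> real \<Rightarrow> bool" where
  "rich F n p M \<longleftrightarrow> (\<forall>J\<subseteq>F. J \<noteq> {} \<longrightarrow> M \<le> real n ^ card (\<Union>J) * p ^ card J)"

text \<open>Group the embeddings \<open>g\<close> by the set J of edges of \<open>F\<close> that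
  they share with \<open>f\<close>. Such a \<open>g\<close> covers the image of the v vertices of J,
  which leaves at most k^k n^(k-v) choices, and the loss against a generic pair is n^v p^|J|, at
  least \<open>M\<close> by richness.\<close>

lemma overlap_sum_le:
  assumes F: "graph_on k F" and p: "0 < p" "p \<le> 1" and M: "0 < M" "rich F n p M"
    and \<F>: "\<F> \<subseteq> injections k {..<n}" and n: "0 < n"
  shows "(\<Sum>f\<in>\<F>. \<Sum>g\<in>{g\<in>\<F>. image_graph F f \<inter> image_graph F g \<noteq> {}}.
      p ^ card (image_graph F f \<union> image_graph F g))
    \<le> 2 ^ card F * real k ^ k * (mean_copies F k n p)\<^sup>2 / M"
proof -
  define N where "N = mean_copies F k n p"
  have finF: "finite F" using F by (rule graph_on_finite)
  have fin\<F>: "finite \<F>" using \<F> finite_subset finite_injections[of "{..<n}"] by blast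
  have one: "(\<Sum>g\<in>{g\<in>\<F>. image_graph F f \<inter> image_graph F g \<noteq> {}}.
      p ^ card (image_graph F f \<union> image_graph F g))
    \<le> 2 ^ card F * (real k ^ k * real n ^ k * p ^ (2 * card F) / M)"
    if f: "f \<in> \<F>" for f
  proof -
    have fi: "f \<in> injections k {..<n}" using f \<F> by auto
    \<comment> \<open>The shared edges are recorded as edges of \<open>F\<close> pulled back along
      \<open>f\<close>, so there are at most \<open>2 ^ card F\<close> classes whatever
      \<open>f\<close> is.\<close>
    define sh where "sh g = {e\<in>F. f ` e \<in> image_graph F g}" for g
    define c where "c = real k ^ k * real n ^ k * p ^ (2 * card F) / M"
    have c0: "0 \<le> c" unfolding c_def using p M by simp
    have sh_img: "(`) f ` sh g = image_graph F f \<inter> image_graph F g" for g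
      unfolding sh_def image_graph_def by auto
    have cardun: "p ^ card (image_graph F f \<union> image_graph F g) = p ^ (2 * card F - card (sh g))"
      if "g \<in> \<F>" for g
    proof -
      have gi: "g \<in> injections k {..<n}" using that \<F> by auto
      have "card (image_graph F f \<inter> image_graph F g) = card (sh g)"
        unfolding sh_img[symmetric]
        by (intro card_image inj_on_subset[OF inj_on_image_edges[OF F fi]]) (auto simp: sh_def)
      then show ?thesis
        using card_Un_Int[of "image_graph F f" "image_graph F g"] finF
          card_image_graph[OF F fi] card_image_graph[OF F gi]
        by (simp add: image_graph_def mult_2)
    qed
    have term_le: "(\<Sum>g\<in>{g\<in>\<F>. sh g = J}. p ^ (2 * card F - card J)) \<le> c"
      if J: "J \<in> Pow F - {{}}" for J
    proof -
      define V where "V = \<Union>J"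
      have JF: "J \<subseteq> F" "J \<noteq> {}" "card J \<le> card F" using J finF by (auto intro: card_mono)
      have Vk: "V \<subseteq> {..<k}" using JF F unfolding V_def graph_on_def by blast
      have finV: "finite V" and cardV: "card V \<le> k"
        using Vk finite_subset card_mono[OF _ Vk] by auto
      have fV: "card (f ` V) = card V"
        using fi Vk by (intro card_image) (auto simp: injections_def intro: inj_on_subset)
      have "{g\<in>\<F>. sh g = J} \<subseteq> {g \<in> injections k {..<n}. f ` V \<subseteq> g ` {..<k}}"
      proof
        fix g assume g: "g \<in> {g\<in>\<F>. sh g = J}"
        have "f x \<in> g ` {..<k}" if x: "x \<in> V" for x
        proof -
          obtain e where e: "e \<in> J" "x \<in> e" using x by (auto simp: V_def)
          then have "f ` e \<in> image_graph F g" using g by (auto simp: sh_def)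
          then obtain e' where "e' \<in> F" "f ` e = g ` e'" by (auto simp: image_graph_def)
          then show ?thesis using e F unfolding graph_on_def by blast
        qed
        then show "g \<in> {g \<in> injections k {..<n}. f ` V \<subseteq> g ` {..<k}}" using g \<F> by auto
      qed
      then have "card {g\<in>\<F>. sh g = J} \<le> card {g \<in> injections k {..<n}. f ` V \<subseteq> g ` {..<k}}"
        by (intro card_mono) auto
      also have "\<dots> \<le> k ^ card V * n ^ (k - card V)"
        using card_injections_covering_le[of "f ` V" k n] finV cardV fV by simp
      finally have "real (card {g\<in>\<F>. sh g = J}) \<le> real k ^ card V * real n ^ (k - card V)"
        by (metis of_nat_le_iff of_nat_mult of_nat_power)
      also have "real k ^ card V \<le> real k ^ k"
        using cardV by (cases "k = 0") (auto intro: power_increasing)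
      finally have cnt: "real (card {g\<in>\<F>. sh g = J}) \<le> real k ^ k * real n ^ (k - card V)"
        by (simp add: mult_right_mono)
      have Mle: "M \<le> real n ^ card V * p ^ card J" using M(2) JF unfolding rich_def V_def by blast
      have "(\<Sum>g\<in>{g\<in>\<F>. sh g = J}. p ^ (2 * card F - card J))
         = real (card {g\<in>\<F>. sh g = J}) * p ^ (2 * card F - card J)" by simp
      also have "\<dots> \<le> real k ^ k * real n ^ (k - card V) * p ^ (2 * card F - card J)"
        using cnt p by (intro mult_right_mono) auto
      also have "\<dots> \<le> c"
      proof -
        have "real k ^ k * real n ^ (k - card V) * p ^ (2 * card F - card J) * M
            \<le> real k ^ k * real n ^ (k - card V) * p ^ (2 * card F - card J) * (real n ^ card V * p ^ card J)"
          using Mle p by (intro mult_left_mono) auto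
        also have "\<dots> = real k ^ k * (real n ^ (k - card V) * real n ^ card V)
             * (p ^ (2 * card F - card J) * p ^ card J)" by simp
        also have "\<dots> = real k ^ k * real n ^ k * p ^ (2 * card F)"
          using cardV JF by (simp add: power_add[symmetric])
        finally show ?thesis using M by (simp add: c_def pos_le_divide_eq)
      qed
      finally show ?thesis .
    qed
    have "(\<Sum>g\<in>{g\<in>\<F>. image_graph F f \<inter> image_graph F g \<noteq> {}}. p ^ card (image_graph F f \<union> image_graph F g))
        = (\<Sum>g\<in>{g\<in>\<F>. image_graph F f \<inter> image_graph F g \<noteq> {}}. p ^ (2 * card F - card (sh g)))"
      by (intro sum.cong) (auto simp: cardun)
    also have "\<dots> = (\<Sum>J\<in>Pow F - {{}}. \<Sum>g\<in>{g\<in>{g\<in>\<F>. image_graph F f \<inter> image_graph F g \<noteq> {}}. sh g = J}.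
         p ^ (2 * card F - card (sh g)))"
    proof (rule sum.group[symmetric])
      show "sh ` {g \<in> \<F>. image_graph F f \<inter> image_graph F g \<noteq> {}} \<subseteq> Pow F - {{}}"
      proof
        fix J assume "J \<in> sh ` {g \<in> \<F>. image_graph F f \<inter> image_graph F g \<noteq> {}}"
        then obtain g where "J = sh g" "image_graph F f \<inter> image_graph F g \<noteq> {}" by blast
        moreover have "sh g \<subseteq> F" unfolding sh_def by blast
        ultimately show "J \<in> Pow F - {{}}" using sh_img[of g] by force
      qed
    qed (use fin\<F> finF in auto)
    also have "\<dots> \<le> (\<Sum>J\<in>Pow F - {{}}. \<Sum>g\<in>{g\<in>\<F>. sh g = J}. p ^ (2 * card F - card J))"
    proof (intro sum_mono)
      fix J
      have "(\<Sum>g\<in>{g\<in>{g\<in>\<F>. image_graph F f \<inter> image_graph F g \<noteq> {}}. sh g = J}. p ^ (2 * card F - card (sh g)))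
         = (\<Sum>g\<in>{g\<in>{g\<in>\<F>. image_graph F f \<inter> image_graph F g \<noteq> {}}. sh g = J}. p ^ (2 * card F - card J))"
        by (intro sum.cong) auto
      also have "\<dots> \<le> (\<Sum>g\<in>{g\<in>\<F>. sh g = J}. p ^ (2 * card F - card J))"
        using fin\<F> p by (intro sum_mono2) auto
      finally show "(\<Sum>g\<in>{g\<in>{g\<in>\<F>. image_graph F f \<inter> image_graph F g \<noteq> {}}. sh g = J}. p ^ (2 * card F - card (sh g)))
         \<le> (\<Sum>g\<in>{g\<in>\<F>. sh g = J}. p ^ (2 * card F - card J))" .
    qed
    also have "\<dots> \<le> (\<Sum>J\<in>Pow F - {{}}. c)" by (intro sum_mono term_le)
    also have "\<dots> \<le> 2 ^ card F * c"
    proof -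
      have "card (Pow F - {{}}) \<le> 2 ^ card F"
        using finF card_mono[of "Pow F" "Pow F - {{}}"] by (simp add: card_Pow)
      then have "real (card (Pow F - {{}})) \<le> 2 ^ card F"
        by (metis of_nat_le_iff of_nat_numeral of_nat_power)
      then show ?thesis using c0 by (simp add: mult_right_mono)
    qed
    finally show ?thesis by (simp add: c_def)
  qed
  have "card \<F> \<le> card (injections k {..<n})" using \<F> by (intro card_mono) auto
  also have "\<dots> \<le> n ^ k" using card_injections_le[of "{..<n}" k] by simp
  finally have c\<F>: "real (card \<F>) \<le> real n ^ k" by (metis of_nat_le_iff of_nat_power)
  have "(\<Sum>f\<in>\<F>. \<Sum>g\<in>{g\<in>\<F>. image_graph F f \<inter> image_graph F g \<noteq> {}}.
      p ^ card (image_graph F f \<union> image_graph F g))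
     \<le> (\<Sum>f\<in>\<F>. 2 ^ card F * (real k ^ k * real n ^ k * p ^ (2 * card F) / M))"
    by (intro sum_mono one)
  also have "\<dots> = card \<F> * (2 ^ card F * (real k ^ k * real n ^ k * p ^ (2 * card F) / M))" by simp
  also have "\<dots> \<le> real n ^ k * (2 ^ card F * (real k ^ k * real n ^ k * p ^ (2 * card F) / M))"
    using c\<F> p M by (intro mult_right_mono) auto
  also have "\<dots> = 2 ^ card F * real k ^ k * N\<^sup>2 / M"
    by (simp add: N_def power_mult_distrib power2_eq_square power_mult power_add[symmetric] mult_2)
  finally show ?thesis by (simp add: N_def)
qed

text \<open>The correlation sum is at most a constant times N^2 / \<open>M\<close> for N =
  \<open>mean_copies F k n p\<close>, so N cancels in Janson's exponent and only
  \<open>\<alpha>\<^sup>2 * M\<close> remains.\<close>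

lemma lower_tail:
  assumes F: "graph_on k F" and k: "0 < k" and p: "0 < p" "p \<le> 1" and M: "0 < M" "rich F n p M"
    and \<F>: "\<F> \<subseteq> injections k {..<n}" and n: "0 < n"
    and \<alpha>: "0 \<le> \<alpha>" "\<alpha> * real n ^ k \<le> card \<F>"
  shows "prob (all_edges n) p (\<lambda>\<Gamma>. card {f\<in>\<F>. image_graph F f \<subseteq> \<Gamma>} \<le> \<alpha> / 2 * mean_copies F k n p)
    \<le> exp (- \<alpha>\<^sup>2 * M / (8 * 2 ^ card F * real k ^ k))"
proof -
  define N where "N = mean_copies F k n p"
  define \<Lambda> where "\<Lambda> = 2 ^ card F * real k ^ k * N\<^sup>2 / M"
  have N0: "0 < N" using p n by (simp add: N_def)
  have \<Lambda>0: "0 < \<Lambda>" using N0 M k by (simp add: \<Lambda>_def)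
  define \<mu> where "\<mu> = (\<Sum>f\<in>\<F>. p ^ card (image_graph F f))"
  have "\<mu> = card \<F> * p ^ card F"
  proof -
    have "\<mu> = (\<Sum>f\<in>\<F>. p ^ card F)"
      unfolding \<mu>_def using card_image_graph[OF F] \<F> by (intro sum.cong) auto
    then show ?thesis by simp
  qed
  also have "\<dots> \<ge> \<alpha> * N" unfolding N_def using \<alpha> p by (simp add: mult.assoc[symmetric] mult_right_mono)
  finally have \<mu>: "\<alpha> * N \<le> \<mu>" .
  have fin\<F>: "finite \<F>" using \<F> finite_subset finite_injections[of "{..<n}"] by blast
  have "prob (all_edges n) p (\<lambda>\<Gamma>. card {f\<in>\<F>. image_graph F f \<subseteq> \<Gamma>} \<le> \<alpha> / 2 * N)
     \<le> prob (all_edges n) p (\<lambda>\<Gamma>. real (card {f\<in>\<F>. image_graph F f \<subseteq> \<Gamma>}) \<le> \<mu> / 2)"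
    using \<mu> p by (intro prob_mono) auto
  also have "\<dots> \<le> exp (- \<mu>\<^sup>2 / (8 * \<Lambda>))"
    unfolding \<mu>_def
  proof (rule Janson)
    show "(\<Sum>f\<in>\<F>. \<Sum>g\<in>{g\<in>\<F>. image_graph F f \<inter> image_graph F g \<noteq> {}}.
      p ^ card (image_graph F f \<union> image_graph F g)) \<le> \<Lambda>"
      unfolding \<Lambda>_def N_def by (rule overlap_sum_le[OF F p M \<F> n])
    show "image_graph F f \<subseteq> all_edges n" if "f \<in> \<F>" for f
      using that \<F> image_graph_all_edges[OF F] by auto
  qed (use p \<Lambda>0 fin\<F> in auto)
  also have "\<dots> \<le> exp (- (\<alpha> * N)\<^sup>2 / (8 * \<Lambda>))"
    using \<mu> \<alpha> N0 \<Lambda>0 by (simp add: divide_right_mono power_mono)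
  also have "- (\<alpha> * N)\<^sup>2 / (8 * \<Lambda>) = - \<alpha>\<^sup>2 * M / (8 * 2 ^ card F * real k ^ k)"
    using N0 M by (simp add: \<Lambda>_def field_simps power_mult_distrib)
  finally show ?thesis by (simp add: N_def)
qed

lemma expect_copies_le:
  assumes F: "graph_on k F" and p: "0 \<le> p" "p \<le> 1"
  shows "expect (all_edges n) p (\<lambda>\<Gamma>. real (card (copies F k {..<n} \<Gamma>))) \<le> mean_copies F k n p"
proof -
  have "expect (all_edges n) p (\<lambda>\<Gamma>. real (card (copies F k {..<n} \<Gamma>)))
     = expect (all_edges n) p (\<lambda>\<Gamma>. \<Sum>f\<in>injections k {..<n}. of_bool (image_graph F f \<subseteq> \<Gamma>))"
    by (simp add: copies_def Int_def)
  also have "\<dots> = (\<Sum>f\<in>injections k {..<n}. p ^ card F)"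
    unfolding expect_sum using image_graph_all_edges[OF F] card_image_graph[OF F]
    by (intro sum.cong) (simp_all add: expect_superset_prob)
  also have "\<dots> = real (card (injections k {..<n})) * p ^ card F" by simp
  also have "\<dots> \<le> mean_copies F k n p"
  proof (intro mult_right_mono)
    show "real (card (injections k {..<n})) \<le> real n ^ k"
      using card_injections_le[of "{..<n}" k] by (metis card_lessThan finite_lessThan of_nat_le_iff of_nat_power)
  qed (use p in auto)
  finally show ?thesis .
qed

lemma copies_upper:
  assumes F: "graph_on k F" and p: "0 < p" "p \<le> 1" and L: "0 < L" and n: "0 < n"
  shows "prob (all_edges n) p (\<lambda>\<Gamma>. L * mean_copies F k n p \<le> card (copies F k {..<n} \<Gamma>)) \<le> 1 / L"
proof -
  have "prob (all_edges n) p (\<lambda>\<Gamma>. L * mean_copies F k n p \<le> card (copies F k {..<n} \<Gamma>))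
     \<le> expect (all_edges n) p (\<lambda>\<Gamma>. real (card (copies F k {..<n} \<Gamma>))) / (L * mean_copies F k n p)"
    using p L n by (intro Markov) auto
  also have "\<dots> \<le> mean_copies F k n p / (L * mean_copies F k n p)"
    using expect_copies_le[OF F, of p n] p L n by (intro divide_right_mono) auto
  also have "\<dots> = 1 / L" using p n by simp
  finally show ?thesis .
qed

text \<open>The expected number of overlapping pairs is the very sum that occurs in Janson's
  inequality, so \<open>overlap_sum_le\<close> serves here as well.\<close>

lemma overlaps_upper:
  assumes F: "graph_on k F" and k: "0 < k" and p: "0 < p" "p \<le> 1" and L: "0 < L" and n: "0 < n"
    and M: "0 < M" "rich F n p M"
  shows "prob (all_edges n) p (\<lambda>\<Gamma>. L * (2 ^ card F * real k ^ k * (mean_copies F k n p)\<^sup>2 / M)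
      \<le> card (overlaps F k {..<n} \<Gamma>)) \<le> 1 / L"
proof -
  define \<Lambda> where "\<Lambda> = 2 ^ card F * real k ^ k * (mean_copies F k n p)\<^sup>2 / M"
  have \<Lambda>0: "0 < \<Lambda>" using p n M k by (simp add: \<Lambda>_def)
  let ?I = "injections k {..<n}"
  have cardeq: "real (card (overlaps F k {..<n} \<Gamma>))
     = (\<Sum>f\<in>?I. \<Sum>g\<in>{g\<in>?I. image_graph F f \<inter> image_graph F g \<noteq> {}}.
         of_bool (image_graph F f \<union> image_graph F g \<subseteq> \<Gamma>))" for \<Gamma>
  proof -
    have "overlaps F k {..<n} \<Gamma> = Sigma ?I (\<lambda>f. {g\<in>?I. image_graph F f \<inter> image_graph F g \<noteq> {} \<and>
        image_graph F f \<union> image_graph F g \<subseteq> \<Gamma>})"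
      by (auto simp: overlaps_def copies_def)
    then have "real (card (overlaps F k {..<n} \<Gamma>)) = (\<Sum>f\<in>?I. real (card {g\<in>?I.
        image_graph F f \<inter> image_graph F g \<noteq> {} \<and> image_graph F f \<union> image_graph F g \<subseteq> \<Gamma>}))"
      by (simp only: card_SigmaI finite_injections finite_lessThan of_nat_sum finite_Collect_conjI)
        simp
    also have "\<dots> = (\<Sum>f\<in>?I. \<Sum>g\<in>{g\<in>?I. image_graph F f \<inter> image_graph F g \<noteq> {}}.
         of_bool (image_graph F f \<union> image_graph F g \<subseteq> \<Gamma>))"
    proof (intro sum.cong refl)
      fix f
      have "{g\<in>?I. image_graph F f \<inter> image_graph F g \<noteq> {} \<and> image_graph F f \<union> image_graph F g \<subseteq> \<Gamma>}
        = {g\<in>?I. image_graph F f \<inter> image_graph F g \<noteq> {}} \<inter> {g. image_graph F f \<union> image_graph F g \<subseteq> \<Gamma>}"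
        by auto
      then show "real (card {g\<in>?I. image_graph F f \<inter> image_graph F g \<noteq> {} \<and> image_graph F f \<union> image_graph F g \<subseteq> \<Gamma>})
        = (\<Sum>g\<in>{g\<in>?I. image_graph F f \<inter> image_graph F g \<noteq> {}}.
         of_bool (image_graph F f \<union> image_graph F g \<subseteq> \<Gamma>))"
        by (simp only: sum_of_bool_eq finite_Collect_conjI finite_injections finite_lessThan)
          simp
    qed
    finally show ?thesis .
  qed
  have "expect (all_edges n) p (\<lambda>\<Gamma>. real (card (overlaps F k {..<n} \<Gamma>)))
      = (\<Sum>f\<in>?I. \<Sum>g\<in>{g\<in>?I. image_graph F f \<inter> image_graph F g \<noteq> {}}.
          p ^ card (image_graph F f \<union> image_graph F g))"
    unfolding cardeq expect_sum using image_graph_all_edges[OF F]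
    by (intro sum.cong refl expect_superset_prob) auto
  also have "\<dots> \<le> \<Lambda>" unfolding \<Lambda>_def by (rule overlap_sum_le[OF F p M _ n]) simp
  finally have E: "expect (all_edges n) p (\<lambda>\<Gamma>. real (card (overlaps F k {..<n} \<Gamma>))) \<le> \<Lambda>" .
  have "prob (all_edges n) p (\<lambda>\<Gamma>. L * \<Lambda> \<le> card (overlaps F k {..<n} \<Gamma>))
     \<le> expect (all_edges n) p (\<lambda>\<Gamma>. real (card (overlaps F k {..<n} \<Gamma>))) / (L * \<Lambda>)"
    using p L \<Lambda>0 by (intro Markov) auto
  also have "\<dots> \<le> \<Lambda> / (L * \<Lambda>)" using E L \<Lambda>0 by (intro divide_right_mono) auto
  also have "\<dots> = 1 / L" using \<Lambda>0 by simp
  finally show ?thesis by (simp add: \<Lambda>_def)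
qed

subsection \<open>Cores, paths and cliques\<close>

text \<open>Delete vertices of degree below \<open>c\<close> one by one. Each deletion loses fewer
  than \<open>c\<close> pairs while the left side of the hypothesis drops by \<open>c\<close>, so
  the strict inequality survives and something nonempty remains. \<open>A\<close> and
  \<open>B\<close> may intersect.\<close>

lemma bipartite_core:
  fixes c :: real
  assumes "finite A" "finite B" "0 \<le> c"
    and "c * (card A + card B) < card {(x, y) \<in> A \<times> B. r x y}"
  obtains A' B' where "A' \<subseteq> A" "B' \<subseteq> B" "A' \<noteq> {}" "B' \<noteq> {}"
    "\<And>x. x \<in> A' \<Longrightarrow> c \<le> card {y \<in> B'. r x y}" "\<And>y. y \<in> B' \<Longrightarrow> c \<le> card {x \<in> A'. r x y}"
proof -
  have "\<exists>A' B'. A' \<subseteq> A \<and> B' \<subseteq> B \<and> A' \<noteq> {} \<and> B' \<noteq> {} \<and>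
    (\<forall>x\<in>A'. c \<le> card {y \<in> B'. r x y}) \<and> (\<forall>y\<in>B'. c \<le> card {x \<in> A'. r x y})"
    using assms
  proof (induction "card A + card B" arbitrary: A B rule: less_induct)
    case less
    have fin: "finite {(x, y) \<in> A \<times> B. r x y}"
      by (rule finite_subset[of _ "A \<times> B"]) (auto simp: less.prems(1,2))
    consider (1) x where "x \<in> A" "card {y \<in> B. r x y} < c"
      | (2) y where "y \<in> B" "card {x \<in> A. r x y} < c"
      | (3) "\<forall>x\<in>A. c \<le> card {y \<in> B. r x y}" "\<forall>y\<in>B. c \<le> card {x \<in> A. r x y}"
    proof (cases "(\<exists>x\<in>A. card {y \<in> B. r x y} < c) \<or> (\<exists>y\<in>B. card {x \<in> A. r x y} < c)")
      case True
      then show ?thesis using 1 2 by (elim disjE bexE)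
    next
      case False
      then show ?thesis using 3 by (simp add: not_less)
    qed
    then show ?case
    proof cases
      case 1
      let ?A = "A - {x}"
      have cA: "card A = Suc (card ?A)" using card_Suc_Diff1[OF less.prems(1) 1(1)] by simp
      have "{(x, y) \<in> A \<times> B. r x y} \<subseteq> {(x, y) \<in> ?A \<times> B. r x y} \<union> Pair x ` {y \<in> B. r x y}" by auto
      then have "card {(x, y) \<in> A \<times> B. r x y}
          \<le> card ({(x, y) \<in> ?A \<times> B. r x y} \<union> Pair x ` {y \<in> B. r x y})"
        by (intro card_mono finite_UnI finite_subset[OF _ fin]) (use 1(1) in \<open>auto simp: less.prems(1,2)\<close>)
      also have "\<dots> \<le> card {(x, y) \<in> ?A \<times> B. r x y} + card {y \<in> B. r x y}"
        by (rule order_trans[OF card_Un_le]) (simp add: card_image_le less.prems(1,2))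
      finally have "real (card {(x, y) \<in> A \<times> B. r x y})
         \<le> real (card {(x, y) \<in> ?A \<times> B. r x y}) + real (card {y \<in> B. r x y})" by linarith
      then have *: "c * (card ?A + card B) < card {(x, y) \<in> ?A \<times> B. r x y}"
        using less.prems(4) 1(2) by (simp add: cA algebra_simps)
      have "card ?A + card B < card A + card B" "finite ?A" using cA less.prems(1) by simp_all
      from less.hyps[OF this less.prems(2,3) *] obtain A' B' where "A' \<subseteq> ?A" "B' \<subseteq> B"
        "A' \<noteq> {} \<and> B' \<noteq> {} \<and>
        (\<forall>x\<in>A'. c \<le> card {y \<in> B'. r x y}) \<and> (\<forall>y\<in>B'. c \<le> card {x \<in> A'. r x y})"
        by blast
      then show ?thesis by blast
    next
      case 2
      let ?B = "B - {y}"
      have cB: "card B = Suc (card ?B)" using card_Suc_Diff1[OF less.prems(2) 2(1)] by simp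
      have "{(x, y) \<in> A \<times> B. r x y} \<subseteq> {(x, y) \<in> A \<times> ?B. r x y} \<union> (\<lambda>x. (x, y)) ` {x \<in> A. r x y}" by auto
      then have "card {(x, y) \<in> A \<times> B. r x y}
          \<le> card ({(x, y) \<in> A \<times> ?B. r x y} \<union> (\<lambda>x. (x, y)) ` {x \<in> A. r x y})"
        by (intro card_mono finite_UnI finite_subset[OF _ fin]) (use 2(1) in \<open>auto simp: less.prems(1,2)\<close>)
      also have "\<dots> \<le> card {(x, y) \<in> A \<times> ?B. r x y} + card {x \<in> A. r x y}"
        by (rule order_trans[OF card_Un_le]) (simp add: card_image_le less.prems(1,2))
      finally have "real (card {(x, y) \<in> A \<times> B. r x y})
         \<le> real (card {(x, y) \<in> A \<times> ?B. r x y}) + real (card {x \<in> A. r x y})" by linarith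
      then have *: "c * (card A + card ?B) < card {(x, y) \<in> A \<times> ?B. r x y}"
        using less.prems(4) 2(2) by (simp add: cB algebra_simps)
      have "card A + card ?B < card A + card B" "finite ?B" using cB less.prems(2) by simp_all
      from less.hyps[OF this(1) less.prems(1) this(2) less.prems(3) *] obtain A' B' where "A' \<subseteq> A" "B' \<subseteq> ?B"
        "A' \<noteq> {} \<and> B' \<noteq> {} \<and>
        (\<forall>x\<in>A'. c \<le> card {y \<in> B'. r x y}) \<and> (\<forall>y\<in>B'. c \<le> card {x \<in> A'. r x y})"
        by blast
      then show ?thesis by blast
    next
      case 3
      have "{(x, y) \<in> A \<times> B. r x y} \<noteq> {}"
      proof
        assume e: "{(x, y) \<in> A \<times> B. r x y} = {}"
        have "0 \<le> c * (card A + card B)" using less.prems by simp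
        then show False using less.prems(4) unfolding e by simp
      qed
      then have "A \<noteq> {}" "B \<noteq> {}" by auto
      then show ?thesis using 3 by blast
    qed
  qed
  then show ?thesis using that by blast
qed

lemma card_relation:
  assumes "finite A" "finite B"
  shows "card {(x, y) \<in> A \<times> B. r x y} = (\<Sum>x\<in>A. card {y \<in> B. r x y})"
    "card {(x, y) \<in> A \<times> B. r x y} = (\<Sum>y\<in>B. card {x \<in> A. r x y})"
proof -
  have *: "{(x, y) \<in> A \<times> B. r x y} = Sigma A (\<lambda>x. {y \<in> B. r x y})"
    "{(x, y) \<in> A \<times> B. r x y} = prod.swap ` Sigma B (\<lambda>y. {x \<in> A. r x y})" by force+
  show "card {(x, y) \<in> A \<times> B. r x y} = (\<Sum>x\<in>A. card {y \<in> B. r x y})"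
    unfolding *(1) using assms by simp
  show "card {(x, y) \<in> A \<times> B. r x y} = (\<Sum>y\<in>B. card {x \<in> A. r x y})"
    unfolding *(2) using assms by (subst card_image) (auto simp: inj_on_def)
qed

text \<open>Count pairs from both sides. The vertices of \<open>W\<close> below the cutoff account
  for at most half of them, and each of the others for at most \<open>card D\<close>.\<close>

lemma many_large_degrees:
  fixes m c :: real
  assumes fin: "finite W" "finite D" and m: "card W \<le> m" "0 < m" and D: "D \<noteq> {}" and c: "0 \<le> c"
    and deg: "\<And>x. x \<in> D \<Longrightarrow> c * m \<le> card {w \<in> W. r x w}"
  shows "c * m / 2 \<le> card {w \<in> W. c / 2 * card D \<le> card {x \<in> D. r x w}}"
proof -
  let ?W = "{w \<in> W. c / 2 * card D \<le> card {x \<in> D. r x w}}"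
  have D0: "0 < real (card D)" using D fin by (simp add: card_gt_0_iff)
  define k where "k w = card {x \<in> D. r x w}" for w
  have "c * m * card D = (\<Sum>x\<in>D. c * m)" by simp
  also have "\<dots> \<le> (\<Sum>x\<in>D. real (card {w \<in> W. r x w}))" by (intro sum_mono deg)
  also have "\<dots> = real (card {(x, w) \<in> D \<times> W. r x w})"
    using card_relation(1)[OF fin(2,1), of r] by simp
  also have "\<dots> = (\<Sum>w\<in>W. real (k w))"
    using card_relation(2)[OF fin(2,1), of r] by (simp add: k_def)
  also have "\<dots> \<le> (\<Sum>w\<in>W. of_bool (c / 2 * card D \<le> k w) * real (card D) + c / 2 * card D)"
  proof (intro sum_mono)
    fix w
    have "k w \<le> card D" unfolding k_def using fin by (intro card_mono) auto
    then show "real (k w) \<le> of_bool (c / 2 * card D \<le> k w) * real (card D) + c / 2 * card D"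
      using c by (auto simp: add_increasing2)
  qed
  also have "\<dots> = card ?W * card D + card W * (c / 2 * card D)"
    using fin by (simp add: sum.distrib sum_distrib_right[symmetric] k_def Int_def)
  also have "\<dots> \<le> card ?W * card D + m * (c / 2 * card D)"
    using m c by (intro add_left_mono mult_right_mono) auto
  finally have "c * m / 2 * card D \<le> card ?W * card D" by (simp add: algebra_simps)
  then show ?thesis using D0 by simp
qed

text \<open>A degenerate form of dependent random choice in which a single vertex \<open>w\<close> is chosen; it
  suffices because the threshold \<open>s\<close> may be taken arbitrarily small.\<close>

lemma dependent_choice:
  fixes s :: real
  assumes "finite W" "finite C" "V \<subseteq> W" "V \<noteq> {}" "0 \<le> s"
  obtains w where "w \<in> V"
    "card V * card {f \<in> C. q w f \<and> card {w' \<in> W. q w' f} < s} \<le> s * card C"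
proof -
  define bad where "bad w = card {f \<in> C. q w f \<and> card {w' \<in> W. q w' f} < s}" for w
  have finV: "finite V" using assms finite_subset by blast
  have "\<exists>w\<in>V. card V * bad w \<le> s * card C"
  proof (rule ccontr)
    assume "\<not> ?thesis"
    then have less: "\<And>w. w \<in> V \<Longrightarrow> s * card C < card V * bad w" by (meson not_le)
    have "card V * (s * card C) = (\<Sum>w\<in>V. s * card C)" by simp
    also have "\<dots> < (\<Sum>w\<in>V. real (card V * bad w))"
      using less assms finV by (intro sum_strict_mono) auto
    also have "\<dots> = card V * (\<Sum>w\<in>V. real (bad w))" by (simp add: sum_distrib_left)
    finally have "s * card C < (\<Sum>w\<in>V. real (bad w))"
      using assms finV by (simp add: card_gt_0_iff)
    also have "\<dots> = real (\<Sum>w\<in>V. bad w)" by simp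
    \<comment> \<open>Count the bad pairs by \<open>f\<close> instead: a bad \<open>f\<close> has
      fewer than \<open>s\<close> suitable vertices in \<open>W\<close>, hence in
      \<open>V\<close>.\<close>
    also have "(\<Sum>w\<in>V. bad w) = (\<Sum>f\<in>C. card {w \<in> V. q w f \<and> card {w' \<in> W. q w' f} < s})"
      unfolding bad_def
      by (rule trans[OF card_relation(1)[OF finV assms(2), symmetric] card_relation(2)[OF finV assms(2)]])
    also have "real \<dots> \<le> (\<Sum>f\<in>C. s)"
      unfolding of_nat_sum
    proof (intro sum_mono)
      fix f
      show "real (card {w \<in> V. q w f \<and> card {w' \<in> W. q w' f} < s}) \<le> s"
      proof (cases "card {w' \<in> W. q w' f} < s")
        case True
        have "card {w \<in> V. q w f} \<le> card {w' \<in> W. q w' f}"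
          using assms by (intro card_mono) auto
        then show ?thesis using True by auto
      qed (use assms in auto)
    qed
    finally show False by (simp add: mult.commute)
  qed
  then show ?thesis using that unfolding bad_def by auto
qed

text \<open>Cauchy-Schwarz over \<open>H\<close>, with X h the members of \<open>M\<close> through
  h: the sum of the |X h|^2 counts overlapping pairs with a marked common edge, and each pair has at
  most \<open>card F\<close> possible marks.\<close>

lemma edge_cover:
  assumes "graph_on k F" "M \<subseteq> copies F k {..<n} \<Gamma>" "finite H"
    and "\<And>f. f \<in> M \<Longrightarrow> image_graph F f \<inter> H \<noteq> {}"
  shows "(real (card M))\<^sup>2 \<le> card H * (card F * card (overlaps F k {..<n} \<Gamma>))"
proof -
  have finF: "finite F" using assms graph_on_finite by blast
  have finM: "finite M" using assms(2) finite_subset finite_copies finite_lessThan by metis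
  define X where "X h = {f \<in> M. h \<in> image_graph F f}" for h
  have finO: "finite (overlaps F k {..<n} \<Gamma>)"
    by (rule finite_subset[of _ "copies F k {..<n} \<Gamma> \<times> copies F k {..<n} \<Gamma>"])
      (auto simp: overlaps_def)
  have "M \<subseteq> (\<Union>h\<in>H. X h)" using assms(4) by (auto simp: X_def)
  then have "card M \<le> card (\<Union>h\<in>H. X h)"
    using finM assms by (intro card_mono) (auto simp: X_def)
  also have "\<dots> \<le> (\<Sum>h\<in>H. card (X h))" by (rule card_UN_le[OF assms(3)])
  finally have "real (card M) \<le> (\<Sum>h\<in>H. real (card (X h)))"
    by (metis of_nat_le_iff of_nat_sum)
  then have "(real (card M))\<^sup>2 \<le> (\<Sum>h\<in>H. real (card (X h)))\<^sup>2" by (intro power_mono) auto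
  also have "\<dots> \<le> (\<Sum>h\<in>H. (real (card (X h)))\<^sup>2) * card H" by (rule sum_squared_le_sum_of_squares)
  also have "(\<Sum>h\<in>H. (real (card (X h)))\<^sup>2) = real (card (SIGMA h:H. X h \<times> X h))"
    using assms finM by (subst card_SigmaI) (auto simp: X_def card_cartesian_product power2_eq_square)
  also have "card (SIGMA h:H. X h \<times> X h) \<le> card (SIGMA x:overlaps F k {..<n} \<Gamma>. image_graph F (fst x))"
  proof (rule card_inj_on_le)
    show "inj_on (\<lambda>(h, x). (x, h)) (SIGMA h:H. X h \<times> X h)" by (auto simp: inj_on_def)
    show "(\<lambda>(h, x). (x, h)) ` (SIGMA h:H. X h \<times> X h)
      \<subseteq> (SIGMA x:overlaps F k {..<n} \<Gamma>. image_graph F (fst x))"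
      using assms(2) by (auto simp: X_def overlaps_def)
    show "finite (SIGMA x:overlaps F k {..<n} \<Gamma>. image_graph F (fst x))"
      using finO finF by (auto simp: image_graph_def)
  qed
  also have "\<dots> = (\<Sum>x\<in>overlaps F k {..<n} \<Gamma>. card (image_graph F (fst x)))"
    using finO finF by (subst card_SigmaI) (auto simp: image_graph_def)
  also have "\<dots> \<le> (\<Sum>x\<in>overlaps F k {..<n} \<Gamma>. card F)"
    unfolding image_graph_def by (intro sum_mono card_image_le finF)
  finally show ?thesis by (simp add: mult_right_mono mult.commute mult.left_commute)
qed

section \<open>Greedy paths and the cycles they close\<close>

lemma exists_outside:
  assumes "finite Q" "card Q < card S" shows "\<exists>x\<in>S. x \<notin> Q"
  using assms by (metis card_mono leD subsetI)

text \<open>The path grows greedily at its head, so \<open>z0\<close> stays last and the parity of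
  \<open>m\<close> decides the side on which the head lies. As \<open>Z\<close> and \<open>W\<close>
  may intersect, every new vertex must avoid the whole path as well as \<open>Q\<close>.\<close>

lemma alternating_path:
  assumes fin: "finite Q"
    and deg: "\<And>z. z \<in> Z \<Longrightarrow> K \<le> card {w \<in> W. {z, w} \<in> H}"
      "\<And>w. w \<in> W \<Longrightarrow> K \<le> card {z \<in> Z. {z, w} \<in> H}"
    and "m + card Q < K" and z0: "z0 \<in> Z" "z0 \<notin> Q"
  shows "\<exists>xs. length xs = Suc m \<and> distinct xs \<and> last xs = z0 \<and> hd xs \<in> (if even m then Z else W)
    \<and> set xs \<subseteq> Z \<union> W \<and> set xs \<inter> Q = {} \<and> successively (\<lambda>x y. {x, y} \<in> H) xs"
  using \<open>m + card Q < K\<close>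
proof (induction m)
  case 0
  show ?case using z0 by (intro exI[of _ "[z0]"]) auto
next
  case (Suc m)
  then obtain xs where xs: "length xs = Suc m" "distinct xs" "last xs = z0"
    "hd xs \<in> (if even m then Z else W)" "set xs \<subseteq> Z \<union> W" "set xs \<inter> Q = {}"
    "successively (\<lambda>x y. {x, y} \<in> H) xs" by auto
  let ?T = "if even m then W else Z"
  have "K \<le> card {w \<in> ?T. {w, hd xs} \<in> H}"
    using deg(1)[of "hd xs"] deg(2)[of "hd xs"] xs(4) by (auto simp: insert_commute split: if_splits)
  moreover have "card (Q \<union> set xs) \<le> card Q + Suc m"
    using card_Un_le[of Q "set xs"] xs(1) card_length[of xs] by linarith
  ultimately obtain y where y: "y \<in> ?T" "{y, hd xs} \<in> H" "y \<notin> Q \<union> set xs"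
    using exists_outside[of "Q \<union> set xs" "{w \<in> ?T. {w, hd xs} \<in> H}"] fin Suc.prems by auto
  have "xs \<noteq> []" using xs by auto
  then show ?case
    using xs y by (intro exI[of _ "y # xs"]) (auto simp: successively_Cons split: if_splits)
qed

lemma has_cycle:
  assumes "length xs = l" "distinct xs" "3 \<le> l" "successively (\<lambda>x y. {x, y} \<in> H) xs"
    "{last xs, hd xs} \<in> H"
  shows "has_copy (cycle_graph l) l H"
  unfolding has_copy_def
proof (intro exI[of _ "(!) xs"] conjI ballI)
  show "inj_on ((!) xs) {0..<l}" using assms by (auto simp: inj_on_def nth_eq_iff_index_eq)
  fix e assume "e \<in> cycle_graph l"
  then obtain i where i: "i < l" "e = {i, (i + 1) mod l}" by (auto simp: cycle_graph_def)
  show "(!) xs ` e \<in> H"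
  proof (cases "i + 1 < l")
    case True
    then show ?thesis using i assms by (auto simp: successively_conv_nth)
  next
    case False
    then have "i = l - 1" using i by auto
    moreover have "xs \<noteq> []" using assms by auto
    ultimately show ?thesis using i assms by (simp add: last_conv_nth hd_conv_nth)
  qed
qed

section \<open>Cliques as images of labelled embeddings\<close>

lemma complete_graph_edge: "i < t \<Longrightarrow> j < t \<Longrightarrow> i \<noteq> j \<Longrightarrow> {i, j} \<in> complete_graph t"
  unfolding complete_graph_def all_edges_def by blast

lemma graph_on_complete: "graph_on t (complete_graph t)"
  unfolding graph_on_def complete_graph_def by (auto simp: all_edges_iff)

lemma image_complete_subset_iff:
  "image_graph (complete_graph t) f \<subseteq> R \<longleftrightarrow> (\<forall>i<t. \<forall>j<t. i \<noteq> j \<longrightarrow> {f i, f j} \<in> R)"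
proof
  assume a: "image_graph (complete_graph t) f \<subseteq> R"
  show "\<forall>i<t. \<forall>j<t. i \<noteq> j \<longrightarrow> {f i, f j} \<in> R"
  proof (intro allI impI)
    fix i j assume "i < t" "j < t" "i \<noteq> j"
    then have "f ` {i, j} \<in> image_graph (complete_graph t) f"
      unfolding image_graph_def by (intro imageI complete_graph_edge)
    then show "{f i, f j} \<in> R" using a by auto
  qed
next
  assume "\<forall>i<t. \<forall>j<t. i \<noteq> j \<longrightarrow> {f i, f j} \<in> R"
  then show "image_graph (complete_graph t) f \<subseteq> R"
    unfolding image_graph_def complete_graph_def all_edges_def by auto
qed

lemma has_copyI:
  assumes "f \<in> injections k S" "image_graph F f \<subseteq> R"
  shows "has_copy F k R"
  unfolding has_copy_def using assms
  by (intro exI[of _ f]) (auto simp: injections_def image_graph_def atLeast0LessThan)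

lemma has_clique_join:
  assumes f: "f \<in> injections a S" "image_graph (complete_graph a) f \<subseteq> R"
    and g: "g \<in> injections b T" "image_graph (complete_graph b) g \<subseteq> R"
    and cross: "\<And>i j. i < a \<Longrightarrow> j < b \<Longrightarrow> {f i, g j} \<in> R" "\<And>i j. i < a \<Longrightarrow> j < b \<Longrightarrow> f i \<noteq> g j"
  shows "has_copy (complete_graph (a + b)) (a + b) R"
proof -
  define h where "h i = (if i < a then f i else g (i - a))" for i
  have inj: "inj_on h {..<a + b}"
  proof (rule inj_onI)
    fix x y assume xy: "x \<in> {..<a + b}" "y \<in> {..<a + b}" "h x = h y"
    have injs: "inj_on f {..<a}" "inj_on g {..<b}" using f(1) g(1) by (auto simp: injections_def)
    consider "x < a" "y < a" | "x < a" "\<not> y < a" | "\<not> x < a" "y < a" | "\<not> x < a" "\<not> y < a" by auto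
    then show "x = y"
    proof cases
      case 1 then show ?thesis using xy injs(1) by (simp add: h_def inj_on_def)
    next
      case 2
      then have "y - a < b" using xy by auto
      then show ?thesis using xy 2 cross(2)[of x "y - a"] by (simp add: h_def)
    next
      case 3
      then have "x - a < b" using xy by auto
      then show ?thesis using xy 3 cross(2)[of y "x - a"] by (simp add: h_def)
    next
      case 4
      then have "g (x - a) = g (y - a)" "x - a < b" "y - a < b" using xy by (auto simp: h_def)
      then have "x - a = y - a" using injs(2) by (simp add: inj_on_def)
      then show ?thesis using 4 by simp
    qed
  qed
  have "{h i, h j} \<in> R" if "i < a + b" "j < a + b" "i \<noteq> j" for i j
  proof -
    consider "i < a" "j < a" | "i < a" "\<not> j < a" | "\<not> i < a" "j < a" | "\<not> i < a" "\<not> j < a" by auto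
    then show ?thesis
    proof cases
      case 1 then show ?thesis using f(2) that by (simp add: h_def image_complete_subset_iff)
    next
      case 2 then show ?thesis using cross(1)[of i "j - a"] that by (simp add: h_def)
    next
      case 3 then show ?thesis using cross(1)[of j "i - a"] that by (simp add: h_def insert_commute)
    next
      case 4
      then have "i - a < b" "j - a < b" "i - a \<noteq> j - a" using that by auto
      then show ?thesis using g(2) 4 by (simp add: h_def image_complete_subset_iff)
    qed
  qed
  then show ?thesis
    unfolding has_copy_def using inj
    by (intro exI[of _ h]) (auto simp: atLeast0LessThan complete_graph_def all_edges_def)
qed

subsection \<open>Colourings in which few dense edges are red\<close>

definition count_upper :: "nat set set \<Rightarrow> nat \<Rightarrow> nat \<Rightarrow> real \<Rightarrow> real \<Rightarrow> nat set set \<Rightarrow> bool" where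
  "count_upper F k n p L \<Gamma> \<longleftrightarrow> card (copies F k {..<n} \<Gamma>) \<le> L * mean_copies F k n p"

text \<open>Halving \<open>card S\<close> allows for embeddings having to be injective; the other
  factor 1/2 is the loss in Janson's inequality. The bound is asked of all large \<open>S\<close> at
  once because it is applied to sets that depend on the graph and its colouring.\<close>

definition dense_copies :: "nat set set \<Rightarrow> nat \<Rightarrow> nat \<Rightarrow> real \<Rightarrow> real \<Rightarrow> nat set set \<Rightarrow> bool" where
  "dense_copies F k n p \<delta> \<Gamma> \<longleftrightarrow> (\<forall>S\<subseteq>{..<n}. \<delta> * real n \<le> real (card S) \<longrightarrow>
     (real (card S) / 2) ^ k / 2 * p ^ card F \<le> card (copies F k S \<Gamma>))"

text \<open>The bound of \<open>overlaps_upper\<close> for \<open>M\<close> = n^2 p, multiplied out.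
  This choice of \<open>M\<close> is available when a single edge is the rarest subgraph of
  \<open>F\<close>.\<close>

definition few_overlaps :: "nat set set \<Rightarrow> nat \<Rightarrow> nat \<Rightarrow> real \<Rightarrow> real \<Rightarrow> nat set set \<Rightarrow> bool" where
  "few_overlaps F k n p L \<Gamma> \<longleftrightarrow>
     (real n)\<^sup>2 * p * card (overlaps F k {..<n} \<Gamma>) \<le> L * (mean_copies F k n p)\<^sup>2"

lemma dense_copiesD:
  assumes "dense_copies F k n p \<delta> \<Gamma>" "S \<subseteq> {..<n}" "\<delta> \<le> \<delta>'" "\<delta>' * n \<le> card S" "0 \<le> \<delta>'" "0 \<le> p"
  shows "(\<delta>' / 2) ^ k / 2 * mean_copies F k n p \<le> card (copies F k S \<Gamma>)"
proof -
  have "(\<delta>' / 2) ^ k / 2 * mean_copies F k n p = (\<delta>' * n / 2) ^ k / 2 * p ^ card F"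
    by (simp add: power_mult_distrib power_divide)
  also have "\<dots> \<le> (card S / 2) ^ k / 2 * p ^ card F"
    using assms by (intro mult_right_mono divide_right_mono power_mono) auto
  also have "\<dots> \<le> card (copies F k S \<Gamma>)"
  proof -
    have "\<delta> * n \<le> card S" using assms(3,4) mult_right_mono[of \<delta> \<delta>' "real n"] by simp
    then show ?thesis using assms(1,2) unfolding dense_copies_def by blast
  qed
  finally show ?thesis .
qed

lemma few_large_degrees:
  fixes m h :: real
  assumes "finite A" "finite B" "0 < h" "card {(x, y) \<in> A \<times> B. r x y} \<le> m * h"
  shows "card {x \<in> A. h \<le> card {y \<in> B. r x y}} \<le> m"
proof -
  let ?X = "{x \<in> A. h \<le> card {y \<in> B. r x y}}"
  have "card ?X * h = (\<Sum>x\<in>?X. h)" by simp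
  also have "\<dots> \<le> (\<Sum>x\<in>?X. real (card {y \<in> B. r x y}))" by (intro sum_mono) simp
  also have "\<dots> \<le> (\<Sum>x\<in>A. real (card {y \<in> B. r x y}))" using assms by (intro sum_mono2) auto
  also have "\<dots> = card {(x, y) \<in> A \<times> B. r x y}" using card_relation(1)[OF assms(1,2), of r] by simp
  finally show ?thesis using assms(3,4) by (meson dual_order.trans mult_le_cancel_right_pos)
qed

lemma all_edges_neq: "B \<subseteq> all_edges n \<Longrightarrow> {x, y} \<in> B \<Longrightarrow> x \<noteq> y"
  by (auto simp: all_edges_iff subset_iff)

text \<open>A blue path on \<open>l - 2\<close> vertices alternating between \<open>Z\<close> and
  \<open>W\<close> with both ends in \<open>Z\<close> closes up through the edge from
  \<open>x\<close> to \<open>y\<close>, as every vertex of \<open>Z\<close> is joined in blue to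
  both. Such a path has an odd number of vertices, which is where the parity of \<open>l\<close>
  enters.\<close>

lemma blue_cycle_through_edge:
  fixes c e :: real
  assumes l: "odd l" "5 \<le> l" and B: "B \<subseteq> all_edges n" "{x, y} \<in> B"
    and ZW: "Z \<subseteq> {..<n}" "W \<subseteq> {..<n}"
    and Z: "\<And>z. z \<in> Z \<Longrightarrow> {x, z} \<in> B \<and> {y, z} \<in> B"
    and deg: "\<And>z. z \<in> Z \<Longrightarrow> c * n \<le> card {w \<in> W. {z, w} \<in> B}"
    and card: "e * n \<le> card Z" "0 < c" "0 < e" and big: "real l + 1 \<le> c * e * n / 3"
  shows "has_copy (cycle_graph l) l B"
proof -
  have fin: "finite Z" "finite W" using ZW finite_subset by auto
  have n0: "0 < real n" using big by (cases "n = 0") auto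
  have cards: "card Z \<le> n" "card W \<le> n"
    using card_mono[OF _ ZW(1)] card_mono[OF _ ZW(2)] by auto
  \<comment> \<open>There are at least c e n^2 blue pairs between \<open>Z\<close> and
    \<open>W\<close>, and \<open>bipartite_core\<close> compares them with at most 2 n D; any
    constant below c e / 2 would do.\<close>
  define D where "D = c * e * n / 3"
  have D0: "0 < D" using card n0 by (simp add: D_def)
  have "D * (card Z + card W) \<le> D * (n + n)" using cards D0 by (intro mult_left_mono) auto
  also have "\<dots> < c * n * (e * n)"
    using n0 card by (simp add: D_def field_simps)
  also have "\<dots> \<le> c * n * card Z" using card by (intro mult_left_mono) auto
  also have "\<dots> = (\<Sum>z\<in>Z. c * n)" by simp
  also have "\<dots> \<le> (\<Sum>z\<in>Z. real (card {w \<in> W. {z, w} \<in> B}))" by (intro sum_mono deg)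
  also have "\<dots> = card {(z, w) \<in> Z \<times> W. {z, w} \<in> B}"
    using card_relation(1)[OF fin, of "\<lambda>z w. {z, w} \<in> B"] by simp
  finally have edges: "D * (card Z + card W) < card {(z, w) \<in> Z \<times> W. {z, w} \<in> B}" by simp
  obtain Z1 W1 where ZW1: "Z1 \<subseteq> Z" "W1 \<subseteq> W" "Z1 \<noteq> {}" "W1 \<noteq> {}"
    "\<And>z. z \<in> Z1 \<Longrightarrow> D \<le> card {w \<in> W1. {z, w} \<in> B}" "\<And>w. w \<in> W1 \<Longrightarrow> D \<le> card {z \<in> Z1. {z, w} \<in> B}"
    by (rule bipartite_core[OF fin less_imp_le[OF D0] edges]) blast
  obtain z0 where z0: "z0 \<in> Z1" using ZW1 by auto
  have K: "l + 1 \<le> m" if "D \<le> real m" for m using that big unfolding D_def[symmetric] by linarith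
  have xyZ: "x \<notin> Z" "y \<notin> Z" using Z all_edges_neq[OF B(1)] by blast+
  have "card {x, y} \<le> 2" by (simp add: card_insert_if)
  then have "(l - 3) + card {x, y} < l + 1" using l by linarith
  \<comment> \<open>\<open>l - 3\<close> is even, so the head lies in \<open>Z1\<close>, like the
    fixed end \<open>z0\<close>.\<close>
  then have "\<exists>xs. length xs = Suc (l - 3) \<and> distinct xs \<and> last xs = z0 \<and>
      hd xs \<in> (if even (l - 3) then Z1 else W1) \<and> set xs \<subseteq> Z1 \<union> W1 \<and> set xs \<inter> {x, y} = {} \<and>
      successively (\<lambda>x y. {x, y} \<in> B) xs"
  proof (rule alternating_path[rotated 3])
    show "l + 1 \<le> card {w \<in> W1. {z, w} \<in> B}" if "z \<in> Z1" for z by (rule K[OF ZW1(5)[OF that]])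
    show "l + 1 \<le> card {z \<in> Z1. {z, w} \<in> B}" if "w \<in> W1" for w by (rule K[OF ZW1(6)[OF that]])
  qed (use z0 xyZ ZW1(1) in auto)
  then obtain xs where xs: "length xs = Suc (l - 3)" "distinct xs" "last xs = z0"
    "hd xs \<in> (if even (l - 3) then Z1 else W1)" "set xs \<inter> {x, y} = {}"
    "successively (\<lambda>x y. {x, y} \<in> B) xs" by blast
  have hd: "hd xs \<in> Z1" using xs(4) l by auto
  have "xs \<noteq> []" using xs(1) by auto
  show ?thesis
  proof (rule has_cycle[of "y # x # xs"])
    show "length (y # x # xs) = l" using xs(1) l by simp
    show "distinct (y # x # xs)" using xs(2,5) all_edges_neq[OF B] by auto
    have "{x, hd xs} \<in> B" using Z ZW1(1) hd by blast
    then show "successively (\<lambda>x y. {x, y} \<in> B) (y # x # xs)"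
      using xs(6) B(2) by (auto simp: successively_Cons insert_commute)
    have "{y, last xs} \<in> B" unfolding xs(3) using Z ZW1(1) z0 by blast
    then show "{last (y # x # xs), hd (y # x # xs)} \<in> B"
      using \<open>xs \<noteq> []\<close> by (simp add: insert_commute)
  qed (use l in auto)
qed

text \<open>Restricting to the blue neighbourhood \<open>S\<close> of a well chosen \<open>w\<close>
  leaves more cliques in \<open>S\<close> than there are cliques with few common blue neighbours. A
  clique with many of them cannot contain a blue edge, by
  \<open>blue_cycle_through_edge\<close>.\<close>

lemma clique_avoiding_blue:
  fixes c \<delta> \<delta>' \<epsilon> L p :: real
  assumes l: "odd l" "5 \<le> l" and B: "B \<subseteq> all_edges n" "\<not> has_copy (cycle_graph l) l B"
    and T: "TA \<subseteq> {..<n}" "TB \<subseteq> {..<n}"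
    and deg: "\<And>z. z \<in> TB \<Longrightarrow> c * n \<le> card {w \<in> TA. {z, w} \<in> B}"
      "\<And>w. w \<in> TA \<Longrightarrow> c * n \<le> card {z \<in> TB. {w, z} \<in> B}"
    and D: "D \<subseteq> TB" "\<delta> * n \<le> card D" and pos: "0 < c" "0 < \<delta>" "0 < L" "0 < n" "0 < p"
    and \<Gamma>: "count_upper (complete_graph k) k n p L \<Gamma>"
      "dense_copies (complete_graph k) k n p \<delta>' \<Gamma>" "\<delta>' \<le> c * \<delta> / 2"
    and \<epsilon>: "\<epsilon> = c * (c * \<delta> / 4) ^ k / (8 * L)" and big: "real l + 1 \<le> c * \<epsilon> * n / 3"
  obtains f where "f \<in> copies (complete_graph k) k D \<Gamma>"
    "\<And>i j. i < k \<Longrightarrow> j < k \<Longrightarrow> {f i, f j} \<notin> B"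
proof -
  define N where "N = mean_copies (complete_graph k) k n p"
  have N0: "0 < N" using pos by (simp add: N_def)
  have \<epsilon>0: "0 < \<epsilon>" using pos by (simp add: \<epsilon>)
  have fin: "finite TA" "finite D" using T D finite_subset[of _ "{..<n}"] by auto
  define V where "V = {w \<in> TA. c / 2 * card D \<le> card {x \<in> D. {x, w} \<in> B}}"
  define C where "C = copies (complete_graph k) k {..<n} \<Gamma>"
  have finC: "finite C" by (simp add: C_def)
  have "0 < \<delta> * n" using pos by simp
  then have "D \<noteq> {}" using D by auto
  then have V: "c * n / 2 \<le> card V"
    unfolding V_def using many_large_degrees[OF fin, of "real n" c "\<lambda>x w. {x, w} \<in> B"]
      deg(1) D pos card_mono[OF _ T(1)] by auto
  moreover have "0 < c * n / 2" using pos by simp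
  ultimately have V0: "V \<noteq> {}" "0 < card V" by auto
  obtain w where w: "w \<in> V"
    "card V * card {f \<in> C. (\<forall>i<k. {f i, w} \<in> B) \<and> card {w' \<in> TA. \<forall>i<k. {f i, w'} \<in> B} < \<epsilon> * n}
      \<le> \<epsilon> * n * card C"
    using dependent_choice[OF fin(1) finC _ V0(1), of "\<epsilon> * n" "\<lambda>w f. \<forall>i<k. {f i, w} \<in> B"] \<epsilon>0
    by (auto simp: V_def)
  define bad where "bad = {f \<in> C. (\<forall>i<k. {f i, w} \<in> B) \<and> card {w' \<in> TA. \<forall>i<k. {f i, w'} \<in> B} < \<epsilon> * n}"
  define S where "S = {x \<in> D. {x, w} \<in> B}"
  have "c * n / 2 * card bad \<le> real (card V) * card bad" using V by (intro mult_right_mono) auto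
  also have "\<dots> \<le> \<epsilon> * n * card C" using w(2) unfolding bad_def by simp
  also have "\<dots> \<le> \<epsilon> * n * (L * N)"
    using \<Gamma>(1) \<epsilon>0 unfolding count_upper_def C_def N_def by (intro mult_left_mono) auto
  finally have "card bad \<le> 2 * \<epsilon> * L / c * N" using pos by (simp add: field_simps)
  \<comment> \<open>The value of \<open>\<epsilon>\<close> is chosen here: the bad cliques are at
    most half of the number guaranteed inside \<open>S\<close>.\<close>
  also have "2 * \<epsilon> * L / c = (c * \<delta> / 4) ^ k / 4" using pos by (simp add: \<epsilon> field_simps)
  also have "(c * \<delta> / 4) ^ k / 4 * N < (c * \<delta> / 2 / 2) ^ k / 2 * N"
    using N0 pos by (intro mult_strict_right_mono) (auto simp: field_simps)
  also have "\<dots> \<le> card (copies (complete_graph k) k S \<Gamma>)"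
    unfolding N_def
  proof (rule dense_copiesD[OF \<Gamma>(2) _ \<Gamma>(3)])
    show "S \<subseteq> {..<n}" using D T by (auto simp: S_def)
    have "c * \<delta> / 2 * n = c / 2 * (\<delta> * n)" by simp
    also have "\<dots> \<le> c / 2 * card D" using D pos by (intro mult_left_mono) auto
    also have "\<dots> \<le> card S" using w(1) by (simp add: V_def S_def)
    finally show "c * \<delta> / 2 * real n \<le> real (card S)" .
  qed (use pos in auto)
  finally have "card bad < card (copies (complete_graph k) k S \<Gamma>)" by simp
  then obtain f where f: "f \<in> copies (complete_graph k) k S \<Gamma>" "f \<notin> bad"
    using exists_outside[of bad "copies (complete_graph k) k S \<Gamma>"] finC by (auto simp: bad_def)
  have SD: "S \<subseteq> D" "S \<subseteq> {..<n}" using D T by (auto simp: S_def)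
  have fS: "f i \<in> S" if "i < k" for i using f(1) that by (auto simp: copies_def injections_def)
  have "f \<in> C" using f(1) copies_mono[OF SD(2)] unfolding C_def by blast
  then have common: "\<epsilon> * n \<le> card {w' \<in> TA. \<forall>i<k. {f i, w'} \<in> B}"
    using f(2) fS by (auto simp: bad_def S_def)
  show ?thesis
  proof
    show "f \<in> copies (complete_graph k) k D \<Gamma>" using f(1) copies_mono[OF SD(1)] by blast
    fix i j assume ij: "i < k" "j < k"
    show "{f i, f j} \<notin> B"
    proof
      assume "{f i, f j} \<in> B"
      then have "has_copy (cycle_graph l) l B"
      proof (rule blue_cycle_through_edge[OF l B(1) _ _ T(2) _ _ common pos(1) \<epsilon>0 big])
        show "{w' \<in> TA. \<forall>i<k. {f i, w'} \<in> B} \<subseteq> {..<n}" using T(1) by blast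
        show "{f i, z} \<in> B \<and> {f j, z} \<in> B" if "z \<in> {w' \<in> TA. \<forall>i<k. {f i, w'} \<in> B}" for z
          using that ij by blast
        show "c * n \<le> card {w \<in> TB. {z, w} \<in> B}" if "z \<in> {w' \<in> TA. \<forall>i<k. {f i, w'} \<in> B}" for z
          using that deg(2) by blast
      qed
      then show False using B(2) by simp
    qed
  qed
qed

lemma card_minus_le:
  assumes "finite Y" "finite Z" "X - Y \<subseteq> Z" "finite X"
  shows "real (card X) - card Y \<le> card Z"
proof -
  have "card X \<le> card (Y \<union> Z)" using assms by (intro card_mono) auto
  also have "\<dots> \<le> card Y + card Z" by (rule card_Un_le)
  finally show ?thesis by simp
qed

text \<open>Discarding the vertices of red degree at least \<open>\<theta> * n\<close> leaves
  \<open>TA\<close> and \<open>TB\<close> with linear blue minimum degrees. If the prescribed clique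
  lies in \<open>TA\<close>, any blue edge of it would close a blue cycle. If not, one of its
  vertices was discarded, and its large red neighbourhood holds a red clique on \<open>t - 1\<close>
  vertices.\<close>

lemma few_red_case:
  fixes c e \<theta> \<delta>' \<epsilon> L p :: real
  assumes l: "odd l" "5 \<le> l" and t: "2 \<le> t"
    and GG: "G \<subseteq> all_edges n" "\<Gamma> \<subseteq> all_edges n" and B: "\<not> has_copy (cycle_graph l) l ((G \<union> \<Gamma>) - R)"
    and AB: "A1 \<subseteq> {..<n}" "B1 \<subseteq> {..<n}"
    and deg: "\<And>x. x \<in> A1 \<Longrightarrow> c * n \<le> card {y \<in> B1. {x, y} \<in> G}"
      "\<And>y. y \<in> B1 \<Longrightarrow> c * n \<le> card {x \<in> A1. {x, y} \<in> G}"
    and f: "f \<in> copies (complete_graph t) t A1 \<Gamma>" "e * n \<le> card {y \<in> B1. \<forall>i<t. {f i, y} \<in> G}"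
    and pos: "0 < c" "0 < e" "0 < \<theta>" "0 < L" "0 < n" "0 < p"
    and \<theta>: "\<theta> \<le> c / 4" "\<theta> * (2 * (real t + 1)) \<le> e"
    and red: "card {(x, y) \<in> A1 \<times> B1. {x, y} \<in> G \<inter> R} \<le> \<theta>\<^sup>2 / 2 * n\<^sup>2"
    and \<Gamma>: "count_upper (complete_graph (t - 1)) (t - 1) n p L \<Gamma>"
      "dense_copies (complete_graph (t - 1)) (t - 1) n p \<delta>' \<Gamma>" "\<delta>' \<le> c * \<theta> / 8"
    and \<epsilon>: "\<epsilon> = c / 2 * (c * \<theta> / 16) ^ (t - 1) / (8 * L)"
    and big: "real l + 1 \<le> c / 2 * \<epsilon> * n / 3" "real l + 1 \<le> c / 2 * (e / 2) * n / 3"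
  shows "has_copy (complete_graph t) t R"
proof -
  define Bl where "Bl = (G \<union> \<Gamma>) - R"
  have Bl: "Bl \<subseteq> all_edges n" using GG by (auto simp: Bl_def)
  have fin: "finite A1" "finite B1" using AB finite_subset by auto
  define TA where "TA = {x \<in> A1. card {y \<in> B1. {x, y} \<in> G \<inter> R} < \<theta> * n}"
  define TB where "TB = {y \<in> B1. card {x \<in> A1. {x, y} \<in> G \<inter> R} < \<theta> * n}"
  have \<theta>n: "0 < \<theta> * n" using pos by simp
  have TT: "TA \<subseteq> {..<n}" "TB \<subseteq> {..<n}" using AB by (auto simp: TA_def TB_def)
  have finT: "finite TA" "finite TB" using fin by (auto simp: TA_def TB_def)
  have red': "card {(x, y) \<in> A1 \<times> B1. {x, y} \<in> G \<inter> R} \<le> (\<theta> * n / 2) * (\<theta> * n)"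
    using red by (simp add: power2_eq_square algebra_simps)
  have "A1 - TA = {x \<in> A1. \<theta> * n \<le> card {y \<in> B1. {x, y} \<in> G \<inter> R}}" by (auto simp: TA_def)
  then have atA: "card (A1 - TA) \<le> \<theta> * n / 2"
    using few_large_degrees[OF fin \<theta>n red'] by simp
  have sw: "card {(y, x) \<in> B1 \<times> A1. {x, y} \<in> G \<inter> R} = card {(x, y) \<in> A1 \<times> B1. {x, y} \<in> G \<inter> R}"
    unfolding card_relation(1)[OF fin(2,1), of "\<lambda>y x. {x, y} \<in> G \<inter> R"]
      card_relation(2)[OF fin, of "\<lambda>x y. {x, y} \<in> G \<inter> R"] by simp
  have "B1 - TB = {y \<in> B1. \<theta> * n \<le> card {x \<in> A1. {x, y} \<in> G \<inter> R}}" by (auto simp: TB_def)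
  then have atB: "card (B1 - TB) \<le> \<theta> * n / 2"
    using few_large_degrees[OF fin(2,1) \<theta>n, of "\<lambda>y x. {x, y} \<in> G \<inter> R" "\<theta> * n / 2"] red' sw by simp
  \<comment> \<open>A vertex loses at most \<open>\<theta> * n\<close> neighbours to red edges and
    at most \<open>\<theta> * n / 2\<close> to the discarded vertices on the other side.\<close>
  have c2: "\<theta> * n + \<theta> * n / 2 \<le> c / 2 * n"
  proof -
    have "\<theta> * n \<le> c / 4 * n" using \<theta>(1) by (intro mult_right_mono) auto
    then show ?thesis using pos by (simp add: field_simps)
  qed
  have degA: "c / 2 * n \<le> card {y \<in> TB. {x, y} \<in> Bl}" if x: "x \<in> TA" for x
  proof -
    have xA: "x \<in> A1" "card {y \<in> B1. {x, y} \<in> G \<inter> R} < \<theta> * n" using x by (auto simp: TA_def)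
    have "real (card {y \<in> B1. {x, y} \<in> G}) - card ({y \<in> B1. {x, y} \<in> G \<inter> R} \<union> (B1 - TB))
        \<le> card {y \<in> TB. {x, y} \<in> Bl}"
      using fin finT by (intro card_minus_le) (auto simp: Bl_def TB_def)
    moreover have "card ({y \<in> B1. {x, y} \<in> G \<inter> R} \<union> (B1 - TB))
      \<le> card {y \<in> B1. {x, y} \<in> G \<inter> R} + card (B1 - TB)" by (rule card_Un_le)
    ultimately show ?thesis using deg(1)[OF xA(1)] xA(2) atB c2 by linarith
  qed
  have degB: "c / 2 * n \<le> card {x \<in> TA. {y, x} \<in> Bl}" if y: "y \<in> TB" for y
  proof -
    have yB: "y \<in> B1" "card {x \<in> A1. {x, y} \<in> G \<inter> R} < \<theta> * n" using y by (auto simp: TB_def)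
    have "real (card {x \<in> A1. {x, y} \<in> G}) - card ({x \<in> A1. {x, y} \<in> G \<inter> R} \<union> (A1 - TA))
        \<le> card {x \<in> TA. {y, x} \<in> Bl}"
      using fin finT by (intro card_minus_le) (auto simp: Bl_def TA_def insert_commute)
    moreover have "card ({x \<in> A1. {x, y} \<in> G \<inter> R} \<union> (A1 - TA))
      \<le> card {x \<in> A1. {x, y} \<in> G \<inter> R} + card (A1 - TA)" by (rule card_Un_le)
    ultimately show ?thesis using deg(2)[OF yB(1)] yB(2) atA c2 by linarith
  qed
  have fA: "f i \<in> A1" if "i < t" for i using f(1) that by (auto simp: copies_def injections_def)
  have f\<Gamma>: "f \<in> injections t A1" "image_graph (complete_graph t) f \<subseteq> \<Gamma>"
    using f(1) by (auto simp: copies_def)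
  show ?thesis
  proof (cases "\<forall>i<t. f i \<in> TA")
    case True
    define Z where "Z = {y \<in> TB. \<forall>i<t. {f i, y} \<in> Bl}"
    \<comment> \<open>The common \<open>G\<close>-neighbours of the clique to be given up; the bound
      \<open>\<theta> * (2 * (t + 1)) \<le> e\<close> keeps them below half of all.\<close>
    define U where "U = (\<Union>i<t. {y \<in> B1. {f i, y} \<in> G \<inter> R}) \<union> (B1 - TB)"
    have "card U \<le> card (\<Union>i<t. {y \<in> B1. {f i, y} \<in> G \<inter> R}) + card (B1 - TB)"
      unfolding U_def by (rule card_Un_le)
    also have "card (\<Union>i<t. {y \<in> B1. {f i, y} \<in> G \<inter> R})
        \<le> (\<Sum>i<t. card {y \<in> B1. {f i, y} \<in> G \<inter> R})" by (rule card_UN_le) simp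
    finally have "real (card U) \<le> (\<Sum>i<t. real (card {y \<in> B1. {f i, y} \<in> G \<inter> R})) + card (B1 - TB)"
      unfolding of_nat_sum[symmetric] by linarith
    moreover have "(\<Sum>i<t. real (card {y \<in> B1. {f i, y} \<in> G \<inter> R})) \<le> (\<Sum>i<t. \<theta> * n)"
      using True by (intro sum_mono) (auto simp: TA_def less_imp_le)
    ultimately have U: "card U \<le> t * (\<theta> * n) + \<theta> * n / 2" using atB by simp
    have "real (card {y \<in> B1. \<forall>i<t. {f i, y} \<in> G}) - card U \<le> card Z"
      unfolding U_def Z_def
      using fin finT by (intro card_minus_le) (auto simp: Bl_def TB_def)
    moreover have "\<theta> * (2 * (real t + 1)) * n \<le> e * n" using \<theta>(2) by (intro mult_right_mono) auto
    ultimately have Z: "e / 2 * n \<le> card Z" using f(2) U \<theta>n by (simp add: algebra_simps)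
    have "{f i, f j} \<in> R" if ij: "i < t" "j < t" "i \<noteq> j" for i j
    proof (rule ccontr)
      assume "{f i, f j} \<notin> R"
      moreover have "{f i, f j} \<in> \<Gamma>" using f\<Gamma>(2) ij by (auto simp: image_complete_subset_iff)
      ultimately have "{f i, f j} \<in> Bl" by (auto simp: Bl_def)
      then have "has_copy (cycle_graph l) l Bl"
      proof (rule blue_cycle_through_edge[OF l Bl _ _ TT(1) _ _ Z _ _ big(2)])
        show "Z \<subseteq> {..<n}" using TT(2) by (auto simp: Z_def)
        show "{f i, z} \<in> Bl \<and> {f j, z} \<in> Bl" if "z \<in> Z" for z
          using that ij by (auto simp: Z_def)
        show "c / 2 * n \<le> card {w \<in> TA. {z, w} \<in> Bl}" if "z \<in> Z" for z
          using that degB by (auto simp: Z_def)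
      qed (use pos in auto)
      then show False using B by (simp add: Bl_def)
    qed
    then show ?thesis using f\<Gamma>(1) by (intro has_copyI) (auto simp: image_complete_subset_iff)
  next
    case False
    then obtain i where i: "i < t" "f i \<notin> TA" by auto
    \<comment> \<open>The red neighbourhood is cut down to \<open>TB\<close>, whose vertices still
      have large blue degree into \<open>TA\<close>, as \<open>clique_avoiding_blue\<close>
      demands.\<close>
    define D where "D = {y \<in> TB. {f i, y} \<in> G \<inter> R}"
    have "\<theta> * n \<le> card {y \<in> B1. {f i, y} \<in> G \<inter> R}" using i fA by (auto simp: TA_def)
    moreover have "real (card {y \<in> B1. {f i, y} \<in> G \<inter> R}) - card (B1 - TB) \<le> card D"
      unfolding D_def using fin finT by (intro card_minus_le) auto
    ultimately have D: "\<theta> / 2 * n \<le> card D" using atB by simp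
    have D': "D \<subseteq> TB" "D \<subseteq> {..<n}" using TT by (auto simp: D_def)
    obtain g where g: "g \<in> copies (complete_graph (t - 1)) (t - 1) D \<Gamma>"
      "\<And>i j. i < t - 1 \<Longrightarrow> j < t - 1 \<Longrightarrow> {g i, g j} \<notin> Bl"
    proof (rule clique_avoiding_blue[OF l Bl _ TT degB degA D'(1) D _ _ _ _ _ \<Gamma>(1,2)])
      show "\<not> has_copy (cycle_graph l) l Bl" using B by (simp add: Bl_def)
    qed (use pos \<Gamma>(3) \<epsilon> big in auto)
    have gD: "g j \<in> D" if "j < t - 1" for j using g(1) that by (auto simp: copies_def injections_def)
    have "image_graph (complete_graph (t - 1)) g \<subseteq> R"
      unfolding image_complete_subset_iff
    proof (intro allI impI)
      fix j j' assume j: "j < t - 1" "j' < t - 1" "j \<noteq> j'"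
      then have "{g j, g j'} \<in> \<Gamma>" using g(1) by (auto simp: copies_def image_complete_subset_iff)
      then show "{g j, g j'} \<in> R" using g(2)[OF j(1,2)] by (auto simp: Bl_def)
    qed
    moreover have "image_graph (complete_graph 1) (\<lambda>j\<in>{..<1}. f i) \<subseteq> R"
      by (auto simp: image_complete_subset_iff)
    moreover have "(\<lambda>j\<in>{..<1}. f i) \<in> injections 1 {f i}"
      by (auto simp: injections_def inj_on_def)
    moreover have "f i \<notin> D" using all_edges_neq[OF GG(1), of "f i" "f i"] by (auto simp: D_def)
    ultimately have "has_copy (complete_graph (1 + (t - 1))) (1 + (t - 1)) R"
    proof (intro has_clique_join[of "\<lambda>j\<in>{..<1}. f i" 1 "{f i}" R g "t - 1" D])
      show "g \<in> injections (t - 1) D" using g(1) by (simp add: copies_def)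
      fix j j' assume j: "j < (1::nat)" "j' < t - 1"
      show "{(\<lambda>j\<in>{..<1}. f i) j, g j'} \<in> R" using gD[OF j(2)] j by (simp add: D_def)
      show "(\<lambda>j\<in>{..<1}. f i) j \<noteq> g j'" using gD[OF j(2)] j \<open>f i \<notin> D\<close> by auto
    qed
    then show ?thesis using t by simp
  qed
qed

subsection \<open>Colourings in which many dense edges are red\<close>

text \<open>A red K_a in the red neighbourhood of \<open>w\<close> that is not bad has a linear
  common red neighbourhood. There a red K_a is impossible, since its first \<open>t - a\<close>
  vertices would complete a red K_t. If there is no such K_a, all red copies near \<open>w\<close>
  are bad, and \<open>\<epsilon>\<close> is set so that the bad ones are at most an
  \<open>\<eta>\<close>-fraction of the mean.\<close>

lemma many_red_case:
  fixes \<gamma> \<epsilon> \<eta> L p :: real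
  assumes R: "R \<subseteq> all_edges n" "\<not> has_copy (complete_graph t) t R"
    and a: "a \<le> t" "t - a \<le> a"
    and AB: "A2 \<subseteq> {..<n}" "B2 \<subseteq> {..<n}" "\<gamma> * n \<le> card B2"
    and deg: "\<And>y. y \<in> B2 \<Longrightarrow> \<gamma> * n \<le> card {x \<in> A2. {x, y} \<in> R}"
    and \<Gamma>: "count_upper (complete_graph a) a n p L \<Gamma>"
    and pos: "0 < \<gamma>" "0 < \<eta>" "0 < L" "0 < n" and \<epsilon>: "\<epsilon> = \<eta> * \<gamma> / L"
  obtains S where "S \<subseteq> {..<n}" "\<gamma> * n \<le> card S"
      "card (red_copies (complete_graph a) a S \<Gamma> R)
        \<le> \<eta> * mean_copies (complete_graph a) a n p"
    | S where "S \<subseteq> {..<n}" "\<epsilon> * n \<le> card S"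
      "red_copies (complete_graph a) a S \<Gamma> R = {}"
proof -
  define N where "N = mean_copies (complete_graph a) a n p"
  have \<epsilon>0: "0 < \<epsilon>" using pos by (simp add: \<epsilon>)
  have finB: "finite B2" using AB(2) finite_subset by auto
  have "0 < \<gamma> * n" using pos by simp
  then have B0: "B2 \<noteq> {}" using AB(3) by auto
  define C where "C = copies (complete_graph a) a {..<n} \<Gamma>"
  have finC: "finite C" by (simp add: C_def)
  obtain w where w: "w \<in> B2"
    "card B2 * card {f \<in> C. (\<forall>i<a. {f i, w} \<in> R) \<and> card {w' \<in> B2. \<forall>i<a. {f i, w'} \<in> R} < \<epsilon> * n}
      \<le> \<epsilon> * n * card C"
    using dependent_choice[OF finB finC subset_refl B0, of "\<epsilon> * n" "\<lambda>w f. \<forall>i<a. {f i, w} \<in> R"] \<epsilon>0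
    by auto
  define bad where "bad = {f \<in> C. (\<forall>i<a. {f i, w} \<in> R) \<and> card {w' \<in> B2. \<forall>i<a. {f i, w'} \<in> R} < \<epsilon> * n}"
  define S where "S = {x \<in> A2. {x, w} \<in> R}"
  have S: "S \<subseteq> {..<n}" "\<gamma> * n \<le> card S" using AB deg[OF w(1)] by (auto simp: S_def)
  show thesis
  proof (cases "\<exists>f\<in>copies (complete_graph a) a S \<Gamma>. image_graph (complete_graph a) f \<subseteq> R \<and> f \<notin> bad")
    case True
    then obtain f where f: "f \<in> copies (complete_graph a) a S \<Gamma>" "image_graph (complete_graph a) f \<subseteq> R" "f \<notin> bad"
      by blast
    define D where "D = {y \<in> B2. \<forall>i<a. {f i, y} \<in> R}"
    have "f i \<in> S" if "i < a" for i using f(1) that by (auto simp: copies_def injections_def)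
    moreover have "f \<in> C" using f(1) copies_mono[OF S(1)] unfolding C_def by blast
    ultimately have D: "\<epsilon> * n \<le> card D" using f(3) by (auto simp: bad_def S_def D_def)
    have "False" if g: "g \<in> copies (complete_graph a) a D \<Gamma>" "image_graph (complete_graph a) g \<subseteq> R" for g
    proof -
      have gD: "g j \<in> D" if "j < a" for j using g(1) that by (auto simp: copies_def injections_def)
      let ?h = "restrict g {..<t - a}"
      have "inj_on g {..<t - a}" using g(1) a(2)
        by (auto simp: copies_def injections_def intro: inj_on_subset)
      then have "?h \<in> injections (t - a) D"
        using gD a(2) by (auto simp: injections_def)
      moreover have "image_graph (complete_graph (t - a)) ?h \<subseteq> R"
        using g(2) a(2) by (auto simp: image_complete_subset_iff)
      moreover have cr: "{f i, ?h j} \<in> R" if "i < a" "j < t - a" for i j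
        using gD[of j] that a(2) by (auto simp: D_def)
      moreover have "f i \<noteq> ?h j" if "i < a" "j < t - a" for i j
        using all_edges_neq[OF R(1) cr[OF that]] .
      ultimately have "has_copy (complete_graph (a + (t - a))) (a + (t - a)) R"
        using f by (intro has_clique_join[of f a S R ?h "t - a" D]) (auto simp: copies_def)
      then show False using R(2) a(1) by simp
    qed
    then show thesis using that(2)[of D] D AB(2) by (auto simp: D_def)
  next
    case False
    have "\<gamma> * n * card bad \<le> real (card B2) * card bad" using AB(3) by (intro mult_right_mono) auto
    also have "\<dots> \<le> \<epsilon> * n * card C" using w(2) unfolding bad_def by simp
    also have "\<dots> \<le> \<epsilon> * n * (L * N)"
      using \<Gamma> \<epsilon>0 unfolding count_upper_def C_def N_def by (intro mult_left_mono) auto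
    finally have "card bad \<le> \<eta> * N" using pos by (simp add: \<epsilon> field_simps)
    moreover have "card (red_copies (complete_graph a) a S \<Gamma> R) \<le> card bad"
      using False finC by (intro card_mono) (auto simp: bad_def)
    ultimately show thesis using that(1)[OF S] by (simp add: N_def)
  qed
qed

text \<open>At least half of the guaranteed copies contain a non-red edge, so the non-red edges
  inside \<open>S\<close> cover them; by \<open>edge_cover\<close> and \<open>few_overlaps\<close>
  this takes order n^2 p edges.\<close>

lemma many_blue_edges:
  fixes \<delta> \<delta>' L p :: real
  assumes F: "graph_on k F" "0 < card F" and \<Gamma>: "\<Gamma> \<subseteq> all_edges n"
    and S: "S \<subseteq> {..<n}" "\<delta>' * n \<le> card S" "\<delta> \<le> \<delta>'" "0 < \<delta>'"
    and dense: "dense_copies F k n p \<delta> \<Gamma>" and ov: "few_overlaps F k n p L \<Gamma>"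
    and pos: "0 < p" "0 < n" "0 < L"
    and red: "card (red_copies F k S \<Gamma> R) \<le> (\<delta>' / 2) ^ k / 4 * mean_copies F k n p"
  shows "((\<delta>' / 2) ^ k / 4)\<^sup>2 / (card F * L) * ((real n)\<^sup>2 * p) \<le> card {(x, y) \<in> S \<times> S. {x, y} \<in> \<Gamma> - R}"
proof -
  define N where "N = mean_copies F k n p"
  define m where "m = (\<delta>' / 2) ^ k / 4"
  have N0: "0 < N" using pos by (simp add: N_def)
  have m0: "0 < m" using S by (simp add: m_def)
  have finS: "finite S" using S(1) finite_subset by auto
  have fin\<Gamma>: "finite \<Gamma>" using \<Gamma> finite_subset finite_all_edges by metis
  have finP: "finite {(x, y) \<in> S \<times> S. {x, y} \<in> \<Gamma> - R}"
    by (rule finite_subset[of _ "S \<times> S"]) (auto simp: finS)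
  define M where "M = {f \<in> copies F k S \<Gamma>. \<not> image_graph F f \<subseteq> R}"
  define H where "H = {e \<in> \<Gamma> - R. e \<subseteq> S}"
  have finH: "finite H" using fin\<Gamma> by (simp add: H_def)
  have "copies F k S \<Gamma> = M \<union> red_copies F k S \<Gamma> R" by (auto simp: M_def)
  then have "card (copies F k S \<Gamma>) \<le> card M + card (red_copies F k S \<Gamma> R)"
    by (metis card_Un_le)
  moreover have "2 * m * N \<le> card (copies F k S \<Gamma>)"
    using dense_copiesD[OF dense S(1,3,2)] S(4) pos by (simp add: m_def N_def)
  ultimately have mM: "m * N \<le> card M" using red unfolding m_def[symmetric] N_def[symmetric] by linarith
  have cover: "image_graph F f \<inter> H \<noteq> {}" if f: "f \<in> M" for f
  proof -
    obtain e where e: "e \<in> F" "f ` e \<notin> R" using f by (auto simp: M_def image_graph_def)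
    have "f ` e \<in> \<Gamma>" using f e by (auto simp: M_def copies_def image_graph_def)
    moreover have "f ` e \<subseteq> S"
      using f e(1) F(1) unfolding M_def copies_def injections_def graph_on_def by blast
    ultimately show ?thesis using e by (auto simp: H_def image_graph_def)
  qed
  have "M \<subseteq> copies F k {..<n} \<Gamma>" using copies_mono[OF S(1)] by (auto simp: M_def)
  from edge_cover[OF F(1) this finH cover]
  have "(real (card M))\<^sup>2 \<le> card H * (card F * card (overlaps F k {..<n} \<Gamma>))" by simp
  moreover have "(m * N)\<^sup>2 \<le> (real (card M))\<^sup>2" using mM m0 N0 by (intro power_mono) auto
  ultimately have "(m * N)\<^sup>2 * ((real n)\<^sup>2 * p)
     \<le> card H * (card F * card (overlaps F k {..<n} \<Gamma>)) * ((real n)\<^sup>2 * p)"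
    using pos by (intro mult_right_mono) auto
  also have "\<dots> = card H * card F * ((real n)\<^sup>2 * p * card (overlaps F k {..<n} \<Gamma>))" by simp
  also have "\<dots> \<le> card H * card F * (L * N\<^sup>2)"
    using ov unfolding few_overlaps_def N_def by (intro mult_left_mono) auto
  finally have "N\<^sup>2 * (m\<^sup>2 * ((real n)\<^sup>2 * p)) \<le> N\<^sup>2 * (card H * (card F * L))"
    by (simp add: power_mult_distrib mult_ac)
  then have "m\<^sup>2 * ((real n)\<^sup>2 * p) \<le> card H * (card F * L)" using N0 by simp
  then have "m\<^sup>2 / (card F * L) * ((real n)\<^sup>2 * p) \<le> card H"
    using F(2) pos by (simp add: pos_divide_le_eq)
  also have "card H \<le> card ((\<lambda>(x, y). {x, y}) ` {(x, y) \<in> S \<times> S. {x, y} \<in> \<Gamma> - R})"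
  proof (intro card_mono)
    show "H \<subseteq> (\<lambda>(x, y). {x, y}) ` {(x, y) \<in> S \<times> S. {x, y} \<in> \<Gamma> - R}"
    proof
      fix e assume e: "e \<in> H"
      then have "card e = 2" using \<Gamma> by (auto simp: H_def all_edges_iff)
      then obtain x y where "e = {x, y}" by (auto simp: card_2_iff)
      then show "e \<in> (\<lambda>(x, y). {x, y}) ` {(x, y) \<in> S \<times> S. {x, y} \<in> \<Gamma> - R}"
        using e by (intro image_eqI[of _ _ "(x, y)"]) (auto simp: H_def)
    qed
    show "finite ((\<lambda>(x, y). {x, y}) ` {(x, y) \<in> S \<times> S. {x, y} \<in> \<Gamma> - R})"
      by (intro finite_imageI finP)
  qed
  also have "\<dots> \<le> card {(x, y) \<in> S \<times> S. {x, y} \<in> \<Gamma> - R}"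
    by (rule card_image_le[OF finP])
  finally show ?thesis by (simp add: m_def)
qed

lemma graph_on_cycle: "2 \<le> l \<Longrightarrow> graph_on l (cycle_graph l)"
  unfolding graph_on_def cycle_graph_def
  by (auto simp: card_insert_if mod_Suc)

text \<open>By Cauchy-Schwarz, few edges lie in only few cycles.\<close>

lemma blue_cycle_if_few_red_edges:
  fixes \<delta> \<delta>' \<eta> L p :: real
  assumes l: "3 \<le> l" and \<Gamma>: "\<Gamma> \<subseteq> all_edges n"
    and S: "S \<subseteq> {..<n}" "\<delta>' * n \<le> card S" "\<delta> \<le> \<delta>'" "0 < \<delta>'"
    and dense: "dense_copies (cycle_graph l) l n p \<delta> \<Gamma>" and ov: "few_overlaps (cycle_graph l) l n p L \<Gamma>"
    and pos: "0 < p" "0 < n" "0 < L" "0 \<le> \<eta>"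
    and red: "card (red_copies (complete_graph 2) 2 S \<Gamma> R)
       \<le> \<eta> * ((real n)\<^sup>2 * p)"
    and \<eta>: "\<eta> * (card (cycle_graph l) * L) < ((\<delta>' / 2) ^ l / 2)\<^sup>2"
  shows "has_copy (cycle_graph l) l (\<Gamma> - R)"
proof (rule ccontr)
  assume no: "\<not> ?thesis"
  define F where "F = cycle_graph l"
  have F: "graph_on l F" using graph_on_cycle l by (simp add: F_def)
  define N where "N = mean_copies F l n p"
  define m where "m = (\<delta>' / 2) ^ l / 2"
  have N0: "0 < N" using pos by (simp add: N_def)
  have m0: "0 < m" using S by (simp add: m_def)
  have fin\<Gamma>: "finite \<Gamma>" using \<Gamma> finite_subset finite_all_edges by metis
  have finS: "finite S" using S(1) finite_subset by auto
  define H where "H = {e \<in> \<Gamma> \<inter> R. e \<subseteq> S}"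
  have finH: "finite H" using fin\<Gamma> by (simp add: H_def)
  define X where "X = red_copies (complete_graph 2) 2 S \<Gamma> R"
  have "H \<subseteq> (\<lambda>f. f ` {0, 1}) ` X"
  proof
    fix e assume e: "e \<in> H"
    then have "card e = 2" using \<Gamma> by (auto simp: H_def all_edges_iff)
    then obtain x y where xy: "e = {x, y}" "x \<noteq> y" by (auto simp: card_2_iff)
    let ?f = "\<lambda>i\<in>{..<2::nat}. if i = 0 then x else y"
    have "?f \<in> X" unfolding X_def copies_def
      using e xy by (auto simp: injections_def inj_on_def image_complete_subset_iff H_def
          less_2_cases_iff insert_commute split: if_splits)
    moreover have "?f ` {0, 1} = e" using xy by auto
    ultimately show "e \<in> (\<lambda>f. f ` {0, 1}) ` X" by blast
  qed
  then have "card H \<le> card ((\<lambda>f. f ` {0, 1}) ` X)"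
    using finS by (intro card_mono) (auto simp: X_def)
  also have "\<dots> \<le> card X" using finS by (intro card_image_le) (auto simp: X_def)
  finally have H: "card H \<le> \<eta> * ((real n)\<^sup>2 * p)" using red unfolding X_def by linarith
  define M where "M = copies F l S \<Gamma>"
  have mM: "m * N \<le> card M"
    using dense_copiesD[OF dense S(1,3,2)] S(4) pos by (simp add: m_def N_def M_def F_def)
  have cover: "image_graph F f \<inter> H \<noteq> {}" if f: "f \<in> M" for f
  proof -
    have "\<not> image_graph F f \<subseteq> \<Gamma> - R" using f no has_copyI[of f l S F] by (auto simp: M_def copies_def F_def)
    then obtain e where e: "e \<in> F" "f ` e \<in> R" "f ` e \<in> \<Gamma>"
      using f by (auto simp: M_def image_graph_def copies_def)
    moreover have "f ` e \<subseteq> S"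
      using f e(1) F unfolding M_def copies_def injections_def graph_on_def by blast
    ultimately show ?thesis by (auto simp: H_def image_graph_def)
  qed
  have "M \<subseteq> copies F l {..<n} \<Gamma>" using copies_mono[OF S(1)] by (auto simp: M_def)
  from edge_cover[OF F this finH cover]
  have "(real (card M))\<^sup>2 \<le> real (card H) * (card F * card (overlaps F l {..<n} \<Gamma>))" by simp
  also have "\<dots> \<le> \<eta> * ((real n)\<^sup>2 * p) * (card F * card (overlaps F l {..<n} \<Gamma>))"
    using H by (intro mult_right_mono) auto
  also have "\<dots> = \<eta> * card F * ((real n)\<^sup>2 * p * card (overlaps F l {..<n} \<Gamma>))" by simp
  also have "\<dots> \<le> \<eta> * card F * (L * N\<^sup>2)"
    using ov pos unfolding few_overlaps_def N_def F_def by (intro mult_left_mono) auto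
  also have "\<dots> = \<eta> * (card F * L) * N\<^sup>2" by simp
  also have "\<dots> < m\<^sup>2 * N\<^sup>2" using \<eta> N0 unfolding m_def F_def by (intro mult_strict_right_mono) auto
  also have "\<dots> \<le> (real (card M))\<^sup>2"
    using mM m0 N0 unfolding power_mult_distrib[symmetric] by (intro power_mono) auto
  finally show False by simp
qed

section \<open>Codegrees and second neighbourhoods\<close>

definition codegree_graph :: "nat \<Rightarrow> nat set set" where
  "codegree_graph k = (\<lambda>i. {0, i + 2}) ` {..<k} \<union> (\<lambda>i. {1, i + 2}) ` {..<k}"

lemma graph_on_codegree: "graph_on (k + 2) (codegree_graph k)"
  unfolding graph_on_def codegree_graph_def by auto

lemma card_codegree_graph: "card (codegree_graph k) = 2 * k"
proof -
  have "card ((\<lambda>i. {0, i + 2}) ` {..<k}) = k" "card ((\<lambda>i. {1, i + 2}) ` {..<k}) = k"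
    by (subst card_image; auto simp: inj_on_def doubleton_eq_iff)+
  moreover have "(\<lambda>i. {0, i + 2}) ` {..<k} \<inter> (\<lambda>i. {1, i + 2}) ` {..<k} = ({} :: nat set set)"
    by (auto simp: doubleton_eq_iff)
  ultimately show ?thesis unfolding codegree_graph_def by (subst card_Un_disjoint) auto
qed

text \<open>A first-moment substitute for a Chernoff bound. A pair of codegree
  \<open>\<kappa> * n * p\<close> alone yields \<open>(\<kappa> * n * p / 2) ^ k\<close> embeddings
  of the complete bipartite graph with parts of sizes 2 and \<open>k\<close>, whose expected number
  is at most n^2 p^k (np)^k; for large \<open>k\<close> the factor n^2 p^k is tiny.\<close>

lemma codegree_less:
  fixes \<kappa> L p :: real
  assumes \<Gamma>: "\<Gamma> \<subseteq> all_edges n" "count_upper (codegree_graph k) (k + 2) n p L \<Gamma>"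
    and pos: "0 < \<kappa>" "0 < p" "0 < n" and uv: "u < n" "v < n" "u \<noteq> v"
    and small: "L * (real n)\<^sup>2 * p ^ k < (\<kappa> / 2) ^ k" "2 * k \<le> \<kappa> * n * p"
  shows "card {w. {u, w} \<in> \<Gamma> \<and> {v, w} \<in> \<Gamma>} < \<kappa> * n * p"
proof (rule ccontr)
  assume "\<not> ?thesis"
  then have large: "\<kappa> * n * p \<le> card {w. {u, w} \<in> \<Gamma> \<and> {v, w} \<in> \<Gamma>}" by simp
  define C where "C = {w. {u, w} \<in> \<Gamma> \<and> {v, w} \<in> \<Gamma>}"
  have C: "C \<subseteq> {..<n} - {u, v}" using \<Gamma>(1) by (auto simp: C_def all_edges_iff subset_iff)
  have finC: "finite C" using C finite_subset by blast
  let ?e = "\<lambda>g. \<lambda>i\<in>{..<k + 2}. if i = 0 then u else if i = 1 then v else g (i - 2)"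
  have "(\<kappa> * n * p / 2) ^ k \<le> (card C / 2) ^ k"
    using large pos unfolding C_def by (intro power_mono divide_right_mono) auto
  also have "\<dots> \<le> card (injections k C)"
    using card_injections_ge[OF finC, of k] small(2) large unfolding C_def by linarith
  also have "card (injections k C) \<le> card (copies (codegree_graph k) (k + 2) {..<n} \<Gamma>)"
  proof (rule card_inj_on_le[of ?e])
    show "inj_on ?e (injections k C)"
    proof (rule inj_onI)
      fix g h assume gh: "g \<in> injections k C" "h \<in> injections k C" "?e g = ?e h"
      have "g i = h i" if "i < k" for i
        using fun_cong[OF gh(3), of "i + 2"] that by simp
      moreover have "g i = h i" if "\<not> i < k" for i
        using gh(1,2) that by (auto simp: injections_def PiE_def extensional_def)
      ultimately show "g = h" by blast
    qed
    show "?e ` injections k C \<subseteq> copies (codegree_graph k) (k + 2) {..<n} \<Gamma>"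
    proof clarify
      fix g assume g: "g \<in> injections k C"
      have gC: "g i \<in> C" if "i < k" for i using g that by (auto simp: injections_def)
      have gi: "inj_on g {..<k}" using g by (auto simp: injections_def)
      have "?e g \<in> injections (k + 2) {..<n}"
      proof -
        have "inj_on (?e g) {..<k + 2}"
        proof (rule inj_onI)
          fix i j assume ij: "i \<in> {..<k + 2}" "j \<in> {..<k + 2}" "?e g i = ?e g j"
          have gn: "g (i - 2) \<noteq> u" "g (i - 2) \<noteq> v" if "i \<ge> 2" "i < k + 2" for i
          proof -
            have "i - 2 < k" using that by arith
            then have "g (i - 2) \<in> {..<n} - {u, v}" using gC C by blast
            then show "g (i - 2) \<noteq> u" "g (i - 2) \<noteq> v" by auto
          qed
          consider "i < 2" "j < 2" | "i \<ge> 2" "j < 2" | "i < 2" "j \<ge> 2" | "i \<ge> 2" "j \<ge> 2" by arith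
          then show "i = j"
          proof cases
            case 1
            then have "(if i = 0 then u else v) = (if j = 0 then u else v)" "i = 0 \<or> i = 1" "j = 0 \<or> j = 1"
              using ij by (auto split: if_splits)
            then show ?thesis using uv(3) by (auto split: if_splits)
          next
            case 2
            then have "g (i - 2) = (if j = 0 then u else v)" using ij by (auto split: if_splits)
            then show ?thesis using gn[of i] 2 ij by (auto split: if_splits)
          next
            case 3
            then have "g (j - 2) = (if i = 0 then u else v)" using ij by (auto split: if_splits)
            then show ?thesis using gn[of j] 3 ij by (auto split: if_splits)
          next
            case 4
            then have "g (i - 2) = g (j - 2)" "i - 2 < k" "j - 2 < k" using ij by auto
            then have "i - 2 = j - 2" using gi by (simp add: inj_on_def)
            then show ?thesis using 4 by simp
          qed
        qed
        moreover have "?e g i < n" if "i < k + 2" for i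
        proof -
          have "g (i - 2) < n" if "i \<noteq> 0" "i \<noteq> 1"
          proof -
            have "i - 2 < k" using that \<open>i < k + 2\<close> by arith
            then show ?thesis using gC C by blast
          qed
          then show ?thesis using that uv by auto
        qed
        ultimately show ?thesis by (auto simp: injections_def)
      qed
      moreover have "image_graph (codegree_graph k) (?e g) \<subseteq> \<Gamma>"
        using gC by (auto simp: image_graph_def codegree_graph_def C_def insert_commute)
      ultimately show "?e g \<in> copies (codegree_graph k) (k + 2) {..<n} \<Gamma>"
        by (simp add: copies_def)
    qed
  qed simp
  also have "\<dots> \<le> L * (real n ^ (k + 2) * p ^ (2 * k))"
    using \<Gamma>(2) unfolding count_upper_def card_codegree_graph .
  also have "\<dots> = (L * (real n)\<^sup>2 * p ^ k) * (real n * p) ^ k"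
    by (simp add: power_add power_mult_distrib mult_2 power2_eq_square)
  also have "\<dots> < (\<kappa> / 2) ^ k * (real n * p) ^ k"
    using small(1) pos by (intro mult_strict_right_mono) auto
  also have "\<dots> = (\<kappa> * n * p / 2) ^ k" by (simp add: power_mult_distrib[symmetric] mult_ac)
  finally show False by simp
qed

text \<open>A converter: configurations written as explicit vertex lists are bounded by the counts
  that \<open>count_upper\<close> controls.\<close>

lemma card_lists_le_copies:
  assumes F: "graph_on k F" and P: "\<And>xs. xs \<in> P \<Longrightarrow> length xs = k \<and> distinct xs \<and> set xs \<subseteq> {..<n}"
    and E: "\<And>xs e. xs \<in> P \<Longrightarrow> e \<in> F \<Longrightarrow> (!) xs ` e \<in> \<Gamma>"
  shows "card P \<le> card (copies F k {..<n} \<Gamma>)"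
proof (rule card_inj_on_le[of "\<lambda>xs. restrict ((!) xs) {..<k}"])
  show "inj_on (\<lambda>xs. restrict ((!) xs) {..<k}) P"
  proof (rule inj_onI)
    fix xs ys assume a: "xs \<in> P" "ys \<in> P" "restrict ((!) xs) {..<k} = restrict ((!) ys) {..<k}"
    have "xs ! i = ys ! i" if "i < k" for i using fun_cong[OF a(3), of i] that by simp
    then show "xs = ys" using P[OF a(1)] P[OF a(2)] by (simp add: list_eq_iff_nth_eq)
  qed
  show "(\<lambda>xs. restrict ((!) xs) {..<k}) ` P \<subseteq> copies F k {..<n} \<Gamma>"
  proof clarify
    fix xs assume xs: "xs \<in> P"
    have "restrict ((!) xs) {..<k} \<in> injections k {..<n}"
    proof -
      have "xs ! i < n" if "i < k" for i using P[OF xs] that nth_mem[of i xs] by blast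
      moreover have "inj_on ((!) xs) {..<k}" using P[OF xs] by (intro inj_on_nth) auto
      ultimately show ?thesis by (simp add: injections_def)
    qed
    moreover have "restrict ((!) xs) {..<k} ` e = (!) xs ` e" if "e \<in> F" for e
      using F that unfolding graph_on_def by (intro image_cong) auto
    ultimately show "restrict ((!) xs) {..<k} \<in> copies F k {..<n} \<Gamma>"
      using E[OF xs] by (auto simp: copies_def image_graph_def)
  qed
qed simp

definition path3 :: "nat set set" where "path3 = {{0, 1}, {1, 2}}"

lemma graph_on_path3: "graph_on 3 path3" and card_path3: "card path3 = 2"
  unfolding graph_on_def path3_def by (auto simp: card_insert_if doubleton_eq_iff)

lemma cycle_graph_4: "cycle_graph 4 = {{0, 1}, {1, 2}, {2, 3}, {3, 0}}"
proof -
  have "{i::nat. i < 4} = {0, 1, 2, 3}" by auto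
  moreover have "cycle_graph 4 = (\<lambda>i. {i, (i + 1) mod 4}) ` {i. i < 4}"
    unfolding cycle_graph_def by auto
  ultimately show ?thesis by (simp flip: numeral_2_eq_2)
qed

lemma card_cycle_graph_4: "card (cycle_graph 4) = 4"
  unfolding cycle_graph_4 by (simp add: card_insert_if doubleton_eq_iff)

lemma complete_graph_2: "complete_graph 2 = {{0, 1}}"
proof
  show "complete_graph 2 \<subseteq> {{0, 1}}"
  proof
    fix e assume "e \<in> complete_graph 2"
    then obtain u v where "u < 2" "v < 2" "u \<noteq> v" and e: "e = {u, v}"
      unfolding complete_graph_def all_edges_def by blast
    then have "u = 0 \<and> v = 1 \<or> u = 1 \<and> v = 0" by linarith
    then have "e = {0, 1}" unfolding e by blast
    then show "e \<in> {{0, 1}}" by simp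
  qed
qed (use complete_graph_edge[of 0 2 1] in simp)

text \<open>Two applications of Cauchy-Schwarz: many blue edges give many blue cherries, and as
  cherries and 4-cycles are not too numerous, the cherries spread over a positive proportion of all
  pairs of ends. The condition \<open>1 \<le> n * p\<^sup>2\<close> makes the bound for 4-cycles
  dominate that for cherries.\<close>

lemma blue_second_neighbourhood:
  fixes b L p :: real
  assumes \<Gamma>: "\<Gamma> \<subseteq> all_edges n" "E \<subseteq> \<Gamma>" and S: "S \<subseteq> {..<n}"
    and edges: "b * ((real n)\<^sup>2 * p) \<le> card {(x, y) \<in> S \<times> S. {x, y} \<in> E}"
    and up: "count_upper (cycle_graph 4) 4 n p L \<Gamma>" "count_upper path3 3 n p L \<Gamma>"
      "count_upper (complete_graph 2) 2 n p L \<Gamma>"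
    and pos: "0 < b" "0 < L" "0 < p" "0 < n"
    and big: "1 \<le> n * p\<^sup>2" "L \<le> b\<^sup>2 / 2 * (n * p)" "L * p \<le> b ^ 4 / (16 * L)"
  obtains v where "v \<in> S"
    "b ^ 4 / (16 * L) * n \<le> card {y \<in> S. y \<noteq> v \<and> {v, y} \<notin> \<Gamma> \<and> (\<exists>x\<in>S. {v, x} \<in> E \<and> {x, y} \<in> E)}"
proof -
  have finS: "finite S" using S finite_subset by auto
  have cS: "card S \<le> n" using card_mono[OF _ S] by auto
  have n0: "0 < real n" using pos by simp
  define c where "c = b ^ 4 / (16 * L)"
  define A where "A = (real n)\<^sup>2 * p"
  define Q where "Q = real n ^ 3 * p\<^sup>2"
  have A0: "0 < A" and Q0: "0 < Q" using pos by (simp_all add: A_def Q_def)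
  have c0: "0 < c" using pos by (simp add: c_def)
  have neq: "x \<noteq> y" if "{x, y} \<in> E" for x y using all_edges_neq[OF \<Gamma>(1)] \<Gamma>(2) that by blast
  define N where "N x = {y \<in> S. {x, y} \<in> E}" for x
  have finN: "finite (N x)" for x using finS by (simp add: N_def)
  have adj: "card {(x, y) \<in> S \<times> S. {x, y} \<in> \<Gamma>} \<le> L * A"
  proof -
    let ?P = "(\<lambda>(x, y). [x, y]) ` {(x, y) \<in> S \<times> S. {x, y} \<in> \<Gamma>}"
    have "card {(x, y) \<in> S \<times> S. {x, y} \<in> \<Gamma>} = card ?P"
      by (rule card_image[symmetric]) (auto simp: inj_on_def)
    also have "\<dots> \<le> card (copies (complete_graph 2) 2 {..<n} \<Gamma>)"
    proof (rule card_lists_le_copies[OF graph_on_complete])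
      fix xs assume "xs \<in> ?P"
      then obtain x y where xy: "xs = [x, y]" "x \<in> S" "y \<in> S" "{x, y} \<in> \<Gamma>" by auto
      then show "length xs = 2 \<and> distinct xs \<and> set xs \<subseteq> {..<n}"
        using all_edges_neq[OF \<Gamma>(1)] S by auto
      show "(!) xs ` e \<in> \<Gamma>" if "e \<in> complete_graph 2" for e
        using that xy by (simp add: complete_graph_2)
    qed
    finally show ?thesis using up(3) unfolding count_upper_def A_def complete_graph_2 by simp
  qed
  have degs: "b * A \<le> (\<Sum>x\<in>S. real (card (N x)))"
    using edges card_relation(1)[OF finS finS, of "\<lambda>x y. {x, y} \<in> E"] by (simp add: A_def N_def)
  have degs_le: "(\<Sum>x\<in>S. real (card (N x))) \<le> L * A"
  proof -
    have "finite {(x, y) \<in> S \<times> S. {x, y} \<in> \<Gamma>}"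
      by (rule finite_subset[of _ "S \<times> S"]) (auto simp: finS)
    then have "card {(x, y) \<in> S \<times> S. {x, y} \<in> E} \<le> card {(x, y) \<in> S \<times> S. {x, y} \<in> \<Gamma>}"
      by (rule card_mono) (use \<Gamma>(2) in auto)
    then show ?thesis using adj card_relation(1)[OF finS finS, of "\<lambda>x y. {x, y} \<in> E"]
      unfolding of_nat_sum[symmetric] N_def by linarith
  qed
  have sq: "b\<^sup>2 * Q \<le> (\<Sum>x\<in>S. (real (card (N x)))\<^sup>2)"
  proof -
    have "(b * A)\<^sup>2 \<le> (\<Sum>x\<in>S. real (card (N x)))\<^sup>2" using degs A0 pos by (intro power_mono) auto
    also have "\<dots> \<le> (\<Sum>x\<in>S. (real (card (N x)))\<^sup>2) * card S" by (rule sum_squared_le_sum_of_squares)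
    also have "\<dots> \<le> (\<Sum>x\<in>S. (real (card (N x)))\<^sup>2) * n" using cS by (intro mult_left_mono sum_nonneg) auto
    also have "(b * A)\<^sup>2 = b\<^sup>2 * Q * n"
      by (simp add: A_def Q_def power2_eq_square power3_eq_cube)
    finally show ?thesis using n0 by simp
  qed
  \<comment> \<open>A cherry with centre \<open>x\<close> and distinct ends \<open>vy\<close>;
    \<open>P vy\<close> is the blue codegree of the ends within \<open>S\<close>.\<close>
  define r where "r x vy \<longleftrightarrow> fst vy \<noteq> snd vy \<and> {x, fst vy} \<in> E \<and> {x, snd vy} \<in> E" for x and vy :: "nat \<times> nat"
  define P where "P vy = card {x \<in> S. r x vy}" for vy
  have finSS: "finite (S \<times> S)" using finS by simp
  have T: "b\<^sup>2 / 2 * Q \<le> (\<Sum>vy\<in>S \<times> S. real (P vy))"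
  proof -
    have one: "(real (card (N x)))\<^sup>2 - card (N x) \<le> card {vy \<in> S \<times> S. r x vy}" for x
    proof -
      have "real (card (N x \<times> N x)) - card ((\<lambda>y. (y, y)) ` N x) \<le> card {vy \<in> S \<times> S. r x vy}"
        by (rule card_minus_le) (use finN finSS in \<open>auto simp: N_def r_def\<close>)
      moreover have "card ((\<lambda>y. (y, y)) ` N x) \<le> card (N x)" by (rule card_image_le[OF finN])
      ultimately show ?thesis by (simp add: card_cartesian_product power2_eq_square)
    qed
    have "L * A \<le> b\<^sup>2 / 2 * Q"
    proof -
      have "L * A \<le> b\<^sup>2 / 2 * (n * p) * A" using big(2) A0 by (intro mult_right_mono) auto
      also have "\<dots> = b\<^sup>2 / 2 * Q" by (simp add: A_def Q_def power2_eq_square power3_eq_cube)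
      finally show ?thesis .
    qed
    then have "b\<^sup>2 / 2 * Q \<le> (\<Sum>x\<in>S. (real (card (N x)))\<^sup>2) - (\<Sum>x\<in>S. real (card (N x)))"
      using sq degs_le by simp
    also have "\<dots> = (\<Sum>x\<in>S. (real (card (N x)))\<^sup>2 - card (N x))" by (simp add: sum_subtractf)
    also have "\<dots> \<le> (\<Sum>x\<in>S. real (card {vy \<in> S \<times> S. r x vy}))" by (intro sum_mono one)
    also have "\<dots> = (\<Sum>vy\<in>S \<times> S. real (P vy))"
      using card_relation[OF finS finSS, of r] unfolding P_def of_nat_sum[symmetric] by simp
    finally show ?thesis .
  qed
  define C where "C = {vy \<in> S \<times> S. P vy \<noteq> 0}"
  have finC: "finite C" using finSS by (simp add: C_def)
  have sumC: "(\<Sum>vy\<in>S \<times> S. real (P vy)) = (\<Sum>vy\<in>C. real (P vy))"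
    by (rule sum.mono_neutral_right) (use finSS in \<open>auto simp: C_def\<close>)
  have PP: "(\<Sum>vy\<in>S \<times> S. (real (P vy))\<^sup>2) \<le> 2 * L * (real n ^ 4 * p ^ 4)"
  proof -
    \<comment> \<open>The square of \<open>P vy\<close> counts ordered pairs of centres over the
      same ends. Equal centres give a cherry, distinct ones a 4-cycle.\<close>
    let ?X = "\<lambda>vy. {x \<in> S. r x vy}"
    have finX: "finite (?X vy)" for vy using finS by simp
    define U where "U = (SIGMA vy:S \<times> S. ?X vy \<times> ?X vy)"
    have finU: "finite U" unfolding U_def
      by (rule finite_SigmaI[OF finSS]) (rule finite_cartesian_product[OF finX finX])
    define U1 where "U1 = {z \<in> U. fst (snd z) = snd (snd z)}"
    define U2 where "U2 = {z \<in> U. fst (snd z) \<noteq> snd (snd z)}"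
    have U12: "U = U1 \<union> U2" by (auto simp: U1_def U2_def)
    have "card U = (\<Sum>vy\<in>S \<times> S. card (?X vy \<times> ?X vy))"
      unfolding U_def by (rule card_SigmaI[OF finSS]) (use finite_cartesian_product[OF finX finX] in blast)
    then have sU: "(\<Sum>vy\<in>S \<times> S. (real (P vy))\<^sup>2) = real (card U)"
      by (simp add: card_cartesian_product P_def power2_eq_square)
    have cU: "card U \<le> card U1 + card U2" unfolding U12 by (rule card_Un_le)
    have c1: "card U1 \<le> card (copies path3 3 {..<n} \<Gamma>)"
    proof -
      let ?f = "\<lambda>z :: (nat \<times> nat) \<times> (nat \<times> nat). [fst (fst z), fst (snd z), snd (fst z)]"
      have "card U1 = card (?f ` U1)"
        by (rule card_image[symmetric]) (auto simp: inj_on_def U1_def)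
      also have "\<dots> \<le> card (copies path3 3 {..<n} \<Gamma>)"
      proof (rule card_lists_le_copies[OF graph_on_path3])
        fix xs assume "xs \<in> ?f ` U1"
        then obtain v x y where z: "xs = [v, x, y]" "v \<in> S" "x \<in> S" "y \<in> S" "v \<noteq> y" "{x, v} \<in> E" "{x, y} \<in> E"
          by (auto simp: U1_def U_def r_def)
        then show "length xs = 3 \<and> distinct xs \<and> set xs \<subseteq> {..<n}" using neq[OF z(6)] neq[OF z(7)] S by auto
        show "(!) xs ` e \<in> \<Gamma>" if "e \<in> path3" for e
          using that z \<Gamma>(2) by (auto simp: path3_def insert_commute)
      qed
      finally show ?thesis .
    qed
    have c2: "card U2 \<le> card (copies (cycle_graph 4) 4 {..<n} \<Gamma>)"
    proof -
      let ?f = "\<lambda>z :: (nat \<times> nat) \<times> (nat \<times> nat). [fst (fst z), fst (snd z), snd (fst z), snd (snd z)]"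
      have "card U2 = card (?f ` U2)"
        by (rule card_image[symmetric]) (auto simp: inj_on_def U2_def)
      also have "\<dots> \<le> card (copies (cycle_graph 4) 4 {..<n} \<Gamma>)"
      proof (rule card_lists_le_copies[OF graph_on_cycle])
        fix xs assume "xs \<in> ?f ` U2"
        then obtain v x y x' where z: "xs = [v, x, y, x']" "v \<in> S" "x \<in> S" "y \<in> S" "x' \<in> S" "v \<noteq> y" "x \<noteq> x'"
          "{x, v} \<in> E" "{x, y} \<in> E" "{x', v} \<in> E" "{x', y} \<in> E"
          by (auto simp: U2_def U_def r_def)
        then show "length xs = 4 \<and> distinct xs \<and> set xs \<subseteq> {..<n}"
          using neq[OF z(8)] neq[OF z(9)] neq[OF z(10)] neq[OF z(11)] S by auto
        show "(!) xs ` e \<in> \<Gamma>" if "e \<in> cycle_graph 4" for e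
          using that z \<Gamma>(2) by (auto simp: cycle_graph_4 insert_commute)
      qed simp
      finally show ?thesis .
    qed
    have h1: "real (card (copies path3 3 {..<n} \<Gamma>)) \<le> L * (real n ^ 4 * p ^ 4)"
    proof -
      have "real (card (copies path3 3 {..<n} \<Gamma>)) \<le> L * Q * 1"
        using up(2) unfolding count_upper_def card_path3 Q_def by simp
      also have "\<dots> \<le> L * Q * (n * p\<^sup>2)" using big(1) Q0 pos by (intro mult_left_mono) auto
      also have "\<dots> = L * (real n ^ 4 * p ^ 4)"
        by (simp add: Q_def power2_eq_square power3_eq_cube power4_eq_xxxx)
      finally show ?thesis .
    qed
    have h2: "real (card (copies (cycle_graph 4) 4 {..<n} \<Gamma>)) \<le> L * (real n ^ 4 * p ^ 4)"
      using up(1) unfolding count_upper_def card_cycle_graph_4 .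
    show ?thesis using sU cU c1 c2 h1 h2 by linarith
  qed
  have C: "2 * c * (real n)\<^sup>2 \<le> card C"
  proof -
    have "(b\<^sup>2 / 2 * Q)\<^sup>2 \<le> (\<Sum>vy\<in>C. real (P vy))\<^sup>2"
      using T Q0 pos unfolding sumC by (intro power_mono) auto
    also have "\<dots> \<le> (\<Sum>vy\<in>C. (real (P vy))\<^sup>2) * card C" by (rule sum_squared_le_sum_of_squares)
    also have "\<dots> \<le> (\<Sum>vy\<in>S \<times> S. (real (P vy))\<^sup>2) * card C"
      using finSS by (intro mult_right_mono sum_mono2) (auto simp: C_def)
    also have "\<dots> \<le> 2 * L * (real n ^ 4 * p ^ 4) * card C" using PP by (intro mult_right_mono) auto
    finally have "(b\<^sup>2 / 2 * Q)\<^sup>2 \<le> 2 * L * (real n ^ 4 * p ^ 4) * card C" .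
    moreover have "(b\<^sup>2 / 2 * Q)\<^sup>2 = 2 * L * (real n ^ 4 * p ^ 4) * (2 * c * (real n)\<^sup>2)"
      using pos by (simp add: c_def Q_def power2_eq_square power3_eq_cube power4_eq_xxxx)
    ultimately show ?thesis using pos by simp
  qed
  \<comment> \<open>Ends adjacent in \<open>\<Gamma>\<close> are dropped, so that no neighbour of
    \<open>v\<close> lies in the second neighbourhood. Their number is negligible because
    \<open>p\<close> is small.\<close>
  define C' where "C' = {(v, y) \<in> S \<times> S. (v, y) \<in> C \<and> {v, y} \<notin> \<Gamma>}"
  have "real (card C) - card {(x, y) \<in> S \<times> S. {x, y} \<in> \<Gamma>} \<le> card C'"
  proof (rule card_minus_le)
    show "finite {(x, y) \<in> S \<times> S. {x, y} \<in> \<Gamma>}" "finite C'"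
      unfolding C'_def by (rule finite_subset[OF _ finSS]; auto)+
  qed (use finC in \<open>auto simp: C'_def C_def\<close>)
  moreover have "L * A \<le> c * (real n)\<^sup>2"
    using mult_right_mono[OF big(3), of "(real n)\<^sup>2"] by (simp add: A_def c_def mult_ac)
  ultimately have C': "c * (real n)\<^sup>2 \<le> card C'" using C adj by linarith
  have cC': "card C' = (\<Sum>v\<in>S. card {y \<in> S. (v, y) \<in> C \<and> {v, y} \<notin> \<Gamma>})"
    unfolding C'_def by (rule card_relation(1)[OF finS finS])
  have "\<exists>v\<in>S. c * n \<le> card {y \<in> S. (v, y) \<in> C \<and> {v, y} \<notin> \<Gamma>}"
  proof (rule ccontr)
    assume "\<not> ?thesis"
    then have less: "\<And>v. v \<in> S \<Longrightarrow> card {y \<in> S. (v, y) \<in> C \<and> {v, y} \<notin> \<Gamma>} < c * n" by (meson not_le)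
    have "0 < c * (real n)\<^sup>2" using c0 n0 by simp
    then have "S \<noteq> {}" using C' cC' by auto
    then have "real (card C') < (\<Sum>v\<in>S. c * n)"
      unfolding cC' of_nat_sum using less finS by (intro sum_strict_mono) auto
    also have "\<dots> = card S * (c * n)" by simp
    also have "\<dots> \<le> n * (c * n)" using cS c0 by (intro mult_right_mono) auto
    finally show False using C' by (simp add: power2_eq_square mult_ac)
  qed
  then obtain v where v: "v \<in> S" "c * n \<le> card {y \<in> S. (v, y) \<in> C \<and> {v, y} \<notin> \<Gamma>}" by blast
  have "{y \<in> S. (v, y) \<in> C \<and> {v, y} \<notin> \<Gamma>}
     \<subseteq> {y \<in> S. y \<noteq> v \<and> {v, y} \<notin> \<Gamma> \<and> (\<exists>x\<in>S. {v, x} \<in> E \<and> {x, y} \<in> E)}"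
  proof
    fix y assume y: "y \<in> {y \<in> S. (v, y) \<in> C \<and> {v, y} \<notin> \<Gamma>}"
    then have "card {x \<in> S. r x (v, y)} \<noteq> 0" by (simp add: C_def P_def)
    then have "{x \<in> S. r x (v, y)} \<noteq> {}" by (metis card.empty)
    then obtain x where "x \<in> S" "v \<noteq> y" "{x, v} \<in> E" "{x, y} \<in> E" by (auto simp: r_def)
    then show "y \<in> {y \<in> S. y \<noteq> v \<and> {v, y} \<notin> \<Gamma> \<and> (\<exists>x\<in>S. {v, x} \<in> E \<and> {x, y} \<in> E)}"
      using y by (auto simp: insert_commute)
  qed
  then have "card {y \<in> S. (v, y) \<in> C \<and> {v, y} \<notin> \<Gamma>}
     \<le> card {y \<in> S. y \<noteq> v \<and> {v, y} \<notin> \<Gamma> \<and> (\<exists>x\<in>S. {v, x} \<in> E \<and> {x, y} \<in> E)}"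
    using finS by (intro card_mono) auto
  then show thesis using v that[of v] unfolding c_def by linarith
qed

text \<open>Two vertices of the second neighbourhood of \<open>v\<close> that are joined by a path of length
  \<open>l - 4\<close> and have different parents close up to a cycle of length \<open>l\<close>. The parents differ
  as soon as the last vertex of the path avoids the few \<open>\<Gamma>\<close>-neighbours of the parent of the first.\<close>

lemma blue_cycle_in_second_neighbourhood:
  fixes b p :: real
  assumes l: "odd l" "5 \<le> l" and \<Gamma>: "\<Gamma> \<subseteq> all_edges n" "E \<subseteq> \<Gamma>" and Y: "Y \<subseteq> {..<n}"
    and v: "\<And>y. y \<in> Y \<Longrightarrow> y \<noteq> v \<and> {v, y} \<notin> \<Gamma> \<and> (\<exists>x. {v, x} \<in> E \<and> {x, y} \<in> E)"
    and edges: "b * ((real n)\<^sup>2 * p) \<le> card {(x, y) \<in> Y \<times> Y. {x, y} \<in> E}"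
    and codeg: "\<And>u w. u < n \<Longrightarrow> w < n \<Longrightarrow> u \<noteq> w \<Longrightarrow> card {x. {u, x} \<in> \<Gamma> \<and> {w, x} \<in> \<Gamma>} < b / 6 * n * p"
    and pos: "0 < b" "0 < p" "0 < n" and big: "real l + 1 \<le> b / 6 * n * p"
  shows "has_copy (cycle_graph l) l E"
proof -
  have finY: "finite Y" using Y finite_subset by auto
  have cY: "card Y \<le> n" using card_mono[OF _ Y] by auto
  define D where "D = b * n * p / 3"
  have D0: "0 < D" using pos by (simp add: D_def)
  \<comment> \<open>Half of the degree pays for the path already built, the other half for a
    codegree.\<close>
  have D6: "D = b / 6 * n * p + b / 6 * n * p" by (simp add: D_def)
  have "D * (card Y + card Y) \<le> D * (n + n)" using cY D0 by (intro mult_left_mono) auto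
  also have "\<dots> < b * ((real n)\<^sup>2 * p)" using pos by (simp add: D_def power2_eq_square field_simps)
  also have "\<dots> \<le> card {(x, y) \<in> Y \<times> Y. {x, y} \<in> E}" by (rule edges)
  finally have ed: "D * (card Y + card Y) < card {(x, y) \<in> Y \<times> Y. {x, y} \<in> E}" by simp
  obtain Z W where ZW: "Z \<subseteq> Y" "W \<subseteq> Y" "Z \<noteq> {}" "W \<noteq> {}"
    "\<And>z. z \<in> Z \<Longrightarrow> D \<le> card {w \<in> W. {z, w} \<in> E}" "\<And>w. w \<in> W \<Longrightarrow> D \<le> card {z \<in> Z. {z, w} \<in> E}"
    by (rule bipartite_core[OF finY finY less_imp_le[OF D0] ed]) blast
  obtain parent where parent: "\<And>y. y \<in> Y \<Longrightarrow> {v, parent y} \<in> E \<and> {parent y, y} \<in> E"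
    using v by metis
  obtain y0 where y0: "y0 \<in> Z" using ZW by auto
  have K: "l \<le> m" if "D \<le> real m" for m using that big D6 pos by linarith
  \<comment> \<open>The \<open>l - 4\<close> vertices here, one further vertex \<open>w\<close>, two
    parents and \<open>v\<close> make \<open>l\<close>. As \<open>l - 5\<close> is even, the head
    lies in \<open>Z\<close> and \<open>w\<close> can be sought in \<open>W\<close>.\<close>
  have "\<exists>xs. length xs = Suc (l - 5) \<and> distinct xs \<and> last xs = y0 \<and>
      hd xs \<in> (if even (l - 5) then Z else W) \<and> set xs \<subseteq> Z \<union> W \<and> set xs \<inter> {} = {} \<and>
      successively (\<lambda>x y. {x, y} \<in> E) xs"
  proof (rule alternating_path[rotated 3])
    show "l \<le> card {w \<in> W. {z, w} \<in> E}" if "z \<in> Z" for z by (rule K[OF ZW(5)[OF that]])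
    show "l \<le> card {z \<in> Z. {z, w} \<in> E}" if "w \<in> W" for w by (rule K[OF ZW(6)[OF that]])
  qed (use y0 l in auto)
  then obtain xs where xs: "length xs = Suc (l - 5)" "distinct xs" "last xs = y0"
    "hd xs \<in> (if even (l - 5) then Z else W)" "set xs \<subseteq> Z \<union> W"
    "successively (\<lambda>x y. {x, y} \<in> E) xs" by blast
  have xs0: "xs \<noteq> []" using xs(1) by auto
  have xsY: "set xs \<subseteq> Y" using xs(5) ZW(1,2) by blast
  have h: "hd xs \<in> Z" using xs(4) l by auto
  have hY: "hd xs \<in> Y" "y0 \<in> Y" using h y0 ZW(1) by auto
  let ?x = "parent y0"
  have nb: "{v, ?x} \<in> \<Gamma>" using parent[OF hY(2)] \<Gamma>(2) by blast
  \<comment> \<open>The parent is adjacent to \<open>v\<close> in \<open>\<Gamma>\<close> while no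
    vertex of \<open>Y\<close> is, so the codegree bound applies to two different vertices.\<close>
  have "hd xs \<noteq> ?x" using nb v[OF hY(1)] by auto
  moreover have "?x < n" using nb \<Gamma>(1) by (auto simp: all_edges_iff subset_iff)
  moreover have "hd xs < n" using hY Y by auto
  ultimately have cd: "card {w. {hd xs, w} \<in> \<Gamma> \<and> {?x, w} \<in> \<Gamma>} < b / 6 * n * p" by (intro codeg)
  let ?Q = "set xs \<union> {w. {hd xs, w} \<in> \<Gamma> \<and> {?x, w} \<in> \<Gamma>}"
  have "{w. {hd xs, w} \<in> \<Gamma> \<and> {?x, w} \<in> \<Gamma>} \<subseteq> {..<n}"
    using \<Gamma>(1) by (auto simp: all_edges_iff subset_iff)
  then have finQ: "finite ?Q" using finite_subset by auto
  have "card ?Q \<le> card (set xs) + card {w. {hd xs, w} \<in> \<Gamma> \<and> {?x, w} \<in> \<Gamma>}" by (rule card_Un_le)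
  moreover have "card (set xs) \<le> l" using card_length[of xs] xs(1) l by linarith
  ultimately have "real (card ?Q) < D" using cd big D6 by linarith
  then have "card ?Q < card {w \<in> W. {hd xs, w} \<in> E}" using ZW(5)[OF h] by linarith
  then obtain w where w: "w \<in> W" "{hd xs, w} \<in> E" "w \<notin> ?Q" using exists_outside[OF finQ] by blast
  have wY: "w \<in> Y" using w(1) ZW(2) by blast
  have w\<Gamma>: "{?x, w} \<notin> \<Gamma>" "w \<notin> set xs" using w(2,3) \<Gamma>(2) by auto
  have pw: "{v, parent w} \<in> E" "{parent w, w} \<in> E" using parent[OF wY] by auto
  have px: "{v, ?x} \<in> E" "{?x, y0} \<in> E" using parent[OF hY(2)] by auto
  \<comment> \<open>\<open>w\<close> was chosen outside the \<open>\<Gamma>\<close>-neighbourhood of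
    the parent of \<open>y0\<close>, but its own parent is adjacent to it.\<close>
  have diff: "?x \<noteq> parent w" using w\<Gamma>(1) pw(2) \<Gamma>(2) by auto
  have notY: "u \<notin> Y" if "{v, u} \<in> E" for u using v[of u] that \<Gamma>(2) by auto
  have vY: "v \<notin> Y" using v by auto
  have vn: "v \<noteq> ?x" "v \<noteq> parent w" using all_edges_neq[of E n] \<Gamma> pw(1) px(1) by blast+
  show ?thesis
  proof (rule has_cycle[of "w # xs @ [?x, v, parent w]"])
    show "length (w # xs @ [?x, v, parent w]) = l" using xs(1) l by simp
    show "distinct (w # xs @ [?x, v, parent w])"
      using xs(2) w\<Gamma>(2) wY xsY notY[OF pw(1)] notY[OF px(1)] vY vn diff by auto
    have "successively (\<lambda>x y. {x, y} \<in> E) (w # xs)"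
      using xs(6) w(2) by (simp add: successively_Cons insert_commute)
    moreover have "successively (\<lambda>x y. {x, y} \<in> E) [?x, v, parent w]"
      using pw(1) px(1) by (simp add: insert_commute)
    moreover have "{last (w # xs), hd [?x, v, parent w]} \<in> E"
      using px(2) xs(3) xs0 by (simp add: insert_commute)
    ultimately show "successively (\<lambda>x y. {x, y} \<in> E) (w # xs @ [?x, v, parent w])"
      using successively_append_iff[of "\<lambda>x y. {x, y} \<in> E" "w # xs" "[?x, v, parent w]"] by simp
    show "{last (w # xs @ [?x, v, parent w]), hd (w # xs @ [?x, v, parent w])} \<in> E"
      using pw(2) by simp
  qed (use l in auto)
qed

subsection \<open>Expected numbers of copies near the threshold\<close>

definition edge_exponent :: "nat \<Rightarrow> real" where "edge_exponent t = 2 / (real t - 1)"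

text \<open>The upper end of the range makes codegrees negligible compared with degrees; larger
  probabilities are reduced to it by monotonicity.\<close>

definition in_range :: "nat \<Rightarrow> nat \<Rightarrow> real \<Rightarrow> bool" where
  "in_range t n p \<longleftrightarrow> real n powr (- edge_exponent t) \<le> p \<and> p \<le> real n powr (- edge_exponent t / 2)"

lemma in_range_pos:
  assumes "in_range t n p" "0 < n" shows "0 < p"
proof -
  have "0 < real n powr (- edge_exponent t)" using assms by simp
  then show ?thesis using assms(1) unfolding in_range_def by linarith
qed

lemma in_range_le_1: "in_range t n p \<Longrightarrow> 0 < n \<Longrightarrow> 4 \<le> t \<Longrightarrow> p \<le> 1"
proof -
  assume a: "in_range t n p" "0 < n" "4 \<le> t"
  have "real n powr (- edge_exponent t / 2) \<le> real n powr 0"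
    using a by (intro powr_mono) (auto simp: edge_exponent_def)
  then show "p \<le> 1" using a by (auto simp: in_range_def)
qed

text \<open>One factor \<open>q\<close> is kept because at least one edge is present; it is what
  later drives the tail bounds.\<close>

lemma power_mult_ge_powr:
  fixes q p :: real
  assumes n: "0 < n" and q: "1 \<le> q" and p: "q * real n powr (- \<beta>) \<le> p" and e: "1 \<le> e"
  shows "q * real n powr (real v - \<beta> * real e) \<le> real n ^ v * p ^ e"
proof -
  have "q * real n powr (real v - \<beta> * real e) = real n ^ v * (q * (real n powr (- \<beta>)) ^ e)"
    using n by (simp add: powr_diff powr_realpow powr_minus powr_power field_simps)
  also have "\<dots> \<le> real n ^ v * (q ^ e * (real n powr (- \<beta>)) ^ e)"
    using q e self_le_power[of q e] by (intro mult_left_mono mult_right_mono) auto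
  also have "\<dots> \<le> real n ^ v * p ^ e"
    using p q unfolding power_mult_distrib[symmetric] by (intro mult_left_mono power_mono) auto
  finally show ?thesis .
qed

lemma card_subgraph:
  assumes "graph_on k F" "J \<subseteq> F" "J \<noteq> {}"
  shows "1 \<le> card J" "2 \<le> card (\<Union>J)" "card (\<Union>J) \<le> k" "card J \<le> card (\<Union>J) choose 2"
proof -
  have "finite F" by (rule graph_on_finite[OF assms(1)])
  then have finJ: "finite J" using assms(2) finite_subset by blast
  have sub: "\<Union>J \<subseteq> {..<k}" using assms unfolding graph_on_def by blast
  then have finU: "finite (\<Union>J)" using finite_subset by blast
  show "card (\<Union>J) \<le> k" using card_mono[OF _ sub] by simp
  show "1 \<le> card J" using finJ assms(3) by (simp add: Suc_le_eq card_gt_0_iff)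
  obtain e where e: "e \<in> J" using assms(3) by blast
  have "card e = 2" using e assms unfolding graph_on_def by blast
  moreover have "card e \<le> card (\<Union>J)" using e finU by (intro card_mono) auto
  ultimately show "2 \<le> card (\<Union>J)" by simp
  have "card J \<le> card {e. e \<subseteq> \<Union>J \<and> card e = 2}"
    using assms finU unfolding graph_on_def by (intro card_mono) auto
  then show "card J \<le> card (\<Union>J) choose 2" by (simp add: n_subsets[OF finU])
qed

lemma real_choose_2: "real (v choose 2) = real v * (real v - 1) / 2"
proof -
  have "even (v * (v - 1))" by (cases v) auto
  then have "real (v * (v - 1) div 2) = real (v * (v - 1)) / 2" by (simp add: real_of_nat_div)
  then show ?thesis unfolding choose_two by (cases v) (simp_all add: algebra_simps)
qed

text \<open>On v vertices the exponent of n is at least v - v(v-1)/(t-1), which exceeds 1 by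
  (v-1)(t-1-v)/(t-1). So it is at least 1 for 2 <= v <= t-1, and it vanishes for v = t.\<close>

lemma rich_complete:
  fixes q p :: real
  assumes t: "3 \<le> t" "k \<le> t" and n: "0 < n" and q: "1 \<le> q"
    and p: "q * real n powr (- edge_exponent t) \<le> p"
  shows "rich (complete_graph k) n p (if k < t then q * n else q)"
  unfolding rich_def
proof (intro allI impI)
  fix J assume J: "J \<subseteq> complete_graph k" "J \<noteq> {}"
  define v e where "v = card (\<Union>J)" and "e = card J"
  have c: "1 \<le> e" "2 \<le> v" "v \<le> k" "e \<le> v choose 2"
    using card_subgraph[OF graph_on_complete J] by (simp_all add: v_def e_def)
  have "real e \<le> real v * (real v - 1) / 2" using c(4) real_choose_2[of v] by linarith
  then have "edge_exponent t * real e \<le> edge_exponent t * (real v * (real v - 1) / 2)"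
    using t by (intro mult_left_mono) (auto simp: edge_exponent_def)
  also have "\<dots> = real v * (real v - 1) / (real t - 1)"
    using t by (simp add: edge_exponent_def divide_simps)
  finally have e: "edge_exponent t * real e \<le> real v * (real v - 1) / (real t - 1)" .
  have t1: "0 < real t - 1" using t by simp
  have "(if k < t then 1 else 0) \<le> real v - real v * (real v - 1) / (real t - 1)"
  proof (cases "k < t")
    case True
    then have "0 \<le> (real v - 1) * (real t - 1 - real v)" using c by (intro mult_nonneg_nonneg) auto
    then show ?thesis using True t1 by (simp add: field_simps)
  next
    case False
    have "real v * (real v - 1) \<le> real v * (real t - 1)" using c t by (intro mult_left_mono) auto
    then show ?thesis using False t1 by (simp add: field_simps)
  qed
  then have "(if k < t then 1 else 0) \<le> real v - edge_exponent t * real e" using e by linarith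
  then have "real n powr (if k < t then 1 else 0) \<le> real n powr (real v - edge_exponent t * real e)"
    using n by (intro powr_mono) auto
  then have "(if k < t then q * n else q) \<le> q * real n powr (real v - edge_exponent t * real e)"
    using n q by (auto split: if_splits)
  also have "\<dots> \<le> real n ^ v * p ^ e" by (rule power_mult_ge_powr[OF n q p c(1)])
  finally show "(if k < t then q * n else q) \<le> real n ^ card (\<Union>J) * p ^ card J"
    by (simp add: v_def e_def)
qed

text \<open>The condition on \<open>J\<close> is the one of 2-density: growing an edge into a larger
  subgraph does not lower the expected number of copies.\<close>

lemma rich_edge:
  assumes F: "graph_on k F" and n: "0 < n" and p: "real n powr (- \<beta>) \<le> p"
    and J: "\<And>J. J \<subseteq> F \<Longrightarrow> J \<noteq> {} \<Longrightarrow> \<beta> * (real (card J) - 1) \<le> real (card (\<Union>J)) - 2"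
  shows "rich F n p ((real n)\<^sup>2 * p)"
  unfolding rich_def
proof (intro allI impI)
  fix J assume J': "J \<subseteq> F" "J \<noteq> {}"
  define v e where "v = card (\<Union>J)" and "e = card J"
  have c: "1 \<le> e" "2 \<le> v" using card_subgraph[OF F J'] by (simp_all add: v_def e_def)
  have "0 < real n powr (- \<beta>)" using n by simp
  then have p0: "0 < p" using p by linarith
  have "1 \<le> real n ^ (v - 2) * p ^ (e - 1)"
  proof (cases "e = 1")
    case True
    then show ?thesis using n by simp
  next
    case False
    have "\<beta> * real (e - 1) \<le> real (v - 2)" using J[OF J'] c by (simp add: v_def e_def of_nat_diff)
    then have "real n powr 0 \<le> real n powr (real (v - 2) - \<beta> * real (e - 1))"
      using n by (intro powr_mono) auto
    also have "\<dots> \<le> real n ^ (v - 2) * p ^ (e - 1)"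
      using power_mult_ge_powr[OF n order_refl, of \<beta> p "e - 1" "v - 2"] p c False by simp
    finally show ?thesis using n by simp
  qed
  then have "(real n)\<^sup>2 * p * 1 \<le> (real n)\<^sup>2 * p * (real n ^ (v - 2) * p ^ (e - 1))"
    using p0 by (intro mult_left_mono) auto
  also have "\<dots> = (real n ^ 2 * real n ^ (v - 2)) * (p ^ 1 * p ^ (e - 1))"
    by (simp only: power_one_right mult_ac)
  also have "\<dots> = real n ^ (2 + (v - 2)) * p ^ (1 + (e - 1))" by (simp only: power_add)
  also have "\<dots> = real n ^ v * p ^ e"
  proof -
    have "2 + (v - 2) = v" "1 + (e - 1) = e" using c by auto
    then show ?thesis by (simp only:)
  qed
  finally show "(real n)\<^sup>2 * p \<le> real n ^ card (\<Union>J) * p ^ card J" by (simp add: v_def e_def)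
qed

text \<open>With binomial(v,2) - 1 = (v-2)(v+1)/2 the 2-density condition becomes v + 1 <= t - 1,
  the origin of \<open>a \<le> t - 2\<close>.\<close>

lemma rich_edge_complete:
  assumes t: "4 \<le> t" "a \<le> t - 2" and n: "0 < n" and p: "real n powr (- edge_exponent t) \<le> p"
  shows "rich (complete_graph a) n p ((real n)\<^sup>2 * p)"
proof (rule rich_edge[OF graph_on_complete n p])
  fix J assume J: "J \<subseteq> complete_graph a" "J \<noteq> {}"
  define v e where "v = card (\<Union>J)" and "e = card J"
  have c: "1 \<le> e" "2 \<le> v" "v \<le> a" "e \<le> v choose 2"
    using card_subgraph[OF graph_on_complete J] by (simp_all add: v_def e_def)
  have "real e \<le> real v * (real v - 1) / 2" using c(4) real_choose_2[of v] by linarith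
  then have "edge_exponent t * (real e - 1) \<le> edge_exponent t * ((real v * (real v - 1)) / 2 - 1)"
    using t by (intro mult_left_mono) (auto simp: edge_exponent_def)
  also have "\<dots> = (real v - 2) * (real v + 1) / (real t - 1)"
    using t by (simp add: edge_exponent_def field_simps)
  also have "\<dots> \<le> (real v - 2) * (real t - 1) / (real t - 1)"
    using c t by (intro divide_right_mono mult_left_mono) auto
  also have "\<dots> = real v - 2" using t by simp
  finally show "edge_exponent t * (real (card J) - 1) \<le> real (card (\<Union>J)) - 2" by (simp add: v_def e_def)
qed

text \<open>Charge every edge to its first endpoint in the cyclic order. In the case of equality
  every vertex present is such a first endpoint, so the vertex set is closed under the successor and
  is everything.\<close>

lemma cycle_subgraph:
  assumes J: "J \<subseteq> cycle_graph l" and l: "0 < l"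
  shows "card J \<le> card (\<Union>J) \<and> (card J = card (\<Union>J) \<longrightarrow> J = {} \<or> l \<le> card (\<Union>J))"
proof -
  define I where "I = {i. i < l \<and> {i, (i + 1) mod l} \<in> J}"
  have finI: "finite I" by (simp add: I_def)
  have JI: "J = (\<lambda>i. {i, (i + 1) mod l}) ` I" using J by (auto simp: I_def cycle_graph_def)
  have IU: "I \<subseteq> \<Union>J" by (auto simp: I_def)
  have finU: "finite (\<Union>J)" unfolding JI using finI by simp
  have c1: "card J \<le> card I" unfolding JI by (rule card_image_le[OF finI])
  have c2: "card I \<le> card (\<Union>J)" by (rule card_mono[OF finU IU])
  have "l \<le> card (\<Union>J)" if eq: "card J = card (\<Union>J)" and "J \<noteq> {}"
  proof -
    have "I = \<Union>J" using card_subset_eq[OF finU IU] c1 c2 eq by simp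
    then have step: "(i + 1) mod l \<in> I" if "i \<in> I" for i using that by (auto simp: I_def)
    obtain i where i: "i \<in> I" using \<open>J \<noteq> {}\<close> JI by auto
    have *: "(i + j) mod l \<in> I" for j
    proof (induction j)
      case 0
      then show ?case using i by (auto simp: I_def)
    next
      case (Suc j)
      then show ?case using step[OF Suc] by (simp add: mod_Suc_eq)
    qed
    have "{..<l} \<subseteq> I"
    proof
      fix x assume "x \<in> {..<l}"
      then have "(i + (x + (l - i))) mod l = x" using i by (simp add: I_def)
      then show "x \<in> I" using *[of "x + (l - i)"] by simp
    qed
    then have "card {..<l} \<le> card I" by (rule card_mono[OF finI])
    then show ?thesis using c2 by simp
  qed
  then show ?thesis using c1 c2 by auto
qed

text \<open>For exponent 2/3 the condition reads 2(e-1) <= 3(v-2): subgraphs with e <= v-1 satisfy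
  it because v >= 2, the full cycle because v >= 4.\<close>

lemma rich_edge_cycle:
  assumes l: "4 \<le> l" and n: "0 < n" and p: "real n powr (- edge_exponent 4) \<le> p"
  shows "rich (cycle_graph l) n p ((real n)\<^sup>2 * p)"
proof (rule rich_edge[OF graph_on_cycle n p])
  fix J assume J: "J \<subseteq> cycle_graph l" "J \<noteq> {}"
  have gl: "graph_on l (cycle_graph l)" using l by (intro graph_on_cycle) auto
  note c = card_subgraph[OF gl J]
  have "3 * real (card (\<Union>J)) - 6 \<ge> 2 * (real (card J) - 1)"
  proof (cases "card J = card (\<Union>J)")
    case True
    then have "l \<le> card (\<Union>J)" using cycle_subgraph[OF J(1)] J(2) l by auto
    then have "4 \<le> card (\<Union>J)" using l by linarith
    then have "4 \<le> real (card (\<Union>J))" by simp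
    then show ?thesis by (simp add: True)
  next
    case False
    then have "card J + 1 \<le> card (\<Union>J)" using cycle_subgraph[OF J(1)] l by auto
    then have "real (card J) + 1 \<le> real (card (\<Union>J))" "2 \<le> real (card (\<Union>J))"
      using c(2) by simp_all
    then show ?thesis by argo
  qed
  then show "edge_exponent 4 * (real (card J) - 1) \<le> real (card (\<Union>J)) - 2"
    by (simp add: edge_exponent_def)
qed (use l in auto)

text \<open>Links the two levels of richness: n^2 p, for overlaps, is at least \<open>q * n\<close>,
  which can beat a union bound over all vertex sets.\<close>

lemma edges_ge:
  assumes t: "3 \<le> t" and n: "0 < n" and p: "q * real n powr (- edge_exponent t) \<le> p" and q: "0 \<le> q"
  shows "q * n \<le> (real n)\<^sup>2 * p"
proof -
  have "real n powr (- 1) \<le> real n powr (- edge_exponent t)"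
    using n t by (intro powr_mono) (auto simp: edge_exponent_def)
  then have "q * (1 / real n) \<le> p" using p q n mult_left_mono[of "real n powr (- 1)" "real n powr (- edge_exponent t)" q]
    by (simp add: powr_minus_divide)
  then have "(real n)\<^sup>2 * (q * (1 / real n)) \<le> (real n)\<^sup>2 * p" by (intro mult_left_mono) auto
  then show ?thesis using n by (simp add: power2_eq_square)
qed

section \<open>Asymptotic consequences of \<open>in_range\<close>\<close>

lemma eventually_real_ge: "\<forall>\<^sub>F n in sequentially. C \<le> real n"
  using filterlim_real_sequentially by (simp add: filterlim_at_top)

lemma eventually_powr_ge:
  assumes "0 < s" shows "\<forall>\<^sub>F n in sequentially. C \<le> real n powr s"
  using eventually_real_ge[of "max C 1 powr (1 / s)"]
proof eventually_elim
  case (elim n)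
  then have "(max C 1 powr (1 / s)) powr s \<le> real n powr s"
    using assms by (intro powr_mono2) auto
  moreover have "(max C 1 powr (1 / s)) powr s = max C 1" using assms by (simp add: powr_powr)
  ultimately show ?case by linarith
qed

lemma eventually_degree_ge:
  assumes "4 \<le> t" shows "\<forall>\<^sub>F n in sequentially. \<forall>p. in_range t n p \<longrightarrow> C \<le> real n * p"
proof -
  have "0 < 1 - edge_exponent t" using assms by (simp add: edge_exponent_def field_simps)
  then have "\<forall>\<^sub>F n in sequentially. C \<le> real n powr (1 - edge_exponent t)" by (rule eventually_powr_ge)
  then show ?thesis using eventually_gt_at_top[of 0]
  proof eventually_elim
    case (elim n)
    have "real n powr (1 - edge_exponent t) = n * real n powr (- edge_exponent t)"
      using elim by (simp add: powr_diff powr_minus divide_inverse)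
    then have "C \<le> n * real n powr (- edge_exponent t)" using elim by simp
    moreover have "n * real n powr (- edge_exponent t) \<le> real n * p" if "in_range t n p" for p
      using that by (intro mult_left_mono) (auto simp: in_range_def)
    ultimately show ?case by (meson order_trans)
  qed
qed

lemma eventually_prob_le:
  assumes "4 \<le> t" "0 < C" shows "\<forall>\<^sub>F n in sequentially. \<forall>p. in_range t n p \<longrightarrow> p \<le> C"
proof -
  have "0 < edge_exponent t / 2" using assms by (simp add: edge_exponent_def)
  then have "\<forall>\<^sub>F n in sequentially. 1 / C \<le> real n powr (edge_exponent t / 2)" by (rule eventually_powr_ge)
  then show ?thesis using eventually_gt_at_top[of 0]
  proof eventually_elim
    case (elim n)
    have "1 / real n powr (edge_exponent t / 2) \<le> 1 / (1 / C)"
      using elim assms by (intro divide_left_mono) auto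
    moreover have "real n powr (- edge_exponent t / 2) = 1 / real n powr (edge_exponent t / 2)"
      using powr_minus_divide[of "real n" "edge_exponent t / 2"] by simp
    ultimately show ?case unfolding in_range_def by auto
  qed
qed

text \<open>The upper end of the range is n^(-1/(t-1)), so the exponent \<open>3 * (t - 1)\<close>
  makes the power of \<open>p\<close> at most n^(-3), which beats n^2.\<close>

lemma eventually_codegree_small:
  assumes "4 \<le> t" "0 < D"
  shows "\<forall>\<^sub>F n in sequentially. \<forall>p. in_range t n p \<longrightarrow> C * (real n)\<^sup>2 * p ^ (3 * (t - 1)) < D"
proof -
  have "\<forall>\<^sub>F n in sequentially. (\<bar>C\<bar> + 1) / D \<le> real n" by (rule eventually_real_ge)
  then show ?thesis using eventually_gt_at_top[of 0]
  proof eventually_elim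
    case (elim n)
    show ?case
    proof (intro allI impI)
      fix p assume p: "in_range t n p"
      have p0: "0 < p" using in_range_pos[OF p] elim by simp
      have "p ^ (3 * (t - 1)) \<le> (real n powr (- edge_exponent t / 2)) ^ (3 * (t - 1))"
        using p p0 by (intro power_mono) (auto simp: in_range_def)
      also have "\<dots> = real n powr (- edge_exponent t / 2 * real (3 * (t - 1)))"
        using elim by (simp add: powr_power mult.commute)
      also have "- edge_exponent t / 2 * real (3 * (t - 1)) = - 3"
        using assms by (simp add: edge_exponent_def of_nat_diff field_simps)
      also have "real n powr (- 3) = 1 / real n ^ 3"
        using elim powr_realpow[of "real n" 3] by (simp add: powr_minus_divide)
      finally have "C * (real n)\<^sup>2 * p ^ (3 * (t - 1)) \<le> \<bar>C\<bar> * (real n)\<^sup>2 * (1 / real n ^ 3)"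
        using p0 by (intro mult_mono) auto
      also have "\<dots> = \<bar>C\<bar> / n" using elim by (simp add: power2_eq_square power3_eq_cube)
      also have "\<dots> < D"
      proof -
        have "\<bar>C\<bar> + 1 \<le> D * n" using elim assms by (simp add: field_simps)
        then have "\<bar>C\<bar> < D * n" by linarith
        then show ?thesis using elim by (simp add: field_simps)
      qed
      finally show "C * (real n)\<^sup>2 * p ^ (3 * (t - 1)) < D" .
    qed
  qed
qed

text \<open>The exponent \<open>1 - 2 * edge_exponent t\<close> is nonnegative exactly from
  \<open>t = 5\<close> on, where it is 0.\<close>

lemma codegree_ge_1:
  assumes t: "5 \<le> t" and n: "0 < n" and p: "in_range t n p"
  shows "1 \<le> n * p\<^sup>2"
proof -
  have "real n powr 0 \<le> real n powr (1 - edge_exponent t * 2)"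
    using t n by (intro powr_mono) (auto simp: edge_exponent_def field_simps)
  also have "\<dots> \<le> real n ^ 1 * p ^ 2"
    using power_mult_ge_powr[OF n order_refl, of "edge_exponent t" p 2 1] p by (simp add: in_range_def)
  finally show ?thesis using n by simp
qed

subsection \<open>Typical random graphs are Ramsey\<close>

definition half_up :: "nat \<Rightarrow> nat" where "half_up t = (t + 1) div 2"

lemma half_up:
  assumes "4 \<le> t"
  shows "2 \<le> half_up t" "half_up t \<le> t - 2" "half_up t \<le> t" "t - half_up t \<le> half_up t"
  using assms unfolding half_up_def by presburger+

definition overlap_const :: "nat set set \<Rightarrow> nat \<Rightarrow> real \<Rightarrow> real" where
  "overlap_const F k L = L * (2 ^ card F * real k ^ k)"

text \<open>For \<open>t = 4\<close> the random graph is too sparse for second neighbourhoods of linear size; there the cycles themselves are counted instead.\<close>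

definition typical :: "nat \<Rightarrow> nat \<Rightarrow> nat \<Rightarrow> real \<Rightarrow> real \<Rightarrow> real \<Rightarrow> nat set set \<Rightarrow> bool" where
  "typical t l n p L \<delta> \<Gamma> \<longleftrightarrow>
    count_upper (complete_graph (half_up t)) (half_up t) n p L \<Gamma> \<and>
    count_upper (complete_graph (t - 1)) (t - 1) n p L \<Gamma> \<and>
    dense_copies (complete_graph (t - 1)) (t - 1) n p \<delta> \<Gamma> \<and>
    (if t = 4
     then dense_copies (cycle_graph l) l n p \<delta> \<Gamma> \<and>
       few_overlaps (cycle_graph l) l n p (overlap_const (cycle_graph l) l L) \<Gamma>
     else dense_copies (complete_graph (half_up t)) (half_up t) n p \<delta> \<Gamma> \<and>
       few_overlaps (complete_graph (half_up t)) (half_up t) n p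
         (overlap_const (complete_graph (half_up t)) (half_up t) L) \<Gamma> \<and>
       count_upper (cycle_graph 4) 4 n p L \<Gamma> \<and> count_upper path3 3 n p L \<Gamma> \<and>
       count_upper (complete_graph 2) 2 n p L \<Gamma> \<and>
       count_upper (codegree_graph (3 * (t - 1))) (3 * (t - 1) + 2) n p L \<Gamma>)"

lemma dense_copies_mono:
  assumes "dense_copies F k n p \<delta> \<Gamma>" "\<delta> \<le> \<delta>'" shows "dense_copies F k n p \<delta>' \<Gamma>"
proof -
  have "\<delta> * real n \<le> \<delta>' * real n" using assms(2) by (intro mult_right_mono) auto
  then show ?thesis using assms(1) unfolding dense_copies_def by (meson order_trans)
qed

lemma typical_mono: "typical t l n p L \<delta> \<Gamma> \<Longrightarrow> \<delta> \<le> \<delta>' \<Longrightarrow> typical t l n p L \<delta>' \<Gamma>"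
  unfolding typical_def using dense_copies_mono by (auto split: if_splits)

lemma overlap_const_pos: "0 < k \<Longrightarrow> 0 < L \<Longrightarrow> 0 < overlap_const F k L"
  by (simp add: overlap_const_def)

lemma card_complete_graph_pos: "2 \<le> k \<Longrightarrow> 0 < card (complete_graph k)"
  using complete_graph_edge[of 0 k 1] graph_on_finite[OF graph_on_complete] by (auto simp: card_gt_0_iff)

text \<open>All quantifiers except that over \<open>n\<close> are inside, so one eventual bound on
  \<open>n\<close> serves every probability, graph, set and colouring.\<close>

abbreviation forces_blue_cycle :: "nat \<Rightarrow> nat \<Rightarrow> real \<Rightarrow> real \<Rightarrow> real \<Rightarrow> real \<Rightarrow> nat \<Rightarrow> bool" where
  "forces_blue_cycle t l L \<delta>0 \<delta> \<eta> n \<equiv> \<forall>p \<Gamma> S R. in_range t n p \<longrightarrow> \<Gamma> \<subseteq> all_edges n \<longrightarrow>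
    typical t l n p L \<delta>0 \<Gamma> \<longrightarrow> S \<subseteq> {..<n} \<longrightarrow> \<delta> * real n \<le> real (card S) \<longrightarrow>
    card (red_copies (complete_graph (half_up t)) (half_up t) S \<Gamma> R)
      \<le> \<eta> * mean_copies (complete_graph (half_up t)) (half_up t) n p \<longrightarrow>
    has_copy (cycle_graph l) l (\<Gamma> - R)"

text \<open>The prescribed clique \<open>f\<close> is a hypothesis apart from
  \<open>typical\<close>, since the tuples from which it comes depend on \<open>G\<close>.\<close>

abbreviation typical_forces_ramsey :: "nat \<Rightarrow> nat \<Rightarrow> real \<Rightarrow> real \<Rightarrow> real \<Rightarrow> real \<Rightarrow> nat \<Rightarrow> bool" where
  "typical_forces_ramsey t l L \<delta>0 c e n \<equiv> \<forall>p \<Gamma> G A1 B1 f R. in_range t n p \<longrightarrow>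
    G \<subseteq> all_edges n \<longrightarrow> \<Gamma> \<subseteq> all_edges n \<longrightarrow> typical t l n p L \<delta>0 \<Gamma> \<longrightarrow>
    A1 \<subseteq> {..<n} \<longrightarrow> B1 \<subseteq> {..<n} \<longrightarrow> (\<forall>x\<in>A1. c * real n \<le> real (card {y \<in> B1. {x, y} \<in> G})) \<longrightarrow>
    (\<forall>y\<in>B1. c * real n \<le> real (card {x \<in> A1. {x, y} \<in> G})) \<longrightarrow> f \<in> copies (complete_graph t) t A1 \<Gamma> \<longrightarrow>
    e * real n \<le> real (card {y \<in> B1. \<forall>i<t. {f i, y} \<in> G}) \<longrightarrow> R \<subseteq> G \<union> \<Gamma> \<longrightarrow>
    has_copy (complete_graph t) t R \<or> has_copy (cycle_graph l) l (G \<union> \<Gamma> - R)"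

lemma few_red_cliques_4:
  fixes \<delta> L :: real
  assumes l: "odd l" "5 \<le> l" and pos: "0 < \<delta>" "0 < L"
  shows "\<exists>\<eta>>0. \<exists>\<delta>0>0. \<forall>\<^sub>F n in sequentially. forces_blue_cycle 4 l L \<delta>0 \<delta> \<eta> n"
proof -
  define M where "M = card (cycle_graph l) * overlap_const (cycle_graph l) l L"
  have M0: "0 \<le> M" unfolding M_def using overlap_const_pos[of l L "cycle_graph l"] l pos
    by (intro mult_nonneg_nonneg) auto
  define h where "h = ((\<delta> / 2) ^ l / 2)\<^sup>2"
  have h0: "0 < h" using pos by (simp add: h_def)
  \<comment> \<open>\<open>M + 1\<close> avoids dividing by zero and makes the required inequality
    strict.\<close>
  define \<eta> where "\<eta> = h / (M + 1)"
  have \<eta>0: "0 < \<eta>" using h0 M0 by (simp add: \<eta>_def)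
  have "\<eta> * M < \<eta> * (M + 1)" using \<eta>0 by simp
  also have "\<dots> = h" using M0 by (simp add: \<eta>_def)
  finally have \<eta>: "\<eta> * M < h" .
  have half: "half_up 4 = 2" by (simp add: half_up_def)
  have "has_copy (cycle_graph l) l (\<Gamma> - R)"
    if n: "0 < n" and p: "in_range 4 n p" and \<Gamma>: "\<Gamma> \<subseteq> all_edges n" "typical 4 l n p L \<delta> \<Gamma>"
      and S: "S \<subseteq> {..<n}" "\<delta> * n \<le> card S"
      and red: "card (red_copies (complete_graph 2) 2 S \<Gamma> R)
        \<le> \<eta> * mean_copies (complete_graph 2) 2 n p" for n p \<Gamma> S R
  proof (rule blue_cycle_if_few_red_edges[OF _ \<Gamma>(1) S order_refl pos(1)])
    show "dense_copies (cycle_graph l) l n p \<delta> \<Gamma>"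
      "few_overlaps (cycle_graph l) l n p (overlap_const (cycle_graph l) l L) \<Gamma>"
      using \<Gamma>(2) by (auto simp: typical_def)
    show "card (red_copies (complete_graph 2) 2 S \<Gamma> R)
        \<le> \<eta> * ((real n)\<^sup>2 * p)" using red by (simp add: complete_graph_2)
    show "\<eta> * (card (cycle_graph l) * overlap_const (cycle_graph l) l L) < ((\<delta> / 2) ^ l / 2)\<^sup>2"
      using \<eta> by (simp add: M_def h_def)
  qed (use l n in_range_pos[OF p n] \<eta>0 overlap_const_pos pos in auto)
  note main = this
  show ?thesis
    unfolding half
    by (intro exI[of _ \<eta>] exI[of _ \<delta>] conjI \<eta>0 pos(1), rule eventually_mono[OF eventually_gt_at_top[of 0]])
      (intro allI impI, rule main)
qed

text \<open>\<open>many_blue_edges\<close> is used twice: in \<open>S\<close>, to obtain a linear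
  second neighbourhood Y, and again in Y. The constants follow in the order \<open>\<delta>\<close>,
  \<open>b1\<close>, \<open>\<delta>2\<close>, \<open>b2\<close>, and \<open>\<eta>\<close> must be
  small enough for both uses.\<close>

lemma few_red_cliques_5:
  fixes \<delta> L :: real
  assumes t: "5 \<le> t" and l: "odd l" "5 \<le> l" and pos: "0 < \<delta>" "0 < L"
  shows "\<exists>\<eta>>0. \<exists>\<delta>0>0. \<forall>\<^sub>F n in sequentially. forces_blue_cycle t l L \<delta>0 \<delta> \<eta> n"
proof -
  define a where "a = half_up t"
  define F where "F = complete_graph a"
  have a: "2 \<le> a" using half_up t by (auto simp: a_def)
  have F: "graph_on a F" "0 < card F" using graph_on_complete card_complete_graph_pos a by (auto simp: F_def)
  define Q where "Q = overlap_const F a L"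
  have Q0: "0 < Q" using overlap_const_pos a pos by (simp add: Q_def)
  define blue where "blue x = ((x / 2) ^ a / 4)\<^sup>2 / (card F * Q)" for x :: real
  have blue0: "0 < blue x" if "0 < x" for x using that F Q0 by (simp add: blue_def)
  define b1 where "b1 = blue \<delta>"
  define \<delta>2 where "\<delta>2 = b1 ^ 4 / (16 * L)"
  define b2 where "b2 = blue \<delta>2"
  have b1: "0 < b1" unfolding b1_def by (rule blue0[OF pos(1)])
  have \<delta>2: "0 < \<delta>2" using b1 pos by (simp add: \<delta>2_def)
  have b2: "0 < b2" unfolding b2_def by (rule blue0[OF \<delta>2])
  define \<eta> where "\<eta> = min ((\<delta> / 2) ^ a / 4) ((\<delta>2 / 2) ^ a / 4)"
  have \<eta>0: "0 < \<eta>" using pos \<delta>2 by (simp add: \<eta>_def)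
  define \<delta>0 where "\<delta>0 = min \<delta> \<delta>2"
  have \<delta>00: "0 < \<delta>0" using pos \<delta>2 by (simp add: \<delta>0_def)
  define k where "k = 3 * (t - 1)"
  define C where "C = max (2 * L / b1\<^sup>2) ((real l + 1 + 2 * k) / (b2 / 6))"
  have main: "has_copy (cycle_graph l) l (\<Gamma> - R)"
    if n: "0 < n" and p: "in_range t n p" and \<Gamma>: "\<Gamma> \<subseteq> all_edges n" and tcl: "typical t l n p L \<delta>0 \<Gamma>"
      and S: "S \<subseteq> {..<n}" "\<delta> * n \<le> card S"
      and red: "card (red_copies F a S \<Gamma> R) \<le> \<eta> * mean_copies F a n p"
      and big: "C \<le> real n * p" "p \<le> b1 ^ 4 / (16 * L) / L" "L * (real n)\<^sup>2 * p ^ k < (b2 / 6 / 2) ^ k"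
    for n p \<Gamma> S R
  proof -
    have p0: "0 < p" by (rule in_range_pos[OF p n])
    have N0: "0 \<le> mean_copies F a n p" using p0 by simp
    have finS: "finite S" using S(1) finite_subset by auto
    have dense: "dense_copies F a n p \<delta>0 \<Gamma>" and ov: "few_overlaps F a n p Q \<Gamma>"
      and up: "count_upper (cycle_graph 4) 4 n p L \<Gamma>" "count_upper path3 3 n p L \<Gamma>"
        "count_upper (complete_graph 2) 2 n p L \<Gamma>" "count_upper (codegree_graph k) (k + 2) n p L \<Gamma>"
      using tcl t by (auto simp: typical_def F_def a_def Q_def k_def)
    have "\<eta> * mean_copies F a n p \<le> (\<delta> / 2) ^ a / 4 * mean_copies F a n p"
      using N0 by (intro mult_right_mono) (auto simp: \<eta>_def)
    then have red1: "card (red_copies F a S \<Gamma> R)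
        \<le> (\<delta> / 2) ^ a / 4 * mean_copies F a n p" using red by linarith
    have e1: "b1 * ((real n)\<^sup>2 * p) \<le> card {(x, y) \<in> S \<times> S. {x, y} \<in> \<Gamma> - R}"
      unfolding b1_def blue_def
      by (rule many_blue_edges[OF F \<Gamma> S _ pos(1) dense ov p0 n Q0 red1]) (simp add: \<delta>0_def)
    have np: "1 \<le> real n * p\<^sup>2" by (rule codegree_ge_1[OF t n p])
    have "2 * L / b1\<^sup>2 \<le> real n * p" using big(1) by (simp add: C_def)
    then have Ln: "L \<le> b1\<^sup>2 / 2 * (real n * p)" using b1 by (simp add: field_simps)
    have Lp: "L * p \<le> b1 ^ 4 / (16 * L)" using big(2) pos by (simp add: field_simps)
    obtain v where v: "v \<in> S" "b1 ^ 4 / (16 * L) * n \<le>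
        card {y \<in> S. y \<noteq> v \<and> {v, y} \<notin> \<Gamma> \<and> (\<exists>x\<in>S. {v, x} \<in> \<Gamma> - R \<and> {x, y} \<in> \<Gamma> - R)}"
      by (rule blue_second_neighbourhood[OF \<Gamma> Diff_subset S(1) e1 up(1-3) b1 pos(2) p0 n np Ln Lp])
    define Y where "Y = {y \<in> S. y \<noteq> v \<and> {v, y} \<notin> \<Gamma> \<and> (\<exists>x\<in>S. {v, x} \<in> \<Gamma> - R \<and> {x, y} \<in> \<Gamma> - R)}"
    have Y: "Y \<subseteq> S" "Y \<subseteq> {..<n}" "\<delta>2 * n \<le> card Y" using S(1) v(2) by (auto simp: Y_def \<delta>2_def)
    \<comment> \<open>Scarcity of red copies is measured against all of \<open>{..<n}\<close>, so it
      passes to subsets unchanged.\<close>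
    have "card (red_copies F a Y \<Gamma> R) \<le> card (red_copies F a S \<Gamma> R)"
      using copies_mono[OF Y(1), of F a \<Gamma>] finS by (intro card_mono) auto
    moreover have "\<eta> * mean_copies F a n p \<le> (\<delta>2 / 2) ^ a / 4 * mean_copies F a n p"
      using N0 by (intro mult_right_mono) (auto simp: \<eta>_def)
    ultimately have red2: "card (red_copies F a Y \<Gamma> R)
        \<le> (\<delta>2 / 2) ^ a / 4 * mean_copies F a n p" using red by linarith
    have e2: "b2 * ((real n)\<^sup>2 * p) \<le> card {(x, y) \<in> Y \<times> Y. {x, y} \<in> \<Gamma> - R}"
      unfolding b2_def blue_def
      by (rule many_blue_edges[OF F \<Gamma> Y(2,3) _ \<delta>2 dense ov p0 n Q0 red2]) (simp add: \<delta>0_def)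
    have "(real l + 1 + 2 * k) / (b2 / 6) \<le> real n * p" using big(1) by (simp add: C_def)
    then have "real l + 1 + 2 * k \<le> b2 / 6 * (real n * p)" using b2 by (simp add: field_simps)
    then have bk: "2 * real k \<le> b2 / 6 * n * p" "real l + 1 \<le> b2 / 6 * n * p" by (simp_all add: mult.assoc)
    show ?thesis
    proof (rule blue_cycle_in_second_neighbourhood[OF l \<Gamma> Diff_subset Y(2) _ e2 _ b2 p0 n bk(2)])
      show "y \<noteq> v \<and> {v, y} \<notin> \<Gamma> \<and> (\<exists>x. {v, x} \<in> \<Gamma> - R \<and> {x, y} \<in> \<Gamma> - R)" if "y \<in> Y" for y
        using that unfolding Y_def by blast
      show "card {x. {u, x} \<in> \<Gamma> \<and> {w, x} \<in> \<Gamma>} < b2 / 6 * n * p" if "u < n" "w < n" "u \<noteq> w" for u w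
        using bk(1) b2 by (intro codegree_less[OF \<Gamma> up(4) _ p0 n that big(3)]) auto
    qed
  qed
  have "\<forall>\<^sub>F n in sequentially. \<forall>p. in_range t n p \<longrightarrow> C \<le> real n * p"
    using t by (intro eventually_degree_ge) auto
  moreover have "\<forall>\<^sub>F n in sequentially. \<forall>p. in_range t n p \<longrightarrow> p \<le> b1 ^ 4 / (16 * L) / L"
    using t b1 pos by (intro eventually_prob_le) auto
  moreover have "\<forall>\<^sub>F n in sequentially. \<forall>p. in_range t n p \<longrightarrow> L * (real n)\<^sup>2 * p ^ k < (b2 / 6 / 2) ^ k"
    unfolding k_def using t b2 by (intro eventually_codegree_small) auto
  ultimately have "\<forall>\<^sub>F n in sequentially. \<forall>p \<Gamma> S R. in_range t n p \<longrightarrow> \<Gamma> \<subseteq> all_edges n \<longrightarrow>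
    typical t l n p L \<delta>0 \<Gamma> \<longrightarrow> S \<subseteq> {..<n} \<longrightarrow> \<delta> * n \<le> card S \<longrightarrow>
    card (red_copies F a S \<Gamma> R) \<le> \<eta> * mean_copies F a n p \<longrightarrow>
    has_copy (cycle_graph l) l (\<Gamma> - R)"
    using eventually_gt_at_top[of 0]
  proof eventually_elim
    case (elim n)
    show ?case
      by (intro allI impI, rule main[OF elim(4)])
        (assumption | (rule elim(1)[rule_format] elim(2)[rule_format] elim(3)[rule_format], assumption))+
  qed
  then show ?thesis unfolding F_def a_def by (intro exI[of _ \<eta>] exI[of _ \<delta>0] conjI \<eta>0 \<delta>00)
qed

lemma few_red_cliques:
  fixes \<delta> L :: real
  assumes t: "4 \<le> t" and l: "odd l" "5 \<le> l" and pos: "0 < \<delta>" "0 < L"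
  shows "\<exists>\<eta>>0. \<exists>\<delta>0>0. \<forall>\<^sub>F n in sequentially. forces_blue_cycle t l L \<delta>0 \<delta> \<eta> n"
proof (cases "t = 4")
  case True
  then show ?thesis using few_red_cliques_4[OF l pos] by simp
next
  case False
  then show ?thesis using few_red_cliques_5[OF _ l pos] t by simp
qed

section \<open>Combining the cases of few and of many red edges\<close>

lemma has_copy_mono: "has_copy H k G \<Longrightarrow> G \<subseteq> G' \<Longrightarrow> has_copy H k G'"
  unfolding has_copy_def by blast

text \<open>\<open>few_red_cliques\<close> is called twice because the two outcomes of
  \<open>many_red_case\<close> have different sizes, \<open>\<gamma> * n\<close> and
  \<open>\<epsilon>2 * n\<close>, and \<open>\<epsilon>2\<close> depends on the
  \<open>\<eta>\<close> returned by the first call.\<close>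

lemma typical_imp_ramsey:
  fixes c e L :: real
  assumes t: "4 \<le> t" and l: "odd l" "5 \<le> l" and pos: "0 < c" "0 < e" "0 < L"
  shows "\<exists>\<delta>0>0. \<forall>\<^sub>F n in sequentially. typical_forces_ramsey t l L \<delta>0 c e n"
proof -
  define \<theta> where "\<theta> = min (c / 4) (e / (2 * (real t + 1)))"
  have \<theta>0: "0 < \<theta>" using pos by (simp add: \<theta>_def)
  have "\<theta> * (2 * (real t + 1)) \<le> e / (2 * (real t + 1)) * (2 * (real t + 1))"
    by (intro mult_right_mono) (auto simp: \<theta>_def)
  also have "\<dots> = e" by simp
  finally have "\<theta> * (2 * (real t + 1)) \<le> e" .
  moreover have "\<theta> \<le> c / 4" unfolding \<theta>_def by (rule min.cobounded1)
  ultimately have \<theta>: "\<theta> \<le> c / 4" "\<theta> * (2 * (real t + 1)) \<le> e" by blast+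
  define \<epsilon> where "\<epsilon> = c / 2 * (c * \<theta> / 16) ^ (t - 1) / (8 * L)"
  have \<epsilon>0: "0 < \<epsilon>" using pos \<theta>0 by (simp add: \<epsilon>_def)
  \<comment> \<open>More than \<theta>^2 n^2 / 2 red pairs exceed the 2 \<gamma> n^2 = \<theta>^2
    n^2 / 4 that a core of minimum degree \<open>\<gamma> * n\<close> requires.\<close>
  define \<gamma> where "\<gamma> = \<theta>\<^sup>2 / 8"
  have \<gamma>0: "0 < \<gamma>" using \<theta>0 by (simp add: \<gamma>_def)
  obtain \<eta> \<delta>1 where \<eta>: "0 < \<eta>" "0 < \<delta>1" and ev1:
    "\<forall>\<^sub>F n in sequentially. forces_blue_cycle t l L \<delta>1 \<gamma> \<eta> n"
    using few_red_cliques[OF t l \<gamma>0 pos(3)] by blast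
  define \<epsilon>2 where "\<epsilon>2 = \<eta> * \<gamma> / L"
  have \<epsilon>20: "0 < \<epsilon>2" using \<eta> \<gamma>0 pos by (simp add: \<epsilon>2_def)
  obtain \<eta>2 \<delta>2 where \<eta>2: "0 < \<eta>2" "0 < \<delta>2" and ev2:
    "\<forall>\<^sub>F n in sequentially. forces_blue_cycle t l L \<delta>2 \<epsilon>2 \<eta>2 n"
    using few_red_cliques[OF t l \<epsilon>20 pos(3)] by blast
  define \<delta>0 where "\<delta>0 = min (c * \<theta> / 8) (min \<delta>1 \<delta>2)"
  have \<delta>00: "0 < \<delta>0" using pos \<theta>0 \<eta> \<eta>2 by (simp add: \<delta>0_def)
  have main: "has_copy (complete_graph t) t R \<or> has_copy (cycle_graph l) l (G \<union> \<Gamma> - R)"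
    if n: "0 < n" and p: "in_range t n p" and G: "G \<subseteq> all_edges n" "\<Gamma> \<subseteq> all_edges n"
      and tcl: "typical t l n p L \<delta>0 \<Gamma>" and AB: "A1 \<subseteq> {..<n}" "B1 \<subseteq> {..<n}"
      and deg: "\<And>x. x \<in> A1 \<Longrightarrow> c * n \<le> card {y \<in> B1. {x, y} \<in> G}"
        "\<And>y. y \<in> B1 \<Longrightarrow> c * n \<le> card {x \<in> A1. {x, y} \<in> G}"
      and f: "f \<in> copies (complete_graph t) t A1 \<Gamma>" "e * n \<le> card {y \<in> B1. \<forall>i<t. {f i, y} \<in> G}"
      and R: "R \<subseteq> G \<union> \<Gamma>"
      and F1: "\<And>S. S \<subseteq> {..<n} \<Longrightarrow> \<gamma> * n \<le> card S \<Longrightarrow>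
        card (red_copies (complete_graph (half_up t)) (half_up t) S \<Gamma> R)
          \<le> \<eta> * mean_copies (complete_graph (half_up t)) (half_up t) n p \<Longrightarrow>
        has_copy (cycle_graph l) l (\<Gamma> - R)"
      and F2: "\<And>S. S \<subseteq> {..<n} \<Longrightarrow> \<epsilon>2 * n \<le> card S \<Longrightarrow>
        card (red_copies (complete_graph (half_up t)) (half_up t) S \<Gamma> R)
          \<le> \<eta>2 * mean_copies (complete_graph (half_up t)) (half_up t) n p \<Longrightarrow>
        has_copy (cycle_graph l) l (\<Gamma> - R)"
      and big: "real l + 1 \<le> c / 2 * \<epsilon> * n / 3" "real l + 1 \<le> c / 2 * (e / 2) * n / 3"
    for n p \<Gamma> G A1 B1 f R
  proof (rule ccontr)
    assume "\<not> ?thesis"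
    then have nored: "\<not> has_copy (complete_graph t) t R" and noblue: "\<not> has_copy (cycle_graph l) l (G \<union> \<Gamma> - R)"
      by auto
    have no\<Gamma>: "\<not> has_copy (cycle_graph l) l (\<Gamma> - R)" using noblue has_copy_mono[of _ l "\<Gamma> - R" "G \<union> \<Gamma> - R"] by blast
    have p0: "0 < p" by (rule in_range_pos[OF p n])
    have up: "count_upper (complete_graph (half_up t)) (half_up t) n p L \<Gamma>"
      "count_upper (complete_graph (t - 1)) (t - 1) n p L \<Gamma>"
      "dense_copies (complete_graph (t - 1)) (t - 1) n p \<delta>0 \<Gamma>"
      using tcl by (auto simp: typical_def)
    have fin: "finite A1" "finite B1" using AB finite_subset by auto
    have cA: "card A1 \<le> n" "card B1 \<le> n" using card_mono[OF _ AB(1)] card_mono[OF _ AB(2)] by auto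
    show False
    proof (cases "card {(x, y) \<in> A1 \<times> B1. {x, y} \<in> G \<inter> R} \<le> \<theta>\<^sup>2 / 2 * (real n)\<^sup>2")
      case True
      have "has_copy (complete_graph t) t R"
        by (rule few_red_case[OF l _ G noblue AB deg f pos(1,2) \<theta>0 pos(3) n p0 \<theta> True up(2,3) _ \<epsilon>_def big])
          (use t in \<open>auto simp: \<delta>0_def\<close>)
      then show False using nored by simp
    next
      case False
      have "\<gamma> * n * (card A1 + card B1) \<le> \<gamma> * n * (n + n)" using cA \<gamma>0 by (intro mult_left_mono) auto
      also have "\<dots> = \<theta>\<^sup>2 / 4 * (real n)\<^sup>2" by (simp add: \<gamma>_def power2_eq_square)
      also have "\<dots> \<le> \<theta>\<^sup>2 / 2 * (real n)\<^sup>2" by (intro mult_right_mono) auto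
      finally have ed: "\<gamma> * n * (card A1 + card B1) < card {(x, y) \<in> A1 \<times> B1. {x, y} \<in> G \<inter> R}"
        using False by linarith
      have gn: "0 \<le> \<gamma> * n" using \<gamma>0 by simp
      obtain A2 B2 where AB2: "A2 \<subseteq> A1" "B2 \<subseteq> B1" "A2 \<noteq> {}" "B2 \<noteq> {}"
        "\<And>x. x \<in> A2 \<Longrightarrow> \<gamma> * n \<le> card {y \<in> B2. {x, y} \<in> G \<inter> R}"
        "\<And>y. y \<in> B2 \<Longrightarrow> \<gamma> * n \<le> card {x \<in> A2. {x, y} \<in> G \<inter> R}"
        by (rule bipartite_core[OF fin gn ed]) blast
      have fin2: "finite A2" "finite B2"
        using finite_subset[OF AB2(1) fin(1)] finite_subset[OF AB2(2) fin(2)] by simp_all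
      have sub2: "A2 \<subseteq> {..<n}" "B2 \<subseteq> {..<n}" using AB2(1,2) AB by blast+
      obtain x where x: "x \<in> A2" using AB2(3) by blast
      have "card {y \<in> B2. {x, y} \<in> G \<inter> R} \<le> card B2" using fin2 by (intro card_mono) auto
      then have cB2: "\<gamma> * n \<le> card B2" using AB2(5)[OF x] by linarith
      have degR: "\<gamma> * n \<le> card {x \<in> A2. {x, y} \<in> R}" if "y \<in> B2" for y
      proof -
        have "card {x \<in> A2. {x, y} \<in> G \<inter> R} \<le> card {x \<in> A2. {x, y} \<in> R}" using fin2 by (intro card_mono) auto
        then show ?thesis using AB2(6)[OF that] by linarith
      qed
      have RE: "R \<subseteq> all_edges n" using R G by auto
      show False
      proof (rule many_red_case[OF RE nored half_up(3)[OF t] half_up(4)[OF t] sub2 cB2 degR up(1) \<gamma>0 \<eta>(1) pos(3) n \<epsilon>2_def])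
        fix S assume "S \<subseteq> {..<n}" "\<gamma> * n \<le> card S"
          "card (red_copies (complete_graph (half_up t)) (half_up t) S \<Gamma> R)
          \<le> \<eta> * mean_copies (complete_graph (half_up t)) (half_up t) n p"
        then show False using F1 no\<Gamma> by blast
      next
        fix S assume S: "S \<subseteq> {..<n}" "\<epsilon>2 * n \<le> card S"
          "red_copies (complete_graph (half_up t)) (half_up t) S \<Gamma> R = {}"
        have "0 \<le> \<eta>2 * mean_copies (complete_graph (half_up t)) (half_up t) n p"
          using \<eta>2 p0 by simp
        then show False using F2[OF S(1,2)] no\<Gamma> unfolding S(3) by simp
      qed auto
    qed
  qed
  have "\<forall>\<^sub>F n in sequentially. (real l + 1) * 3 / (c / 2 * \<epsilon>) \<le> real n"
    "\<forall>\<^sub>F n in sequentially. (real l + 1) * 3 / (c / 2 * (e / 2)) \<le> real n"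
    by (rule eventually_real_ge)+
  with ev1 ev2 eventually_gt_at_top[of 0]
  have "\<forall>\<^sub>F n in sequentially. typical_forces_ramsey t l L \<delta>0 c e n"
  proof eventually_elim
    case (elim n)
    have big: "real l + 1 \<le> c / 2 * \<epsilon> * n / 3" "real l + 1 \<le> c / 2 * (e / 2) * n / 3"
      using elim(4,5) pos \<epsilon>0 by (simp_all add: field_simps)
    show ?case
    proof (intro allI impI)
      fix p \<Gamma> G A1 B1 f R
      assume h: "in_range t n p" "G \<subseteq> all_edges n" "\<Gamma> \<subseteq> all_edges n" "typical t l n p L \<delta>0 \<Gamma>"
        "A1 \<subseteq> {..<n}" "B1 \<subseteq> {..<n}" "\<forall>x\<in>A1. c * n \<le> card {y \<in> B1. {x, y} \<in> G}"
        "\<forall>y\<in>B1. c * n \<le> card {x \<in> A1. {x, y} \<in> G}" "f \<in> copies (complete_graph t) t A1 \<Gamma>"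
        "e * n \<le> card {y \<in> B1. \<forall>i<t. {f i, y} \<in> G}" "R \<subseteq> G \<union> \<Gamma>"
      have tcl: "typical t l n p L \<delta>1 \<Gamma>" "typical t l n p L \<delta>2 \<Gamma>"
        using typical_mono[OF h(4)] by (auto simp: \<delta>0_def)
      show "has_copy (complete_graph t) t R \<or> has_copy (cycle_graph l) l (G \<union> \<Gamma> - R)"
      proof (rule main[OF elim(3) h(1-6) _ _ h(9-11) _ _ big])
        show "c * n \<le> card {y \<in> B1. {x, y} \<in> G}" if "x \<in> A1" for x using h(7) that by blast
        show "c * n \<le> card {x \<in> A1. {x, y} \<in> G}" if "y \<in> B1" for y using h(8) that by blast
        fix S assume S: "S \<subseteq> {..<n}"
        show "has_copy (cycle_graph l) l (\<Gamma> - R)" if "\<gamma> * n \<le> card S"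
          "card (red_copies (complete_graph (half_up t)) (half_up t) S \<Gamma> R)
          \<le> \<eta> * mean_copies (complete_graph (half_up t)) (half_up t) n p"
          by (rule elim(1)[rule_format, OF h(1,3) tcl(1) S that])
        show "has_copy (cycle_graph l) l (\<Gamma> - R)" if "\<epsilon>2 * n \<le> card S"
          "card (red_copies (complete_graph (half_up t)) (half_up t) S \<Gamma> R)
          \<le> \<eta>2 * mean_copies (complete_graph (half_up t)) (half_up t) n p"
          by (rule elim(2)[rule_format, OF h(1,3) tcl(2) S that])
      qed
    qed
  qed
  then show ?thesis by (intro exI[of _ \<delta>0] conjI \<delta>00)
qed

subsection \<open>The random graph is typical\<close>

lemma prob_not_conj_le:
  assumes "0 \<le> p" "p \<le> 1" "prob E p (\<lambda>S. \<not> P S) \<le> a" "prob E p (\<lambda>S. \<not> Q S) \<le> b"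
  shows "prob E p (\<lambda>S. \<not> (P S \<and> Q S)) \<le> a + b"
  using prob_disj_le[OF assms(1,2), of E "\<lambda>S. \<not> P S" "\<lambda>S. \<not> Q S"] assms(3,4)
  by (simp only: de_Morgan_conj)

lemma prob_not_count_upper:
  assumes "graph_on k F" "0 < p" "p \<le> 1" "0 < L" "0 < n"
  shows "prob (all_edges n) p (\<lambda>\<Gamma>. \<not> count_upper F k n p L \<Gamma>) \<le> 1 / L"
  by (rule order_trans[OF prob_mono copies_upper[OF assms]])
    (use assms in \<open>auto simp: count_upper_def\<close>)

lemma prob_not_few_overlaps:
  assumes F: "graph_on k F" "0 < k" and p: "0 < p" "p \<le> 1" and "0 < L" "0 < n"
    and rich: "rich F n p ((real n)\<^sup>2 * p)"
  shows "prob (all_edges n) p (\<lambda>\<Gamma>. \<not> few_overlaps F k n p (overlap_const F k L) \<Gamma>) \<le> 1 / L"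
proof (rule order_trans[OF prob_mono overlaps_upper[OF F p \<open>0 < L\<close> \<open>0 < n\<close> _ rich]])
  have np: "0 < (real n)\<^sup>2 * p" using assms by simp
  then show "0 < (real n)\<^sup>2 * p" .
  fix \<Gamma> assume "\<not> few_overlaps F k n p (overlap_const F k L) \<Gamma>"
  then have "L * (2 ^ card F * real k ^ k) * (mean_copies F k n p)\<^sup>2
      \<le> card (overlaps F k {..<n} \<Gamma>) * ((real n)\<^sup>2 * p)"
    by (simp add: few_overlaps_def overlap_const_def mult_ac)
  then show "L * (2 ^ card F * real k ^ k * (mean_copies F k n p)\<^sup>2 / ((real n)\<^sup>2 * p))
      \<le> card (overlaps F k {..<n} \<Gamma>)"
    using np by (simp add: pos_divide_le_eq mult.assoc)
qed (use p in auto)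

text \<open>A union bound over at most \<open>2 ^ n\<close> sets, each failing with probability
  exponentially small in \<open>q * n\<close>.\<close>

lemma prob_not_dense_copies:
  fixes \<delta> q p :: real
  assumes F: "graph_on k F" "0 < k" and p: "0 < p" "p \<le> 1" and q: "0 < q" and n: "0 < n"
    and rich: "rich F n p (q * n)" and \<delta>: "0 < \<delta>" "2 * k \<le> \<delta> * n"
  shows "prob (all_edges n) p (\<lambda>\<Gamma>. \<not> dense_copies F k n p \<delta> \<Gamma>)
    \<le> 2 ^ n * exp (- ((\<delta> / 2) ^ k)\<^sup>2 * (q * n) / (8 * 2 ^ card F * real k ^ k))"
proof -
  define I where "I = {S. S \<subseteq> {..<n} \<and> \<delta> * n \<le> card S}"
  have finI: "finite I" unfolding I_def by (rule finite_subset[of _ "Pow {..<n}"]) auto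
  define N where "N = mean_copies F k n p"
  define x where "x = exp (- ((\<delta> / 2) ^ k)\<^sup>2 * (q * n) / (8 * 2 ^ card F * real k ^ k))"
  \<comment> \<open>The target in \<open>dense_copies\<close> scales with \<open>S\<close>, so the
    density parameter does too; the error term only uses that it is at least
    \<open>(\<delta> / 2) ^ k\<close>.\<close>
  define \<alpha> where "\<alpha> S = (real (card S) / (2 * n)) ^ k" for S :: "nat set"
  have "prob (all_edges n) p (\<lambda>\<Gamma>. \<not> dense_copies F k n p \<delta> \<Gamma>)
     \<le> prob (all_edges n) p (\<lambda>\<Gamma>. \<exists>S\<in>I. card {f\<in>injections k S. image_graph F f \<subseteq> \<Gamma>} \<le> \<alpha> S / 2 * N)"
  proof (rule prob_mono)
    fix \<Gamma> assume "\<not> dense_copies F k n p \<delta> \<Gamma>"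
    then obtain S where S: "S \<in> I" "card (copies F k S \<Gamma>) < (card S / 2) ^ k / 2 * p ^ card F"
      unfolding dense_copies_def I_def by (auto simp: not_le)
    have "(card S / 2) ^ k / 2 * p ^ card F = \<alpha> S / 2 * N"
      using n by (simp add: \<alpha>_def N_def power_divide power_mult_distrib)
    then show "\<exists>S\<in>I. card {f\<in>injections k S. image_graph F f \<subseteq> \<Gamma>} \<le> \<alpha> S / 2 * N"
      using S unfolding copies_def by (intro bexI[of _ S]) auto
  qed (use p in auto)
  also have "\<dots> \<le> (\<Sum>S\<in>I. prob (all_edges n) p
      (\<lambda>\<Gamma>. card {f\<in>injections k S. image_graph F f \<subseteq> \<Gamma>} \<le> \<alpha> S / 2 * N))"
    using p finI by (intro prob_Bex_le) auto
  also have "\<dots> \<le> (\<Sum>S\<in>I. x)"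
  proof (intro sum_mono)
    fix S assume S: "S \<in> I"
    then have S': "S \<subseteq> {..<n}" "\<delta> * n \<le> card S" "finite S" unfolding I_def using finite_subset by auto
    have \<alpha>n: "\<alpha> S * real n ^ k = (real (card S) / 2) ^ k"
      using n by (simp add: \<alpha>_def power_divide power_mult_distrib)
    have k2: "2 * k \<le> card S" using S'(2) \<delta>(2) by linarith
    have "prob (all_edges n) p (\<lambda>\<Gamma>. card {f\<in>injections k S. image_graph F f \<subseteq> \<Gamma>} \<le> \<alpha> S / 2 * N)
       \<le> exp (- (\<alpha> S)\<^sup>2 * (q * n) / (8 * 2 ^ card F * real k ^ k))"
      unfolding N_def
    proof (rule lower_tail[OF F p _ rich _ n])
      show "injections k S \<subseteq> injections k {..<n}" by (rule injections_mono[OF S'(1)])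
      show "\<alpha> S * real n ^ k \<le> card (injections k S)"
        unfolding \<alpha>n by (rule card_injections_ge[OF S'(3) k2])
      show "0 \<le> \<alpha> S" by (simp add: \<alpha>_def)
    qed (use q n in auto)
    also have "\<dots> \<le> x"
    proof -
      have "\<delta> / 2 \<le> real (card S) / (2 * n)" using S'(2) n by (simp add: field_simps)
      then have "(\<delta> / 2) ^ k \<le> \<alpha> S" unfolding \<alpha>_def using \<delta> by (intro power_mono) auto
      then have "((\<delta> / 2) ^ k)\<^sup>2 \<le> (\<alpha> S)\<^sup>2" using \<delta> by (intro power_mono) auto
      then have "((\<delta> / 2) ^ k)\<^sup>2 * (q * n) / (8 * 2 ^ card F * real k ^ k)
        \<le> (\<alpha> S)\<^sup>2 * (q * n) / (8 * 2 ^ card F * real k ^ k)"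
        using q by (intro divide_right_mono mult_right_mono) auto
      then show ?thesis by (simp add: x_def)
    qed
    finally show "prob (all_edges n) p (\<lambda>\<Gamma>. card {f\<in>injections k S. image_graph F f \<subseteq> \<Gamma>} \<le> \<alpha> S / 2 * N) \<le> x" .
  qed
  also have "\<dots> = card I * x" by simp
  also have "\<dots> \<le> 2 ^ n * x"
  proof (rule mult_right_mono)
    have "card I \<le> card (Pow {..<n})" unfolding I_def by (intro card_mono) auto
    then have "real (card I) \<le> real (2 ^ n)" by (simp only: of_nat_le_iff card_Pow finite_lessThan card_lessThan)
    then show "real (card I) \<le> 2 ^ n" by simp
  qed (simp add: x_def)
  finally show ?thesis by (simp add: x_def)
qed

lemma eventually_exp_decay:
  assumes "0 < \<epsilon>" shows "\<forall>\<^sub>F n in sequentially. 2 ^ n * exp (- real n) \<le> \<epsilon>"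
proof -
  have "2 < exp (1 :: real)" using exp_lower_Taylor_quadratic[of "1::real"] by simp
  then have "(\<lambda>n. (2 / exp 1 :: real) ^ n) \<longlonglongrightarrow> 0"
    by (intro LIMSEQ_realpow_zero) (auto simp: field_simps)
  then have "\<forall>\<^sub>F n in sequentially. (2 / exp 1 :: real) ^ n < \<epsilon>" by (rule order_tendstoD(2)[OF _ assms])
  then show ?thesis
  proof eventually_elim
    case (elim n)
    have "2 ^ n * exp (- real n) = (2 / exp 1) ^ n"
      using exp_of_nat_mult[of n "1::real"] by (simp add: power_divide exp_minus divide_inverse power_inverse)
    then show ?case using elim by simp
  qed
qed

text \<open>The constant \<open>q0\<close> is taken so large that the failure probability of one set
  is at most exp(-n), which wins against 2^n because 2 < e.\<close>

lemma eventually_dense_copies: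
  fixes \<delta> \<epsilon> :: real
  assumes F: "graph_on k F" "0 < k" and t: "4 \<le> t" and pos: "0 < \<delta>" "0 < \<epsilon>"
    and rich: "\<And>n p q. 0 < n \<Longrightarrow> 1 \<le> q \<Longrightarrow> q * real n powr (- edge_exponent t) \<le> p \<Longrightarrow> rich F n p (q * n)"
  shows "\<exists>q0\<ge>1. \<forall>\<^sub>F n in sequentially. \<forall>p. q0 * real n powr (- edge_exponent t) \<le> p \<longrightarrow> in_range t n p \<longrightarrow>
    prob (all_edges n) p (\<lambda>\<Gamma>. \<not> dense_copies F k n p \<delta> \<Gamma>) \<le> \<epsilon>"
proof -
  define c where "c = ((\<delta> / 2) ^ k)\<^sup>2 / (8 * 2 ^ card F * real k ^ k)"
  have c0: "0 < c" using pos F by (simp add: c_def)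
  define q0 where "q0 = max 1 (1 / c)"
  have q0: "1 \<le> q0" "1 \<le> c * q0" using c0 by (auto simp: q0_def max_def field_simps)
  have "\<forall>\<^sub>F n in sequentially. \<forall>p. q0 * real n powr (- edge_exponent t) \<le> p \<longrightarrow> in_range t n p \<longrightarrow>
    prob (all_edges n) p (\<lambda>\<Gamma>. \<not> dense_copies F k n p \<delta> \<Gamma>) \<le> \<epsilon>"
    using eventually_exp_decay[OF pos(2)] eventually_gt_at_top[of 0] eventually_real_ge[of "2 * k / \<delta>"]
  proof eventually_elim
    case (elim n)
    show ?case
    proof (intro allI impI)
      fix p assume p: "q0 * real n powr (- edge_exponent t) \<le> p" "in_range t n p"
      have "prob (all_edges n) p (\<lambda>\<Gamma>. \<not> dense_copies F k n p \<delta> \<Gamma>)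
        \<le> 2 ^ n * exp (- ((\<delta> / 2) ^ k)\<^sup>2 * (q0 * n) / (8 * 2 ^ card F * real k ^ k))"
        using elim q0 in_range_pos[OF p(2) elim(2)] in_range_le_1[OF p(2) elim(2) t] pos
        by (intro prob_not_dense_copies[OF F] rich p(1)) (auto simp: field_simps)
      also have "- ((\<delta> / 2) ^ k)\<^sup>2 * (q0 * n) / (8 * 2 ^ card F * real k ^ k) = - (c * q0 * n)"
        by (simp add: c_def)
      also have "2 ^ n * exp (- (c * q0 * n)) \<le> 2 ^ n * exp (- real n)"
        using mult_right_mono[OF q0(2), of "real n"] by simp
      also have "\<dots> \<le> \<epsilon>" by (rule elim(1))
      finally show "prob (all_edges n) p (\<lambda>\<Gamma>. \<not> dense_copies F k n p \<delta> \<Gamma>) \<le> \<epsilon>" .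
    qed
  qed
  then show ?thesis using q0(1) by blast
qed

lemma rich_mono: "rich F n p M \<Longrightarrow> M' \<le> M \<Longrightarrow> rich F n p M'"
  unfolding rich_def by (meson order_trans)

lemma le_of_scaled_le:
  fixes q x p :: real
  assumes "1 \<le> q" "0 \<le> x" "q * x \<le> p" shows "x \<le> p"
  using mult_right_mono[OF assms(1,2)] assms(3) by simp

lemma eventually_typical:
  fixes \<delta> \<epsilon> :: real
  assumes t: "4 \<le> t" and l: "5 \<le> l" and pos: "0 < \<delta>" "0 < \<epsilon>" and L: "L = 16 / \<epsilon>"
  shows "\<exists>q0\<ge>1. \<forall>\<^sub>F n in sequentially. \<forall>p. q0 * real n powr (- edge_exponent t) \<le> p \<longrightarrow> in_range t n p \<longrightarrow>
    prob (all_edges n) p (\<lambda>\<Gamma>. \<not> typical t l n p L \<delta> \<Gamma>) \<le> \<epsilon>"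
proof -
  have L0: "0 < L" "1 / L = \<epsilon> / 16" using pos by (simp_all add: L)
  have e4: "0 < \<epsilon> / 4" using pos by simp
  \<comment> \<open>The graph whose overlaps matter, the cycle for \<open>t = 4\<close> and K_a
    otherwise. In both cases a single edge is the rarest subgraph, so the two cases can share their
    estimates.\<close>
  define F2 k2 where "F2 = (if t = 4 then cycle_graph l else complete_graph (half_up t))"
    and "k2 = (if t = 4 then l else half_up t)"
  have F2: "graph_on k2 F2" "0 < k2"
    using graph_on_complete[of "half_up t"] graph_on_cycle[of l] half_up[OF t] l by (auto simp: F2_def k2_def)
  have rich_e: "rich F2 n p ((real n)\<^sup>2 * p)" if n: "0 < n" and p: "real n powr (- edge_exponent t) \<le> p" for n p
    using rich_edge_cycle[of l n p] rich_edge_complete[OF t half_up(2)[OF t] n p] that l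
    by (auto simp: F2_def)
  have rich_2: "rich F2 n p (q * n)" if n: "0 < n" and q: "1 \<le> q" and p: "q * real n powr (- edge_exponent t) \<le> p" for n p q
  proof (rule rich_mono)
    show "rich F2 n p ((real n)\<^sup>2 * p)" by (rule rich_e[OF n le_of_scaled_le[OF q _ p]]) simp
    show "q * real n \<le> (real n)\<^sup>2 * p" using t q by (intro edges_ge[OF _ n p]) auto
  qed
  have rich_1: "rich (complete_graph (t - 1)) n p (q * n)"
    if "0 < n" "1 \<le> q" "q * real n powr (- edge_exponent t) \<le> p" for n p q
    using rich_complete[OF _ _ that, of "t - 1"] t by simp
  obtain q1 where q1: "1 \<le> q1" "\<forall>\<^sub>F n in sequentially. \<forall>p. q1 * real n powr (- edge_exponent t) \<le> p \<longrightarrow> in_range t n p \<longrightarrow>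
    prob (all_edges n) p (\<lambda>\<Gamma>. \<not> dense_copies (complete_graph (t - 1)) (t - 1) n p \<delta> \<Gamma>) \<le> \<epsilon> / 4"
    using eventually_dense_copies[OF graph_on_complete _ t pos(1) e4 rich_1] t by auto
  obtain q2 where q2: "1 \<le> q2" "\<forall>\<^sub>F n in sequentially. \<forall>p. q2 * real n powr (- edge_exponent t) \<le> p \<longrightarrow> in_range t n p \<longrightarrow>
    prob (all_edges n) p (\<lambda>\<Gamma>. \<not> dense_copies F2 k2 n p \<delta> \<Gamma>) \<le> \<epsilon> / 4"
    using eventually_dense_copies[OF F2 t pos(1) e4 rich_2] by auto
  define q0 where "q0 = max q1 q2"
  have q0: "1 \<le> q0" "q1 \<le> q0" "q2 \<le> q0" using q1 q2 by (auto simp: q0_def)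
  have "\<forall>\<^sub>F n in sequentially. \<forall>p. q0 * real n powr (- edge_exponent t) \<le> p \<longrightarrow> in_range t n p \<longrightarrow>
    prob (all_edges n) p (\<lambda>\<Gamma>. \<not> typical t l n p L \<delta> \<Gamma>) \<le> \<epsilon>"
    using q1(2) q2(2) eventually_gt_at_top[of 0]
  proof eventually_elim
    case (elim n)
    show ?case
    proof (intro allI impI)
      fix p assume p: "q0 * real n powr (- edge_exponent t) \<le> p" "in_range t n p"
      have p0: "0 < p" by (rule in_range_pos[OF p(2) elim(3)])
      have p1: "p \<le> 1" by (rule in_range_le_1[OF p(2) elim(3) t])
      have pp: "0 \<le> p" using p0 by simp
      let ?P = "prob (all_edges n) p"
      have ge: "q1 * real n powr (- edge_exponent t) \<le> p" "q2 * real n powr (- edge_exponent t) \<le> p"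
        using p(1) mult_right_mono[OF q0(2), of "real n powr (- edge_exponent t)"]
          mult_right_mono[OF q0(3), of "real n powr (- edge_exponent t)"] by auto
      have d1: "?P (\<lambda>\<Gamma>. \<not> dense_copies (complete_graph (t - 1)) (t - 1) n p \<delta> \<Gamma>) \<le> \<epsilon> / 4"
        using elim(1) ge(1) p(2) by blast
      have d2: "?P (\<lambda>\<Gamma>. \<not> dense_copies F2 k2 n p \<delta> \<Gamma>) \<le> \<epsilon> / 4"
        using elim(2) ge(2) p(2) by blast
      have cu: "?P (\<lambda>\<Gamma>. \<not> count_upper F k n p L \<Gamma>) \<le> \<epsilon> / 16" if "graph_on k F" for F k
        using prob_not_count_upper[OF that p0 p1 L0(1) elim(3)] L0(2) by simp
      have fo: "?P (\<lambda>\<Gamma>. \<not> few_overlaps F2 k2 n p (overlap_const F2 k2 L) \<Gamma>) \<le> \<epsilon> / 16"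
        using prob_not_few_overlaps[OF F2 p0 p1 L0(1) elim(3) rich_e] p(2) elim(3) L0(2)
        by (simp add: in_range_def)
      note conj = prob_not_conj_le[OF pp p1]
      \<comment> \<open>Two terms \<epsilon>/4 and seven terms \<epsilon>/16 add up to 15
        \<epsilon>/16.\<close>
      have "?P (\<lambda>\<Gamma>. \<not> (count_upper (complete_graph (half_up t)) (half_up t) n p L \<Gamma> \<and>
          count_upper (complete_graph (t - 1)) (t - 1) n p L \<Gamma> \<and>
          dense_copies (complete_graph (t - 1)) (t - 1) n p \<delta> \<Gamma> \<and>
          dense_copies F2 k2 n p \<delta> \<Gamma> \<and> few_overlaps F2 k2 n p (overlap_const F2 k2 L) \<Gamma> \<and>
          count_upper (cycle_graph 4) 4 n p L \<Gamma> \<and> count_upper path3 3 n p L \<Gamma> \<and>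
          count_upper (complete_graph 2) 2 n p L \<Gamma> \<and>
          count_upper (codegree_graph (3 * (t - 1))) (3 * (t - 1) + 2) n p L \<Gamma>))
        \<le> \<epsilon> / 16 + (\<epsilon> / 16 + (\<epsilon> / 4 + (\<epsilon> / 4 + (\<epsilon> / 16 + (\<epsilon> / 16 + (\<epsilon> / 16 + (\<epsilon> / 16 + \<epsilon> / 16)))))))"
        by (intro conj cu d1 d2 fo graph_on_complete graph_on_cycle graph_on_path3 graph_on_codegree) simp
      note le = this
      show "?P (\<lambda>\<Gamma>. \<not> typical t l n p L \<delta> \<Gamma>) \<le> \<epsilon>"
        by (rule order_trans[OF order_trans[OF prob_mono[OF pp p1] le]])
          (use pos in \<open>auto simp: typical_def F2_def k2_def split: if_splits\<close>)
    qed
  qed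
  then show ?thesis using q0(1) by blast
qed

text \<open>Purely deterministic, so the family is fixed before the random edges appear.
  \<open>A1\<close> and \<open>B1\<close> may intersect; later arguments need only the degrees, and
  distinctness of vertices is secured where cycles and cliques are built.\<close>

lemma exists_good_tuples:
  fixes d c :: real
  assumes G: "G \<subseteq> all_edges n" "d \<le> density n G" and d: "0 < d" and c: "c = d / 8"
    and n: "2 \<le> n" "2 * t \<le> c * n"
  obtains A1 B1 \<F> where "A1 \<subseteq> {..<n}" "B1 \<subseteq> {..<n}"
    "\<And>x. x \<in> A1 \<Longrightarrow> c * n \<le> card {y \<in> B1. {x, y} \<in> G}"
    "\<And>y. y \<in> B1 \<Longrightarrow> c * n \<le> card {x \<in> A1. {x, y} \<in> G}"
    "\<F> \<subseteq> injections t A1" "(c / 2) ^ t / 2 * real n ^ t \<le> card \<F>"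
    "\<And>f. f \<in> \<F> \<Longrightarrow> c * (c / 2) ^ t / 2 * n \<le> card {y \<in> B1. \<forall>i<t. {f i, y} \<in> G}"
proof -
  have c0: "0 < c" using d c by simp
  define V where "V = {..<n}"
  have fV: "finite V" and cV: "card V = n" by (simp_all add: V_def)
  have finG: "finite G" using G(1) finite_subset finite_all_edges by metis
  have chs: "real (n choose 2) = real n * (real n - 1) / 2" by (rule real_choose_2)
  have "0 < real (n choose 2)" using n by (simp add: chs)
  then have "d * (real n * (real n - 1) / 2) \<le> card G"
    using G(2) unfolding density_def chs by (simp add: field_simps)
  moreover have "real n / 2 \<le> real n - 1" using n by simp
  then have "d * (real n * (real n / 2) / 2) \<le> d * (real n * (real n - 1) / 2)"
    using d by (intro mult_left_mono divide_right_mono) auto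
  ultimately have "d * (real n)\<^sup>2 / 4 \<le> card G" by (simp add: power2_eq_square)
  moreover have "c * n * (card V + card V) < d * (real n)\<^sup>2 / 2 + 0"
    using d n by (simp add: c cV power2_eq_square)
  moreover have "2 * card G \<le> card {(x, y) \<in> V \<times> V. {x, y} \<in> G}"
  proof -
    let ?A = "{(x, y) \<in> V \<times> V. {x, y} \<in> G \<and> x < y}" and ?B = "{(x, y) \<in> V \<times> V. {x, y} \<in> G \<and> y < x}"
    have fin: "finite ?A" "finite ?B" by (rule finite_subset[of _ "V \<times> V"]; auto simp: fV)+
    have GA: "G \<subseteq> (\<lambda>(x, y). {x, y}) ` ?A" and GB: "G \<subseteq> (\<lambda>(x, y). {x, y}) ` ?B"
    proof -
      have "e \<in> (\<lambda>(x, y). {x, y}) ` ?A \<and> e \<in> (\<lambda>(x, y). {x, y}) ` ?B" if e: "e \<in> G" for e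
      proof -
        have "e \<subseteq> {..<n}" "card e = 2" using e G(1) all_edges_iff[of e n] by blast+
        then obtain x y where xy: "e = {x, y}" "x < y" "x \<in> V" "y \<in> V"
          unfolding card_2_iff V_def by (metis insert_commute insert_subset linorder_less_linear)
        then have "(x, y) \<in> ?A" "(y, x) \<in> ?B" using e by (auto simp: insert_commute)
        moreover have "e = (\<lambda>(x, y). {x, y}) (x, y)" "e = (\<lambda>(x, y). {x, y}) (y, x)" using xy by auto
        ultimately show ?thesis by blast
      qed
      then show "G \<subseteq> (\<lambda>(x, y). {x, y}) ` ?A" "G \<subseteq> (\<lambda>(x, y). {x, y}) ` ?B" by blast+
    qed
    have "card G \<le> card ?A" "card G \<le> card ?B"
      using surj_card_le[OF fin(1) GA] surj_card_le[OF fin(2) GB] by auto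
    moreover have "card (?A \<union> ?B) = card ?A + card ?B" by (rule card_Un_disjoint[OF fin]) auto
    moreover have "card (?A \<union> ?B) \<le> card {(x, y) \<in> V \<times> V. {x, y} \<in> G}"
      by (intro card_mono) (auto simp: fV intro: finite_subset[of _ "V \<times> V"])
    ultimately show ?thesis by linarith
  qed
  ultimately have ed: "c * n * (card V + card V) < card {(x, y) \<in> V \<times> V. {x, y} \<in> G}" by linarith
  have cn0: "0 \<le> c * n" using c0 by simp
  obtain A1 B1 where AB: "A1 \<subseteq> V" "B1 \<subseteq> V" "A1 \<noteq> {}" "B1 \<noteq> {}"
    "\<And>x. x \<in> A1 \<Longrightarrow> c * n \<le> card {y \<in> B1. {x, y} \<in> G}"
    "\<And>y. y \<in> B1 \<Longrightarrow> c * n \<le> card {x \<in> A1. {x, y} \<in> G}"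
    by (rule bipartite_core[OF fV fV cn0 ed]) blast
  have fin: "finite A1" "finite B1" using finite_subset[OF AB(1) fV] finite_subset[OF AB(2) fV] by simp_all
  obtain x where x: "x \<in> A1" using AB(3) by blast
  have "card {y \<in> B1. {x, y} \<in> G} \<le> card B1" using fin by (intro card_mono) auto
  then have cB: "c * n \<le> card B1" using AB(5)[OF x] by linarith
  \<comment> \<open>With this cutoff the bad tuples are at most
    \<open>(c / 2) ^ t / 2 * n ^ t\<close>, half of the lower bound for the injections into
    \<open>S\<close>.\<close>
  define s where "s = c * (c / 2) ^ t / 2 * n"
  have s0: "0 \<le> s" using c0 by (simp add: s_def)
  define C where "C = injections t {..<n}"
  have finC: "finite C" by (simp add: C_def)
  obtain w where w: "w \<in> B1"
    "card B1 * card {f \<in> C. (\<forall>i<t. {f i, w} \<in> G) \<and> card {w' \<in> B1. \<forall>i<t. {f i, w'} \<in> G} < s} \<le> s * card C"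
    by (rule dependent_choice[OF fin(2) finC subset_refl AB(4) s0, of "\<lambda>w f. \<forall>i<t. {f i, w} \<in> G"]) blast
  define bad where "bad = {f \<in> C. (\<forall>i<t. {f i, w} \<in> G) \<and> card {w' \<in> B1. \<forall>i<t. {f i, w'} \<in> G} < s}"
  have finbad: "finite bad" using finC by (simp add: bad_def)
  define S where "S = {x \<in> A1. {x, w} \<in> G}"
  have S: "S \<subseteq> A1" "finite S" "c * n \<le> card S" using fin AB(6)[OF w(1)] by (auto simp: S_def)
  have SV: "S \<subseteq> {..<n}" using S(1) AB(1) by (auto simp: V_def)
  have "c * n * card bad \<le> real (card B1) * card bad" using cB by (intro mult_right_mono) auto
  also have "\<dots> \<le> s * card C" using w(2) unfolding bad_def by simp
  also have "\<dots> \<le> s * real n ^ t"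
  proof (rule mult_left_mono[OF _ s0])
    have "card C \<le> n ^ t" using card_injections_le[of "{..<n}" t] by (simp add: C_def)
    then show "real (card C) \<le> real n ^ t" by (metis of_nat_le_iff of_nat_power)
  qed
  also have "\<dots> = c * n * ((c / 2) ^ t / 2 * real n ^ t)" by (simp add: s_def)
  finally have "c * n * card bad \<le> c * n * ((c / 2) ^ t / 2 * real n ^ t)" .
  then have bad: "card bad \<le> (c / 2) ^ t / 2 * real n ^ t" using c0 n by simp
  have "(c / 2) ^ t * real n ^ t = (c * n / 2) ^ t" by (simp add: power_mult_distrib power_divide)
  also have "\<dots> \<le> (card S / 2) ^ t" using S(3) c0 by (intro power_mono divide_right_mono) auto
  also have "\<dots> \<le> card (injections t S)"
    using S(3) n(2) by (intro card_injections_ge[OF S(2)]) linarith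
  finally have inj: "(c / 2) ^ t * real n ^ t \<le> card (injections t S)" .
  show thesis
  proof (rule that[of A1 B1 "injections t S - bad"])
    show "A1 \<subseteq> {..<n}" "B1 \<subseteq> {..<n}" using AB(1,2) by (simp_all add: V_def)
    show "c * n \<le> card {y \<in> B1. {x, y} \<in> G}" if "x \<in> A1" for x by (rule AB(5)[OF that])
    show "c * n \<le> card {x \<in> A1. {x, y} \<in> G}" if "y \<in> B1" for y by (rule AB(6)[OF that])
    show "injections t S - bad \<subseteq> injections t A1" using injections_mono[OF S(1)] by blast
    have "real (card (injections t S)) - card bad \<le> card (injections t S - bad)"
      using S(2) finbad by (intro card_minus_le) auto
    then show "(c / 2) ^ t / 2 * real n ^ t \<le> card (injections t S - bad)"
      using inj bad by linarith
    fix f assume f: "f \<in> injections t S - bad"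
    have "f i \<in> S" if "i < t" for i using f that by (auto simp: injections_def)
    moreover have "f \<in> C" using f injections_mono[OF SV] by (auto simp: C_def)
    ultimately show "c * (c / 2) ^ t / 2 * n \<le> card {y \<in> B1. \<forall>i<t. {f i, y} \<in> G}"
      using f unfolding bad_def s_def S_def by (auto simp: not_less)
  qed
qed

section \<open>Probability and monotonicity of the Ramsey property\<close>

lemma union_prob_eq_prob: "union_prob n p G P = prob (all_edges n) p (\<lambda>S. P (G \<union> S))"
proof -
  have "{S. S \<subseteq> all_edges n \<and> P (G \<union> S)} = {S \<in> Pow (all_edges n). P (G \<union> S)}" by auto
  then show ?thesis
    unfolding union_prob_def prob_def expect_def
    by (simp add: sum.inter_filter[symmetric] if_distrib of_bool_def mult.commute cong: if_cong)
qed

lemma is_ramsey_mono: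
  assumes "is_ramsey G H1 k1 H2 k2" "G \<subseteq> G'" shows "is_ramsey G' H1 k1 H2 k2"
  unfolding is_ramsey_def
proof (intro allI impI)
  fix R assume "R \<subseteq> G'"
  have "has_copy H1 k1 (R \<inter> G) \<or> has_copy H2 k2 (G - R \<inter> G)" using assms(1) unfolding is_ramsey_def by blast
  moreover have "G - R \<inter> G \<subseteq> G' - R" using assms(2) by blast
  ultimately show "has_copy H1 k1 R \<or> has_copy H2 k2 (G' - R)"
    using has_copy_mono by (metis inf_le1)
qed

lemma union_prob_ramsey_mono:
  assumes "0 \<le> p" "p \<le> q" "q \<le> 1"
  shows "union_prob n p G (\<lambda>F. is_ramsey F H1 k1 H2 k2) \<le> union_prob n q G (\<lambda>F. is_ramsey F H1 k1 H2 k2)"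
  unfolding union_prob_eq_prob prob_def
proof (rule expect_mono_prob[OF finite_all_edges assms])
  fix S T :: "nat set set" assume "S \<subseteq> T"
  then have "G \<union> S \<subseteq> G \<union> T" by blast
  then show "(of_bool (is_ramsey (G \<union> S) H1 k1 H2 k2) :: real) \<le> of_bool (is_ramsey (G \<union> T) H1 k1 H2 k2)"
    using is_ramsey_mono by auto
qed

subsection \<open>The threshold\<close>

text \<open>The richness of K_t is only the constant \<open>q0\<close>, so its appearance among the
  good tuples fails with a small constant probability; hence \<open>q0\<close> depends on
  \<open>\<epsilon>\<close>, and \<open>\<epsilon>\<close> tends to 0 only in
  \<open>above_threshold\<close>.\<close>

lemma eventually_union_prob_ge:
  fixes d \<epsilon> :: real
  assumes t: "4 \<le> t" and l: "odd l" "5 \<le> l" and d: "0 < d" and \<epsilon>: "0 < \<epsilon>"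
  shows "\<exists>q0\<ge>1. \<forall>\<^sub>F n in sequentially. \<forall>p G. q0 * real n powr (- edge_exponent t) \<le> p \<longrightarrow>
    in_range t n p \<longrightarrow> G \<subseteq> all_edges n \<longrightarrow> d \<le> density n G \<longrightarrow>
    1 - \<epsilon> \<le> union_prob n p G (\<lambda>F. is_ramsey F (complete_graph t) t (cycle_graph l) l)"
proof -
  define c where "c = d / 8"
  have c0: "0 < c" using d by (simp add: c_def)
  define e where "e = c * (c / 2) ^ t / 2"
  have e0: "0 < e" using c0 by (simp add: e_def)
  define \<alpha> where "\<alpha> = (c / 2) ^ t / 2"
  have \<alpha>0: "0 < \<alpha>" using c0 by (simp add: \<alpha>_def)
  define L where "L = 16 / (\<epsilon> / 2)"
  have L0: "0 < L" using \<epsilon> by (simp add: L_def)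
  obtain \<delta> where \<delta>: "0 < \<delta>" and det: "\<forall>\<^sub>F n in sequentially. typical_forces_ramsey t l L \<delta> c e n"
    using typical_imp_ramsey[OF t l c0 e0 L0] by blast
  have \<epsilon>2: "0 < \<epsilon> / 2" using \<epsilon> by simp
  obtain q1 where q1: "1 \<le> q1" and typ1: "\<forall>\<^sub>F n in sequentially. \<forall>p. q1 * real n powr (- edge_exponent t) \<le> p \<longrightarrow>
    in_range t n p \<longrightarrow> prob (all_edges n) p (\<lambda>\<Gamma>. \<not> typical t l n p L \<delta> \<Gamma>) \<le> \<epsilon> / 2"
    using eventually_typical[OF t l(2) \<delta> \<epsilon>2 L_def] by blast
  define K where "K = 8 * 2 ^ card (complete_graph t) * real t ^ t"
  have K0: "0 < K" using t by (simp add: K_def)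
  define q0 where "q0 = max q1 (K * ln (2 / \<epsilon>) / \<alpha>\<^sup>2)"
  have q0: "1 \<le> q0" "q1 \<le> q0" using q1 by (auto simp: q0_def)
  have "K * ln (2 / \<epsilon>) / \<alpha>\<^sup>2 \<le> q0" by (simp add: q0_def)
  then have "ln (2 / \<epsilon>) \<le> \<alpha>\<^sup>2 * q0 / K" using K0 \<alpha>0 by (simp add: field_simps)
  then have "exp (- (\<alpha>\<^sup>2 * q0 / K)) \<le> exp (- ln (2 / \<epsilon>))" by simp
  also have "\<dots> = \<epsilon> / 2" using \<epsilon> by (simp add: exp_minus)
  finally have tail: "exp (- \<alpha>\<^sup>2 * q0 / K) \<le> \<epsilon> / 2" by simp
  have "\<forall>\<^sub>F n in sequentially. \<forall>p G. q0 * real n powr (- edge_exponent t) \<le> p \<longrightarrow>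
    in_range t n p \<longrightarrow> G \<subseteq> all_edges n \<longrightarrow> d \<le> density n G \<longrightarrow>
    1 - \<epsilon> \<le> union_prob n p G (\<lambda>F. is_ramsey F (complete_graph t) t (cycle_graph l) l)"
    using det typ1 eventually_ge_at_top[of 2] eventually_real_ge[of "2 * t / c"]
  proof eventually_elim
    case (elim n)
    have n0: "0 < n" using elim(3) by simp
    have nt: "2 * real t \<le> c * n" using elim(4) c0 by (simp add: field_simps)
    show ?case
    proof (intro allI impI)
      fix p G
      assume p: "q0 * real n powr (- edge_exponent t) \<le> p" "in_range t n p"
        and G: "G \<subseteq> all_edges n" "d \<le> density n G"
      have p0: "0 < p" by (rule in_range_pos[OF p(2) n0])
      have p1: "p \<le> 1" by (rule in_range_le_1[OF p(2) n0 t])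
      have pp: "0 \<le> p" using p0 by simp
      have ge: "q1 * real n powr (- edge_exponent t) \<le> p"
        using p(1) mult_right_mono[OF q0(2), of "real n powr (- edge_exponent t)"] by auto
      obtain A1 B1 \<F> where AB: "A1 \<subseteq> {..<n}" "B1 \<subseteq> {..<n}"
        "\<And>x. x \<in> A1 \<Longrightarrow> c * n \<le> card {y \<in> B1. {x, y} \<in> G}"
        "\<And>y. y \<in> B1 \<Longrightarrow> c * n \<le> card {x \<in> A1. {x, y} \<in> G}"
        "\<F> \<subseteq> injections t A1" "(c / 2) ^ t / 2 * real n ^ t \<le> card \<F>"
        "\<And>f. f \<in> \<F> \<Longrightarrow> c * (c / 2) ^ t / 2 * n \<le> card {y \<in> B1. \<forall>i<t. {f i, y} \<in> G}"
        by (rule exists_good_tuples[OF G d c_def elim(3) nt]) blast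
      have \<F>: "\<F> \<subseteq> injections t {..<n}" using AB(5) injections_mono[OF AB(1)] by blast
      have rich: "rich (complete_graph t) n p q0"
        using rich_complete[OF _ order_refl n0 q0(1) p(1)] t by simp
      define hit where "hit \<Gamma> \<longleftrightarrow> (\<exists>f\<in>\<F>. image_graph (complete_graph t) f \<subseteq> \<Gamma>)" for \<Gamma>
      have "prob (all_edges n) p (\<lambda>\<Gamma>. \<not> hit \<Gamma>)
        \<le> prob (all_edges n) p (\<lambda>\<Gamma>. card {f\<in>\<F>. image_graph (complete_graph t) f \<subseteq> \<Gamma>}
            \<le> \<alpha> / 2 * mean_copies (complete_graph t) t n p)"
      proof (rule prob_mono[OF pp p1])
        fix \<Gamma> assume "\<not> hit \<Gamma>"
        then have none: "{f\<in>\<F>. image_graph (complete_graph t) f \<subseteq> \<Gamma>} = {}" by (auto simp: hit_def)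
        have "0 \<le> \<alpha> / 2 * mean_copies (complete_graph t) t n p" using \<alpha>0 pp by simp
        then show "card {f\<in>\<F>. image_graph (complete_graph t) f \<subseteq> \<Gamma>}
            \<le> \<alpha> / 2 * mean_copies (complete_graph t) t n p" unfolding none by simp
      qed
      also have "\<dots> \<le> exp (- \<alpha>\<^sup>2 * q0 / (8 * 2 ^ card (complete_graph t) * real t ^ t))"
        by (rule lower_tail[OF graph_on_complete _ p0 p1 _ rich \<F> n0])
          (use t q0(1) \<alpha>0 AB(6) in \<open>auto simp: \<alpha>_def\<close>)
      also have "\<dots> \<le> \<epsilon> / 2" using tail by (simp add: K_def)
      finally have h: "prob (all_edges n) p (\<lambda>\<Gamma>. \<not> hit \<Gamma>) \<le> \<epsilon> / 2" .
      have ty: "prob (all_edges n) p (\<lambda>\<Gamma>. \<not> typical t l n p L \<delta> \<Gamma>) \<le> \<epsilon> / 2"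
        using elim(2) ge p(2) by blast
      have "prob (all_edges n) p (\<lambda>\<Gamma>. \<not> (hit \<Gamma> \<and> typical t l n p L \<delta> \<Gamma>)) \<le> \<epsilon> / 2 + \<epsilon> / 2"
        by (rule prob_not_conj_le[OF pp p1 h ty])
      then have "1 - \<epsilon> \<le> prob (all_edges n) p (\<lambda>\<Gamma>. hit \<Gamma> \<and> typical t l n p L \<delta> \<Gamma>)"
        unfolding prob_not[OF finite_all_edges] by simp
      also have "\<dots> \<le> prob (all_edges n) p (\<lambda>\<Gamma>. is_ramsey (G \<union> \<Gamma>) (complete_graph t) t (cycle_graph l) l)"
      proof (rule prob_mono[OF pp p1])
        fix \<Gamma> assume \<Gamma>: "\<Gamma> \<subseteq> all_edges n" "hit \<Gamma> \<and> typical t l n p L \<delta> \<Gamma>"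
        then obtain f where f: "f \<in> \<F>" "image_graph (complete_graph t) f \<subseteq> \<Gamma>" by (auto simp: hit_def)
        have fc: "f \<in> copies (complete_graph t) t A1 \<Gamma>" using f AB(5) by (auto simp: copies_def)
        have fe: "e * n \<le> card {y \<in> B1. \<forall>i<t. {f i, y} \<in> G}" using AB(7)[OF f(1)] by (simp add: e_def)
        show "is_ramsey (G \<union> \<Gamma>) (complete_graph t) t (cycle_graph l) l"
          unfolding is_ramsey_def
        proof (intro allI impI)
          fix R assume R: "R \<subseteq> G \<union> \<Gamma>"
          show "has_copy (complete_graph t) t R \<or> has_copy (cycle_graph l) l (G \<union> \<Gamma> - R)"
            by (rule elim(1)[rule_format, OF p(2) G(1) \<Gamma>(1) conjunct2[OF \<Gamma>(2)] AB(1,2) AB(3) AB(4) fc fe R])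
        qed
      qed
      finally show "1 - \<epsilon> \<le> union_prob n p G (\<lambda>F. is_ramsey F (complete_graph t) t (cycle_graph l) l)"
        unfolding union_prob_eq_prob .
    qed
  qed
  then show ?thesis using q0(1) by blast
qed

lemma union_prob_le_1:
  assumes "0 \<le> p" "p \<le> 1" shows "union_prob n p G P \<le> 1"
proof -
  have "prob (all_edges n) p (\<lambda>S. P (G \<union> S)) \<le> prob (all_edges n) p (\<lambda>_. True)"
    by (rule prob_mono[OF assms]) simp
  then show ?thesis by (simp add: union_prob_eq_prob prob_def)
qed

lemma tendsto_1I:
  fixes f :: "nat \<Rightarrow> real"
  assumes "\<And>n. f n \<le> 1" "\<And>\<epsilon>. 0 < \<epsilon> \<Longrightarrow> \<forall>\<^sub>F n in sequentially. 1 - \<epsilon> \<le> f n"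
  shows "f \<longlonglongrightarrow> 1"
proof (rule order_tendstoI)
  fix a :: real assume "a < 1"
  then have "\<forall>\<^sub>F n in sequentially. 1 - (1 - a) / 2 \<le> f n" by (intro assms(2)) simp
  then show "\<forall>\<^sub>F n in sequentially. a < f n"
  proof eventually_elim
    case (elim n)
    have "a < 1 - (1 - a) / 2" using \<open>a < 1\<close> by (simp add: field_simps)
    then show ?case using elim by linarith
  qed
next
  fix a :: real assume a: "1 < a"
  have "f n < a" for n using assms(1)[of n] a by linarith
  then show "\<forall>\<^sub>F n in sequentially. f n < a" by simp
qed

lemma above_threshold:
  fixes p :: "nat \<Rightarrow> real"
  assumes t: "4 \<le> t" and l: "odd l" "5 \<le> l" and d: "0 < d"
    and p: "\<And>n. 0 \<le> p n \<and> p n \<le> 1" "p \<in> \<omega>(\<lambda>n. real n powr (- edge_exponent t))"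
    and G: "\<And>n. G n \<subseteq> all_edges n" "\<forall>\<^sub>F n in sequentially. d \<le> density n (G n)"
  shows "(\<lambda>n. union_prob n (p n) (G n) (\<lambda>F. is_ramsey F (complete_graph t) t (cycle_graph l) l)) \<longlonglongrightarrow> 1"
proof (rule tendsto_1I)
  show "union_prob n (p n) (G n) (\<lambda>F. is_ramsey F (complete_graph t) t (cycle_graph l) l) \<le> 1" for n
    using p(1) by (intro union_prob_le_1) auto
  fix \<epsilon> :: real assume \<epsilon>: "0 < \<epsilon>"
  obtain q0 where q0: "1 \<le> q0" and ev: "\<forall>\<^sub>F n in sequentially. \<forall>p G. q0 * real n powr (- edge_exponent t) \<le> p \<longrightarrow>
    in_range t n p \<longrightarrow> G \<subseteq> all_edges n \<longrightarrow> d \<le> density n G \<longrightarrow>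
    1 - \<epsilon> \<le> union_prob n p G (\<lambda>F. is_ramsey F (complete_graph t) t (cycle_graph l) l)"
    using eventually_union_prob_ge[OF t l d \<epsilon>] by blast
  have "\<forall>\<^sub>F n in sequentially. q0 * norm (real n powr (- edge_exponent t)) \<le> norm (p n)"
    using landau_omega.smallD[OF p(2), of q0] q0 by simp
  moreover have "\<forall>\<^sub>F n in sequentially. q0 \<le> real n powr (edge_exponent t / 2)"
    using t by (intro eventually_powr_ge) (simp add: edge_exponent_def)
  ultimately show "\<forall>\<^sub>F n in sequentially.
      1 - \<epsilon> \<le> union_prob n (p n) (G n) (\<lambda>F. is_ramsey F (complete_graph t) t (cycle_graph l) l)"
    using ev G(2) eventually_gt_at_top[of 0]
  proof eventually_elim
    case (elim n)
    \<comment> \<open>Truncation to \<open>in_range\<close>; the lower bound by \<open>q0\<close>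
      survives because q0 <= n^(\<open>edge_exponent t\<close> / 2) eventually.\<close>
    define p' where "p' = min (p n) (real n powr (- edge_exponent t / 2))"
    have big: "q0 * real n powr (- edge_exponent t) \<le> p n" using elim(1) p(1)[of n] by simp
    have "q0 * real n powr (- edge_exponent t)
        \<le> real n powr (edge_exponent t / 2) * real n powr (- edge_exponent t)"
      using elim(2) by (intro mult_right_mono) auto
    also have "\<dots> = real n powr (- edge_exponent t / 2)"
      unfolding powr_add[symmetric] by simp
    finally have ge: "q0 * real n powr (- edge_exponent t) \<le> p'" using big by (simp add: p'_def)
    have "real n powr (- edge_exponent t) \<le> p'" by (rule le_of_scaled_le[OF q0 _ ge]) simp
    then have range: "in_range t n p'" by (simp add: in_range_def p'_def)
    have "1 - \<epsilon> \<le> union_prob n p' (G n) (\<lambda>F. is_ramsey F (complete_graph t) t (cycle_graph l) l)"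
      using elim(3) ge range G(1) elim(4) by blast
    also have "\<dots> \<le> union_prob n (p n) (G n) (\<lambda>F. is_ramsey F (complete_graph t) t (cycle_graph l) l)"
      using in_range_pos[OF range elim(5)] p(1)[of n] by (intro union_prob_ramsey_mono) (auto simp: p'_def)
    finally show ?case .
  qed
qed

section \<open>The lower bound from a bipartite host graph\<close>

definition balanced_bipartite :: "nat \<Rightarrow> nat set set" where
  "balanced_bipartite n = (\<lambda>(u, v). {u, v}) ` ({..<n div 2} \<times> {n div 2..<n})"

lemma balanced_bipartite_subset: "balanced_bipartite n \<subseteq> all_edges n"
  unfolding balanced_bipartite_def by (auto simp: all_edges_iff card_insert_if)

lemma card_balanced_bipartite: "card (balanced_bipartite n) = (n div 2) * (n - n div 2)"
proof -
  have "inj_on (\<lambda>(u, v). {u, v}) ({..<n div 2} \<times> {n div 2..<n})"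
    by (auto simp: inj_on_def doubleton_eq_iff)
  then show ?thesis unfolding balanced_bipartite_def by (simp add: card_image card_cartesian_product)
qed

lemma density_balanced_bipartite:
  assumes "2 \<le> n" shows "1 / 2 \<le> density n (balanced_bipartite n)"
proof -
  have "n * (n - 1) \<le> 4 * ((n div 2) * (n - n div 2))"
  proof (cases "even n")
    case True
    then obtain h where "n = 2 * h" by blast
    then show ?thesis by (simp add: algebra_simps)
  next
    case False
    then obtain h where "n = 2 * h + 1" by (rule oddE)
    then show ?thesis by (simp add: algebra_simps)
  qed
  then have "real (n * (n - 1)) \<le> real (4 * ((n div 2) * (n - n div 2)))" by (rule of_nat_mono)
  then have "real n * (real n - 1) \<le> 4 * real (card (balanced_bipartite n))"
    using assms unfolding card_balanced_bipartite by (simp add: of_nat_diff)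
  moreover have "0 < real n * (real n - 1)" using assms by simp
  ultimately show ?thesis unfolding density_def real_choose_2 by (simp add: field_simps)
qed

lemma balanced_bipartite_crossing:
  "{x, y} \<in> balanced_bipartite n \<Longrightarrow> x < n div 2 \<longleftrightarrow> \<not> y < n div 2"
  unfolding balanced_bipartite_def by (auto simp: doubleton_eq_iff)

lemma no_odd_cycle_balanced_bipartite:
  assumes l: "odd l" shows "\<not> has_copy (cycle_graph l) l (balanced_bipartite n)"
proof
  assume "has_copy (cycle_graph l) l (balanced_bipartite n)"
  then obtain f where f: "\<And>e. e \<in> cycle_graph l \<Longrightarrow> f ` e \<in> balanced_bipartite n"
    unfolding has_copy_def by blast
  have l0: "0 < l" using l by (cases l) auto
  have step: "f i < n div 2 \<longleftrightarrow> \<not> f ((i + 1) mod l) < n div 2" if "i < l" for i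
  proof -
    have "{i, (i + 1) mod l} \<in> cycle_graph l" using that by (auto simp: cycle_graph_def)
    from f[OF this] show ?thesis by (intro balanced_bipartite_crossing[of _ _ n]) simp
  qed
  have alt: "f i < n div 2 \<longleftrightarrow> (even i \<longleftrightarrow> f 0 < n div 2)" if "i < l" for i
    using that
  proof (induction i)
    case (Suc i)
    then show ?case using step[of i] by auto
  qed simp
  have "(l - 1 + 1) mod l = 0" using l0 by simp
  then have "f (l - 1) < n div 2 \<longleftrightarrow> \<not> f 0 < n div 2" using step[of "l - 1"] l0 by simp
  moreover have "f (l - 1) < n div 2 \<longleftrightarrow> f 0 < n div 2" using alt[of "l - 1"] l l0 by simp
  ultimately show False by blast
qed

text \<open>\<open>has_copy\<close> does not confine the embedding to \<open>{..<n}\<close>. Since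
  every vertex of \<open>F\<close> lies on an edge, its image lies on an edge of
  \<open>\<Gamma>\<close> and is therefore below \<open>n\<close>.\<close>

lemma has_copy_imp_copies:
  assumes "graph_on k F" "has_copy F k \<Gamma>" "\<Gamma> \<subseteq> all_edges n" "F \<noteq> {}" "\<Union>F = {..<k}"
  shows "copies F k {..<n} \<Gamma> \<noteq> {}"
proof -
  obtain f where f: "inj_on f {0..<k}" "\<And>e. e \<in> F \<Longrightarrow> f ` e \<in> \<Gamma>"
    using assms(2) unfolding has_copy_def by blast
  let ?f = "restrict f {..<k}"
  have img: "?f ` e = f ` e" if "e \<in> F" for e
    using assms(1) that unfolding graph_on_def by (intro image_cong) auto
  have "f i < n" if i: "i < k" for i
  proof -
    obtain e where e: "e \<in> F" "i \<in> e" using assms(5) i by blast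
    then have "f ` e \<in> all_edges n" using f(2) assms(3) by blast
    then show ?thesis using e(2) by (auto simp: all_edges_iff)
  qed
  then have "?f \<in> injections k {..<n}" using f(1) by (auto simp: injections_def atLeast0LessThan)
  moreover have "image_graph F ?f \<subseteq> \<Gamma>" using img f(2) by (auto simp: image_graph_def)
  ultimately show ?thesis by (auto simp: copies_def)
qed

lemma Union_complete_graph: "2 \<le> t \<Longrightarrow> \<Union>(complete_graph t) = {..<t}"
proof
  show "\<Union>(complete_graph t) \<subseteq> {..<t}" using graph_on_complete[of t] unfolding graph_on_def by blast
  assume t: "2 \<le> t"
  show "{..<t} \<subseteq> \<Union>(complete_graph t)"
  proof
    fix i assume i: "i \<in> {..<t}"
    have "{i, if i = 0 then 1 else 0} \<in> complete_graph t" using i t by (intro complete_graph_edge) auto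
    then show "i \<in> \<Union>(complete_graph t)" by blast
  qed
qed

lemma card_complete_graph: "card (complete_graph t) = t choose 2"
proof -
  have "complete_graph t = {e. e \<subseteq> {..<t} \<and> card e = 2}"
    unfolding complete_graph_def by (auto simp: all_edges_iff)
  then show ?thesis by (simp add: n_subsets)
qed

lemma below_threshold:
  fixes p :: "nat \<Rightarrow> real"
  assumes t: "2 \<le> t" and l: "odd l"
    and p: "\<And>n. 0 \<le> p n \<and> p n \<le> 1" "p \<in> o(\<lambda>n. real n powr (- edge_exponent t))"
  shows "(\<lambda>n. union_prob n (p n) (balanced_bipartite n)
    (\<lambda>F. \<not> is_ramsey F (complete_graph t) t (cycle_graph l) l)) \<longlonglongrightarrow> 1"
proof (rule tendsto_1I)
  show "union_prob n (p n) (balanced_bipartite n)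
    (\<lambda>F. \<not> is_ramsey F (complete_graph t) t (cycle_graph l) l) \<le> 1" for n
    using p(1) by (intro union_prob_le_1) auto
  fix \<epsilon> :: real assume \<epsilon>: "0 < \<epsilon>"
  define m where "m = card (complete_graph t)"
  have m: "1 \<le> m" using card_complete_graph_pos[OF t] by (simp add: m_def)
  \<comment> \<open>The cap at 1 gives \<open>c ^ m \<le> c\<close>, so the first moment stays below
    \<open>\<epsilon>\<close>.\<close>
  define c where "c = min 1 \<epsilon>"
  have c: "0 < c" "c \<le> 1" "c \<le> \<epsilon>" using \<epsilon> by (auto simp: c_def)
  have "\<forall>\<^sub>F n in sequentially. norm (p n) \<le> c * norm (real n powr (- edge_exponent t))"
    using landau_o.smallD[OF p(2) c(1)] .
  then show "\<forall>\<^sub>F n in sequentially. 1 - \<epsilon> \<le> union_prob n (p n) (balanced_bipartite n)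
    (\<lambda>F. \<not> is_ramsey F (complete_graph t) t (cycle_graph l) l)"
    using eventually_gt_at_top[of 0]
  proof eventually_elim
    case (elim n)
    have p01: "0 \<le> p n" "p n \<le> 1" using p(1)[of n] by auto
    have pc: "p n \<le> c * real n powr (- edge_exponent t)" using elim(1) p01 by simp
    have "real n ^ t * p n ^ m \<le> real n ^ t * (c * real n powr (- edge_exponent t)) ^ m"
      using pc p01 by (intro mult_left_mono power_mono) auto
    also have "\<dots> = c ^ m * (real n ^ t * (real n powr (- edge_exponent t)) ^ m)"
      by (simp add: power_mult_distrib)
    also have "real n ^ t * (real n powr (- edge_exponent t)) ^ m = real n powr (t - edge_exponent t * m)"
      using elim(2) by (simp add: powr_diff powr_realpow powr_minus powr_power field_simps)
    \<comment> \<open>This cancellation determines the threshold exponent.\<close>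
    also have "t - edge_exponent t * m = 0"
      using t by (simp add: m_def card_complete_graph real_choose_2 edge_exponent_def)
    also have "c ^ m * real n powr 0 \<le> c"
      using c m elim(2) power_decreasing[of 1 m c] by simp
    finally have exp_le: "real n ^ t * p n ^ m \<le> \<epsilon>" using c by linarith
    have "prob (all_edges n) (p n) (\<lambda>S. has_copy (complete_graph t) t S)
      \<le> prob (all_edges n) (p n) (\<lambda>S. 1 \<le> real (card (copies (complete_graph t) t {..<n} S)))"
    proof (rule prob_mono[OF p01])
      fix S assume S: "S \<subseteq> all_edges n" "has_copy (complete_graph t) t S"
      have "complete_graph t \<noteq> {}" using m by (auto simp: m_def)
      then have "copies (complete_graph t) t {..<n} S \<noteq> {}"
        by (rule has_copy_imp_copies[OF graph_on_complete S(2,1) _ Union_complete_graph[OF t]])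
      then have "0 < card (copies (complete_graph t) t {..<n} S)" by (simp add: card_gt_0_iff)
      then show "1 \<le> real (card (copies (complete_graph t) t {..<n} S))" by linarith
    qed
    also have "\<dots> \<le> expect (all_edges n) (p n) (\<lambda>S. real (card (copies (complete_graph t) t {..<n} S))) / 1"
      by (rule Markov[OF p01]) auto
    also have "\<dots> \<le> \<epsilon>"
      using expect_copies_le[OF graph_on_complete p01, of n t] exp_le by (simp add: m_def)
    finally have "prob (all_edges n) (p n) (\<lambda>S. has_copy (complete_graph t) t S) \<le> \<epsilon>" .
    then have "1 - \<epsilon> \<le> prob (all_edges n) (p n) (\<lambda>S. \<not> has_copy (complete_graph t) t S)"
      by (simp add: prob_not)
    also have "\<dots> \<le> prob (all_edges n) (p n)
      (\<lambda>S. \<not> is_ramsey (balanced_bipartite n \<union> S) (complete_graph t) t (cycle_graph l) l)"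
    proof (rule prob_mono[OF p01])
      fix S assume no: "\<not> has_copy (complete_graph t) t S"
      let ?G = "balanced_bipartite n"
      have "\<not> has_copy (complete_graph t) t (S - ?G)" using no has_copy_mono by blast
      moreover have "?G \<union> S - (S - ?G) = ?G" by blast
      then have "\<not> has_copy (cycle_graph l) l (?G \<union> S - (S - ?G))"
        using no_odd_cycle_balanced_bipartite[OF l] by simp
      ultimately show "\<not> is_ramsey (?G \<union> S) (complete_graph t) t (cycle_graph l) l"
        unfolding is_ramsey_def by blast
    qed
    finally show ?case unfolding union_prob_eq_prob .
  qed
qed

theorem theorem1p12:
  fixes t l :: nat and d :: real
  assumes "t \<ge> 4" and "odd l" and "l \<ge> 5" and "0 < d" and "d \<le> 1/2"
  shows "is_perturbed_ramsey_threshold (\<lambda>n. real n powr (- 2 / (real t - 1)))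
           (complete_graph t) t (cycle_graph l) l d"
proof -
  have exponent: "(\<lambda>n. real n powr (- 2 / (real t - 1))) = (\<lambda>n. real n powr (- edge_exponent t))"
    by (simp add: edge_exponent_def)
  show ?thesis
    unfolding is_perturbed_ramsey_threshold_def exponent
  proof (intro conjI allI impI)
    fix p :: "nat \<Rightarrow> real" and G
    assume "\<forall>n. 0 \<le> p n \<and> p n \<le> 1" "p \<in> \<omega>(\<lambda>n. real n powr (- edge_exponent t))"
      "\<forall>n. G n \<subseteq> all_edges n" "\<forall>\<^sub>F n in sequentially. d \<le> density n (G n)"
    then show "(\<lambda>n. union_prob n (p n) (G n)
        (\<lambda>F. is_ramsey F (complete_graph t) t (cycle_graph l) l)) \<longlonglongrightarrow> 1"
      using assms by (intro above_threshold) auto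
  next
    fix p :: "nat \<Rightarrow> real"
    assume p: "\<forall>n. 0 \<le> p n \<and> p n \<le> 1" "p \<in> o(\<lambda>n. real n powr (- edge_exponent t))"
    \<comment> \<open>The assumption \<open>d \<le> 1 / 2\<close> enters here: the bipartite graph
      has density at least 1/2 as soon as \<open>n\<close> is at least 2.\<close>
    have "\<forall>\<^sub>F n in sequentially. d \<le> density n (balanced_bipartite n)"
      using eventually_ge_at_top[of 2]
    proof eventually_elim
      case (elim n)
      then show ?case using density_balanced_bipartite[OF elim] assms by linarith
    qed
    moreover have "(\<lambda>n. union_prob n (p n) (balanced_bipartite n)
        (\<lambda>F. \<not> is_ramsey F (complete_graph t) t (cycle_graph l) l)) \<longlonglongrightarrow> 1"
      using p assms by (intro below_threshold) auto
    ultimately show "\<exists>G. (\<forall>n. G n \<subseteq> all_edges n) \<and> (\<forall>\<^sub>F n in sequentially. d \<le> density n (G n)) \<and>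
        (\<lambda>n. union_prob n (p n) (G n)
          (\<lambda>F. \<not> is_ramsey F (complete_graph t) t (cycle_graph l) l)) \<longlonglongrightarrow> 1"
      using balanced_bipartite_subset by blast
  qed
qed

end
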